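(* Let $r\ge1$ and let $F^{\mathrm{inst}}(\varepsilon_1,\varepsilon_2,\vec a;\mathfrak q)=\varepsilon_1\varepsilon_2\log Z(\varepsilon_1,\varepsilon_2,\vec a;\mathfrak q)$, where $Z$ is Nekrasov's partition function of rank $r$. Then $F^{\mathrm{inst}}(\varepsilon_1,\varepsilon_2,\vec a;\mathfrak q)$ is regular at $\varepsilon_1=\varepsilon_2=0$; that is, writing $F^{\mathrm{inst}}=\sum_{n\ge1}\mathfrak q^nF^{\mathrm{inst}}_n(\varepsilon_1,\varepsilon_2,\vec a)$, every rational function $F^{\mathrm{inst}}_n$ is regular at $\varepsilon_1=\varepsilon_2=0$.
   Context: For $n\ge 0$ let $M(r,n)$ be the framed moduli space of pairs $(E,\Phi)$, where $E$ is a torsion free sheaf on $\mathbb P^2$ of rank $r$ with $c_2(E)=n$, locally free near $\ell_\infty=\{z_0=0\}$, and $\Phi:E|_{\ell_\infty}\cong\mathcal O_{\ell_\infty}^{\oplus r}$. The torus $\widetilde T=\mathbb C^*\times\mathbb C^*\times(\mathbb C^* )^r$ acts ($(t_1,t_2)$ via the automorphism $[z_0:z_1:z_2]\mapsto[z_0:t_1z_1:t_2z_2]$ of $\mathbb P^2$, $(e_1,\dots,e_r)$ via diagonal change of framing); $\varepsilon_1,\varepsilon_2,\vec a=(a_1,\dots,a_r)$ are the corresponding generators of $H^*_{\widetilde T}(\mathrm{pt})$. Let $\pi:M(r,n)\to M_0(r,n)$ be the projective morphism to the Uhlenbeck (partial) compactification $M_0(r,n)=\{(B_1,B_2,i,j)\mid[B_1,B_2]+ij=0\}/\!/\mathrm{GL}_n(\mathbb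 C)$ (with $B_1,B_2\in\mathrm{End}(\mathbb C^n)$, $i\in\mathrm{Hom}(\mathbb C^r,\mathbb C^n)$, $j\in\mathrm{Hom}(\mathbb C^n,\mathbb C^r)$), and let $\iota_0$ be the inclusion of the unique $\widetilde T$-fixed point of $M_0(r,n)$. In localized equivariant Borel–Moore homology, $$Z(\varepsilon_1,\varepsilon_2,\vec a;\mathfrak q)=\sum_{n\ge0}\mathfrak q^n(\iota_{0*})^{-1}\pi_*[M(r,n)].$$ By localization this is explicitly $$Z=\sum_{\vec Y}\frac{\mathfrak q^{|\vec Y|}}{\prod_{\alpha,\beta=1}^r n^{\vec Y}_{\alpha,\beta}(\varepsilon_1,\varepsilon_2,\vec a)},$$ $$n^{\vec Y}_{\alpha,\beta}=\prod_{s\in Y_\alpha}\big(-l_{Y_\beta}(s)\varepsilon_1+(a_{Y_\alpha}(s)+1)\varepsilon_2+a_\beta-a_\alpha\big)\prod_{t\in Y_\beta}\big((l_{Y_\alpha}(t)+1)\varepsilon_1-a_{Y_\beta}(t)\varepsilon_2+a_\beta-a_\alpha\big),$$ where $\vec Y=(Y_1,\dots,Y_r)$ runs over $r$-tuples of Young diagrams, $|\vec Y|$ is the total number of boxes, and for $Y=(\lambda_1\ge\lambda_2\ge\cdots)$ ($\lambda_i$ the length of the $i$-th column, $\lambda'_j$ the length of the $j$-th row, both $0$ beyond the diagram) and $s=(i,j)$ one puts $a_Y(s)=\lambda_i-j$, $l_Y(s)=\lambda'_j-i$ (possibly negative). A rational function in $\mathbb C(\varepsilon_1,\varepsilon_2,\vec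 a)$ is called regular at $\varepsilon_1=\varepsilon_2=0$ if it can be written as a quotient of polynomials whose denominator does not vanish identically (as a polynomial in $\vec a$) after setting $\varepsilon_1=\varepsilon_2=0$. *)

theory Defs
  imports
    "HOL-Computational_Algebra.Computational_Algebra"
    "HOL-Library.Poly_Mapping"
    "HOL-Library.FuncSet"
    Complex_Main
begin

section \<open>Polynomials and rational functions over the complex numbers\<close>

text \<open>
  A monomial is a finitely supported exponent function on variable indices. The variable with
  index 0 is \<open>\<epsilon>\<^sub>1\<close>, the one with index 1 is \<open>\<epsilon>\<^sub>2\<close>, and the one with index \<open>\<alpha> + 1\<close> is
  \<open>a\<^sub>\<alpha>\<close> for \<open>\<alpha> \<ge> 1\<close>; in rank \<open>r\<close> only the indices below \<open>r + 2\<close> occur.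
\<close>

type_synonym cpoly = "(nat \<Rightarrow>\<^sub>0 nat) \<Rightarrow>\<^sub>0 complex"

type_synonym cratfun = "cpoly fract"

definition pvar :: "nat \<Rightarrow> cpoly" where
  "pvar i = Poly_Mapping.single (Poly_Mapping.single i 1) 1"

definition pconst :: "complex \<Rightarrow> cpoly" where
  "pconst c = Poly_Mapping.single 0 c"

definition eps1 :: cpoly where "eps1 = pvar 0"

definition eps2 :: cpoly where "eps2 = pvar 1"

definition avar :: "nat \<Rightarrow> cpoly" where "avar \<alpha> = pvar (\<alpha> + 1)"

definition pvars :: "cpoly \<Rightarrow> nat set" where
  "pvars p = (\<Union>m\<in>Poly_Mapping.keys p. Poly_Mapping.keys m)"

definition psubst :: "(nat \<Rightarrow> cpoly) \<Rightarrow> cpoly \<Rightarrow> cpoly" where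
  "psubst f p = (\<Sum>m\<in>Poly_Mapping.keys p. pconst (Poly_Mapping.lookup p m) *
     (\<Prod>i\<in>Poly_Mapping.keys m. f i ^ Poly_Mapping.lookup m i))"

definition set_eps_zero :: "cpoly \<Rightarrow> cpoly" where
  "set_eps_zero = psubst (pvar(0 := 0, 1 := 0))"

definition regular_at_eps_zero :: "nat \<Rightarrow> cratfun \<Rightarrow> bool" where
  "regular_at_eps_zero r F \<longleftrightarrow>
     (\<exists>p q. pvars p \<subseteq> {..<r + 2} \<and> pvars q \<subseteq> {..<r + 2} \<and>
            set_eps_zero q \<noteq> 0 \<and> F = Fract p q)"

text \<open>Characteristic zero is needed for the coefficients of the formal logarithm.\<close>

instance fract :: ("{idom, ring_char_0}") semiring_char_0
proof
  show "inj (of_nat :: nat \<Rightarrow> 'a fract)"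
    by (rule injI) (simp add: Fract_of_nat_eq [symmetric] eq_fract)
qed

instance fract :: ("{idom, ring_char_0}") field_char_0 ..


section \<open>Young diagrams\<close>

text \<open>
  Diagrams are sets of boxes \<open>(i, j)\<close> with \<open>i, j \<ge> 1\<close>, where \<open>i\<close> numbers the columns and \<open>j\<close> the
  position within a column.
\<close>

definition young_diagrams :: "(nat \<times> nat) set set" where
  "young_diagrams = {Y. finite Y \<and> Y \<subseteq> {1..} \<times> {1..} \<and>
     (\<forall>i j i' j'. (i, j) \<in> Y \<and> 1 \<le> i' \<and> i' \<le> i \<and> 1 \<le> j' \<and> j' \<le> j \<longrightarrow> (i', j') \<in> Y)}"

definition col_len :: "(nat \<times> nat) set \<Rightarrow> nat \<Rightarrow> nat" where
  "col_len Y i = card {j. (i, j) \<in> Y}"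

definition row_len :: "(nat \<times> nat) set \<Rightarrow> nat \<Rightarrow> nat" where
  "row_len Y j = card {i. (i, j) \<in> Y}"

definition arm :: "(nat \<times> nat) set \<Rightarrow> nat \<times> nat \<Rightarrow> int" where
  "arm Y s = int (col_len Y (fst s)) - int (snd s)"

definition leg :: "(nat \<times> nat) set \<Rightarrow> nat \<times> nat \<Rightarrow> int" where
  "leg Y s = int (row_len Y (snd s)) - int (fst s)"

definition young_tuples :: "nat \<Rightarrow> nat \<Rightarrow> (nat \<Rightarrow> (nat \<times> nat) set) set" where
  "young_tuples r n = {Y \<in> {1..r} \<rightarrow>\<^sub>E young_diagrams. (\<Sum>\<alpha>=1..r. card (Y \<alpha>)) = n}"


section \<open>The instanton partition function\<close>

definition nekrasov_factor ::
    "(nat \<Rightarrow> (nat \<times> nat) set) \<Rightarrow> nat \<Rightarrow> nat \<Rightarrow> cpoly" where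
  "nekrasov_factor Y \<alpha> \<beta> =
     (\<Prod>s\<in>Y \<alpha>. - of_int (leg (Y \<beta>) s) * eps1 + of_int (arm (Y \<alpha>) s + 1) * eps2
                  + avar \<beta> - avar \<alpha>) *
     (\<Prod>t\<in>Y \<beta>. of_int (leg (Y \<alpha>) t + 1) * eps1 - of_int (arm (Y \<beta>) t) * eps2
                  + avar \<beta> - avar \<alpha>)"

text \<open>
  The partition function is introduced through its fixed-point expansion: the torus-fixed points
  of \<open>M(r, n)\<close> are indexed by the \<open>r\<close>-tuples of Young diagrams with \<open>n\<close> boxes in total, and the
  product of the factors is the Euler class of the tangent space at the fixed point.
\<close>

definition nekrasov_Z :: "nat \<Rightarrow> cratfun fps" where
  "nekrasov_Z r = Abs_fps (\<lambda>n. \<Sum>Y\<in>young_tuples r n.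
     1 / to_fract (\<Prod>\<alpha>=1..r. \<Prod>\<beta>=1..r. nekrasov_factor Y \<alpha> \<beta>))"

text \<open>
  \<open>fps_ln 1\<close> is the series of \<open>log (1 + x)\<close>; the logarithm of \<open>G\<close> is obtained by substituting
  \<open>G - 1\<close>, which is meaningful when \<open>G\<close> has constant term 1.
\<close>

definition fps_log :: "'a::field_char_0 fps \<Rightarrow> 'a fps" where
  "fps_log G = fps_compose (fps_ln 1) (G - 1)"

definition F_inst :: "nat \<Rightarrow> cratfun fps" where
  "F_inst r = fps_const (to_fract eps1 * to_fract eps2) * fps_log (nekrasov_Z r)"


section \<open>Well-definedness of the sums, quotients and logarithm above\<close>

lemma young_diagram_subset:
  assumes "Y \<in> young_diagrams"
  shows "Y \<subseteq> {1..card Y} \<times> {1..card Y}"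
proof (clarify)
  fix i j assume ij: "(i, j) \<in> Y"
  have fin: "finite Y" and pos: "1 \<le> i" "1 \<le> j"
    using assms ij unfolding young_diagrams_def by auto
  have cl: "(i', j') \<in> Y" if "1 \<le> i'" "i' \<le> i" "1 \<le> j'" "j' \<le> j" for i' j'
    using assms ij that unfolding young_diagrams_def by blast
  have "{1..i} \<times> {1} \<subseteq> Y" "{1} \<times> {1..j} \<subseteq> Y"
    using cl pos by auto
  from this[THEN card_mono[OF fin]]
  have "i \<le> card Y" "j \<le> card Y" by (simp_all add: card_cartesian_product)
  with pos show "i \<in> {1..card Y} \<and> j \<in> {1..card Y}" by simp
qed

lemma finite_young_tuples: "finite (young_tuples r n)"
proof (rule finite_subset)
  show "young_tuples r n \<subseteq> {1..r} \<rightarrow>\<^sub>E Pow ({1..n} \<times> {1..n})"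
  proof
    fix Y assume Y: "Y \<in> young_tuples r n"
    have "Y \<alpha> \<subseteq> {1..n} \<times> {1..n}" if "\<alpha> \<in> {1..r}" for \<alpha>
    proof -
      have "card (Y \<alpha>) \<le> (\<Sum>\<alpha>=1..r. card (Y \<alpha>))"
        using that by (intro member_le_sum) auto
      then have "card (Y \<alpha>) \<le> n" using Y by (simp add: young_tuples_def)
      moreover have "Y \<alpha> \<in> young_diagrams"
        using Y that by (auto simp: young_tuples_def)
      ultimately show ?thesis using young_diagram_subset[of "Y \<alpha>"] by fastforce
    qed
    then show "Y \<in> {1..r} \<rightarrow>\<^sub>E Pow ({1..n} \<times> {1..n})"
      using Y by (auto simp: young_tuples_def PiE_iff)
  qed
qed (auto intro: finite_PiE)

lemma lookup_linear:
  "Poly_Mapping.lookup (of_int k * pvar i) (Poly_Mapping.single l 1) =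
     (if i = l then of_int k else 0)"
proof -
  have "of_int k * pvar i = Poly_Mapping.single (Poly_Mapping.single i 1) (of_int k :: complex)"
    by (simp add: pvar_def mult_single flip: single_of_int)
  moreover have "Poly_Mapping.single i (1::nat) = Poly_Mapping.single l 1 \<longleftrightarrow> i = l"
    by (metis lookup_single_eq lookup_single_not_eq zero_neq_one)
  ultimately show ?thesis by (simp add: lookup_single when_def)
qed

lemma linear_form_nonzero:
  assumes "\<alpha> \<ge> 1" "\<beta> \<ge> 1" "\<alpha> \<noteq> \<beta> \<or> k \<noteq> 0 \<or> l \<noteq> 0"
  shows "of_int k * eps1 + of_int l * eps2 + avar \<beta> - avar \<alpha> \<noteq> 0" (is "?f \<noteq> 0")
proof
  assume 0: "?f = 0"
  have eq: "?f = of_int k * pvar 0 + of_int l * pvar 1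
              + of_int 1 * pvar (\<beta> + 1) - of_int 1 * pvar (\<alpha> + 1)"
    by (simp add: eps1_def eps2_def avar_def)
  have z: "Poly_Mapping.lookup ?f (Poly_Mapping.single i 1) = 0" for i
    unfolding 0 by simp
  show False
    using z[of 0] z[of 1] z[of "\<beta> + 1"] assms
    unfolding eq lookup_add lookup_minus lookup_linear by (auto split: if_splits)
qed

lemma leg_arm_nonneg:
  assumes "Y \<in> young_diagrams" "s \<in> Y"
  shows "arm Y s \<ge> 0" "leg Y s \<ge> 0"
proof -
  obtain i j where s: "s = (i, j)" by force
  have fin: "finite Y" using assms unfolding young_diagrams_def by auto
  have cl: "(i', j') \<in> Y" if "1 \<le> i'" "i' \<le> i" "1 \<le> j'" "j' \<le> j" for i' j'
    using assms s that unfolding young_diagrams_def by blast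
  have pos: "1 \<le> i" "1 \<le> j" using assms s unfolding young_diagrams_def by auto
  have "finite {j. (i, j) \<in> Y}" "finite {i. (i, j) \<in> Y}"
    by (rule finite_subset[OF _ finite_imageI[OF fin, of snd]], force)
      (rule finite_subset[OF _ finite_imageI[OF fin, of fst]], force)
  moreover have "{1..j} \<subseteq> {j. (i, j) \<in> Y}" "{1..i} \<subseteq> {i. (i, j) \<in> Y}"
    using cl pos by auto
  ultimately have "card {1..j} \<le> card {j. (i, j) \<in> Y}" "card {1..i} \<le> card {i. (i, j) \<in> Y}"
    by (simp_all only: card_mono)
  then show "arm Y s \<ge> 0" "leg Y s \<ge> 0"
    by (simp_all add: arm_def leg_def col_len_def row_len_def s)
qed

lemma nekrasov_factor_nonzero:
  assumes "Y \<in> young_tuples r n" "\<alpha> \<in> {1..r}" "\<beta> \<in> {1..r}"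
  shows "nekrasov_factor Y \<alpha> \<beta> \<noteq> 0"
proof -
  have yd: "Y \<alpha> \<in> young_diagrams" "Y \<beta> \<in> young_diagrams"
    using assms by (auto simp: young_tuples_def)
  have fin: "finite (Y \<alpha>)" "finite (Y \<beta>)"
    using yd by (auto simp: young_diagrams_def)
  have 1: "- of_int (leg (Y \<beta>) s) * eps1 + of_int (arm (Y \<alpha>) s + 1) * eps2
             + avar \<beta> - avar \<alpha> \<noteq> 0" if "s \<in> Y \<alpha>" for s
    using linear_form_nonzero[of \<alpha> \<beta> "- leg (Y \<beta>) s" "arm (Y \<alpha>) s + 1"]
      leg_arm_nonneg[OF yd(1) that] assms by simp
  have 2: "of_int (leg (Y \<alpha>) t + 1) * eps1 - of_int (arm (Y \<beta>) t) * eps2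
             + avar \<beta> - avar \<alpha> \<noteq> 0" if "t \<in> Y \<beta>" for t
    using linear_form_nonzero[of \<alpha> \<beta> "leg (Y \<alpha>) t + 1" "- arm (Y \<beta>) t"]
      leg_arm_nonneg[OF yd(2) that] assms by fastforce
  show ?thesis
    using fin 1 2 by (simp add: nekrasov_factor_def)
qed

lemma nekrasov_Z_nth_0: "fps_nth (nekrasov_Z r) 0 = 1"
proof -
  let ?E = "\<lambda>\<alpha>. if \<alpha> \<in> {1..r} then {} else undefined"
  have "young_tuples r 0 = {?E}"
  proof (intro equalityI subsetI)
    fix Y assume Y: "Y \<in> young_tuples r 0"
    then have "Y \<alpha> = {}" if "\<alpha> \<in> {1..r}" for \<alpha>
      using that by (auto simp: young_tuples_def young_diagrams_def PiE_iff)
    with Y show "Y \<in> {?E}"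
      by (auto simp: young_tuples_def PiE_iff extensional_def fun_eq_iff)
  qed (auto simp: young_tuples_def young_diagrams_def)
  then show ?thesis
    by (simp add: nekrasov_Z_def nekrasov_factor_def)
qed

end

theory Submission
  imports Defs
begin

text \<open>By the arm-leg formula, the denominators of the coefficients of \<open>Z\<close> are products of forms
  that do not vanish at \<open>\<epsilon>\<^sub>1 = \<epsilon>\<^sub>2 = 0\<close> and of forms \<open>k \<epsilon>\<^sub>1 + l \<epsilon>\<^sub>2\<close> with \<open>k l \<le> 0\<close>. It
  suffices to show that \<open>\<epsilon>\<^sub>1 \<epsilon>\<^sub>2 log Z\<close> has no pole along any of the latter hyperplanes, since linear
  forms are prime and can then be cancelled one at a time.

  Along \<open>p \<epsilon>\<^sub>1 = q \<epsilon>\<^sub>2\<close> with \<open>p, q > 0\<close>, already \<open>Z\<close> is regular. Group the tuples of diagrams by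
  the multiset of their contents restricted to the hyperplane and build each group by adding boxes of
  maximal height. The sum of the factors acquired by adding a box is a part of a Lagrange interpolation
  sum \<open>\<Sum>\<^sub>x h x / \<Prod>\<^sub>y (x - y)\<close> that collects all poles in one residue class, and such a sum is regular although
  its terms are not.

  Along \<open>\<epsilon>\<^sub>1 = 0\<close>, encode a tuple of diagrams by the multiset of its columns, with one formal variable per
  column type. Adding a column multiplies the weight by a product of linear functions of the
  multiplicities times \<open>\<epsilon>\<^sub>1\<close>, up to a single factor \<open>1 / \<epsilon>\<^sub>1\<close>. This gives a recursion for the
  logarithmic derivatives of the generating function showing that \<open>\<epsilon>\<^sub>1 log Z\<close> is regular. Transposition of the
  diagrams exchanges \<open>\<epsilon>\<^sub>1\<close> and \<open>\<epsilon>\<^sub>2\<close>.\<close>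

section \<open>Young diagrams and their corners\<close>

text \<open>The axes need a method of their own because \<open>Z\<close> is singular there: in rank
  1 its n-th coefficient is 1 / (n! (e1 e2)^n), so poles of every order occur and only the logarithm
  reduces them to simple ones. What breaks down is a gap used on the other hyperplanes. There the
  heights \<open>q * i + p * j\<close> grow strictly in both directions, and an addable box exceeds
  the highest old box by at most max p q, hence never by p + q. This separates the poles belonging
  to boxes of top height from the artificial poles of the interpolation sum, which are contents of
  addable boxes shifted by e1 + e2. With p = 0 or q = 0 the gap closes. Both methods start from one
  rewriting. In the arm-leg product a new box changes many factors; written as a sum over pairs of
  boxes, its logarithm changes by a sum over corners (new box) or by single linear forms in
  differences of row lengths (new column). The rewriting holds for an arbitrary function of two
  integers with values in an abelian group, so the form vanishing at (0, 0) may be read as 1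
  throughout.\<close>

lemma finite_young: "Y \<in> young_diagrams \<Longrightarrow> finite Y"
  by (simp add: young_diagrams_def)

lemma young_pos: "Y \<in> young_diagrams \<Longrightarrow> (i, j) \<in> Y \<Longrightarrow> 1 \<le> i \<and> 1 \<le> j"
  by (auto simp: young_diagrams_def)

lemma young_down:
  "Y \<in> young_diagrams \<Longrightarrow> (i, j) \<in> Y \<Longrightarrow> 1 \<le> i' \<Longrightarrow> i' \<le> i \<Longrightarrow> 1 \<le> j' \<Longrightarrow> j' \<le> j \<Longrightarrow> (i', j') \<in> Y"
  unfolding young_diagrams_def by blast

lemma down_closed_eq_interval:
  fixes S :: "nat set"
  assumes "finite S" "\<And>j. j \<in> S \<Longrightarrow> 1 \<le> j" "\<And>j k. j \<in> S \<Longrightarrow> 1 \<le> k \<Longrightarrow> k \<le> j \<Longrightarrow> k \<in> S"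
  shows "S = {1..card S}"
proof (cases "S = {}")
  case False
  have "S = {1..Max S}"
  proof (intro equalityI subsetI)
    fix x assume "x \<in> S" then show "x \<in> {1..Max S}" using assms(1,2) by simp
  next
    fix x assume "x \<in> {1..Max S}"
    then show "x \<in> S" using assms(3)[OF Max_in[OF assms(1) False]] by auto
  qed
  then show ?thesis by (metis card_atLeastAtMost diff_Suc_1)
qed simp

lemma young_mem_col:
  assumes "Y \<in> young_diagrams"
  shows "(i, j) \<in> Y \<longleftrightarrow> 1 \<le> i \<and> 1 \<le> j \<and> j \<le> col_len Y i"
proof -
  have fin: "finite {j. (i, j) \<in> Y}"
    by (rule finite_subset[OF _ finite_imageI[OF finite_young[OF assms], of snd]]) force
  have "{j. (i, j) \<in> Y} = {1..col_len Y i}"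
    unfolding col_len_def
    by (rule down_closed_eq_interval[OF fin]) (auto dest: young_pos[OF assms] intro: young_down[OF assms])
  then show ?thesis using young_pos[OF assms] by (auto simp: set_eq_iff)
qed

lemma young_mem_row:
  assumes "Y \<in> young_diagrams"
  shows "(i, j) \<in> Y \<longleftrightarrow> 1 \<le> i \<and> 1 \<le> j \<and> i \<le> row_len Y j"
proof -
  have fin: "finite {i. (i, j) \<in> Y}"
    by (rule finite_subset[OF _ finite_imageI[OF finite_young[OF assms], of fst]]) force
  have "{i. (i, j) \<in> Y} = {1..row_len Y j}"
    unfolding row_len_def
    by (rule down_closed_eq_interval[OF fin]) (auto dest: young_pos[OF assms] intro: young_down[OF assms])
  then show ?thesis using young_pos[OF assms] by (auto simp: set_eq_iff)
qed

lemma empty_young [simp]: "{} \<in> young_diagrams"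
  by (simp add: young_diagrams_def)

lemma col_len_empty [simp]: "col_len {} i = 0" and row_len_empty [simp]: "row_len {} j = 0"
  by (simp_all add: col_len_def row_len_def)

section \<open>Addable and removable boxes\<close>

definition addable :: "(nat \<times> nat) set \<Rightarrow> (nat \<times> nat) set" where
  "addable Y = {(i, j). 1 \<le> i \<and> 1 \<le> j \<and> (i, j) \<notin> Y \<and>
     (i = 1 \<or> (i - 1, j) \<in> Y) \<and> (j = 1 \<or> (i, j - 1) \<in> Y)}"

definition removable :: "(nat \<times> nat) set \<Rightarrow> (nat \<times> nat) set" where
  "removable Y = {(i, j). (i, j) \<in> Y \<and> (i + 1, j) \<notin> Y \<and> (i, j + 1) \<notin> Y}"

lemma young_insert:
  assumes "Y \<in> young_diagrams" "b \<in> addable Y"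
  shows "insert b Y \<in> young_diagrams"
proof -
  obtain p q where b: "b = (p, q)" by force
  have "(i', j') \<in> insert b Y" if "(i, j) \<in> insert b Y" "1 \<le> i'" "i' \<le> i" "1 \<le> j'" "j' \<le> j" for i j i' j'
  proof (cases "(i, j) \<in> Y \<or> (i', j') = b")
    case True then show ?thesis using young_down[OF assms(1)] that by blast
  next
    case False
    then have ij: "i = p" "j = q" "i' < p \<or> j' < q" using that b by auto
    then show ?thesis
    proof (cases "i' < p")
      case True
      then have "(p - 1, q) \<in> Y" using assms b that by (auto simp: addable_def)
      then show ?thesis using young_down[OF assms(1)] that True ij by force
    next
      case F: False
      then have "j' < q" using ij by auto
      then have "(p, q - 1) \<in> Y" using assms b that by (auto simp: addable_def)
      then show ?thesis using young_down[OF assms(1), of p "q - 1" i' j'] that \<open>j' < q\<close> ij by force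
    qed
  qed
  moreover have "finite (insert b Y)" using assms finite_young by auto
  moreover have "insert b Y \<subseteq> {1..} \<times> {1..}"
    using assms b by (auto simp: addable_def young_diagrams_def)
  ultimately show ?thesis unfolding young_diagrams_def by blast
qed

lemma young_remove:
  assumes "Y \<in> young_diagrams" "b \<in> removable Y"
  shows "Y - {b} \<in> young_diagrams" "b \<in> addable (Y - {b})"
proof -
  obtain p q where b: "b = (p, q)" by force
  have bY: "(p, q) \<in> Y" "(p + 1, q) \<notin> Y" "(p, q + 1) \<notin> Y" using assms b by (auto simp: removable_def)
  have pq: "1 \<le> p" "1 \<le> q" using young_pos[OF assms(1) bY(1)] by auto
  have "(i', j') \<noteq> b" if "(i, j) \<in> Y - {b}" "1 \<le> i'" "i' \<le> i" "1 \<le> j'" "j' \<le> j" for i j i' j'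
  proof
    assume e: "(i', j') = b"
    then have "p < i \<or> q < j" using that b by auto
    then show False
    proof
      assume "p < i" then have "(p + 1, q) \<in> Y" using young_down[OF assms(1), of i j "p + 1" q] that e b pq by auto
      then show False using bY by simp
    next
      assume "q < j" then have "(p, q + 1) \<in> Y" using young_down[OF assms(1), of i j p "q + 1"] that e b pq by auto
      then show False using bY by simp
    qed
  qed
  then have "(i', j') \<in> Y - {b}" if "(i, j) \<in> Y - {b}" "1 \<le> i'" "i' \<le> i" "1 \<le> j'" "j' \<le> j" for i j i' j'
    using young_down[OF assms(1)] that by blast
  moreover have "finite (Y - {b})" "Y - {b} \<subseteq> {1..} \<times> {1..}" using assms(1) by (auto simp: young_diagrams_def)
  ultimately show "Y - {b} \<in> young_diagrams" unfolding young_diagrams_def by blast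
  show "b \<in> addable (Y - {b})" using young_down[OF assms(1) bY(1)] pq b
    by (auto simp: addable_def)
qed

lemma young_removable_exists:
  assumes "Y \<in> young_diagrams" "Y \<noteq> {}"
  shows "\<exists>b. b \<in> removable Y"
proof -
  \<comment> \<open>Maximality of i + j over Y excludes both outer neighbours, so such a box is a
    corner.\<close>
  let ?h = "\<lambda>s :: nat \<times> nat. fst s + snd s"
  have fin: "finite (?h ` Y)" using assms finite_young by auto
  obtain b where b: "b \<in> Y" "?h b = Max (?h ` Y)" using Max_in[OF fin] assms(2) by fastforce
  have "?h s \<le> ?h b" if "s \<in> Y" for s using b fin that by auto
  from this[of "(fst b + 1, snd b)"] this[of "(fst b, snd b + 1)"] b(1)
  have "b \<in> removable Y" by (cases b) (auto simp: removable_def)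
  then show ?thesis ..
qed

lemma young_induct [consumes 1, case_names empty insert]:
  assumes "Y \<in> young_diagrams" "P {}"
    and step: "\<And>Y b. Y \<in> young_diagrams \<Longrightarrow> b \<in> addable Y \<Longrightarrow> P Y \<Longrightarrow> P (insert b Y)"
  shows "P Y"
  using assms(1)
proof (induction "card Y" arbitrary: Y rule: less_induct)
  case less
  show ?case
  proof (cases "Y = {}")
    case False
    obtain b where b: "b \<in> removable Y" using young_removable_exists[OF less.prems False] by blast
    have bY: "b \<in> Y" using b by (auto simp: removable_def)
    have "P (Y - {b})"
      by (rule less.hyps[OF card_Diff1_less[OF finite_young[OF less.prems] bY] young_remove(1)[OF less.prems b]])
    from step[OF young_remove[OF less.prems b] this] bY show ?thesis by (simp add: insert_absorb)
  qed (use assms in simp)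
qed

lemma addable_pos: "(p, q) \<in> addable Y \<Longrightarrow> 1 \<le> p \<and> 1 \<le> q \<and> (p, q) \<notin> Y"
  by (auto simp: addable_def)

lemma addable_col_len:
  assumes "Y \<in> young_diagrams" "(p, q) \<in> addable Y"
  shows "col_len Y p = q - 1"
proof -
  have "\<not> q \<le> col_len Y p" "q = 1 \<or> q - 1 \<le> col_len Y p"
    using assms(2) young_mem_col[OF assms(1)] by (auto simp: addable_def)
  then show ?thesis by linarith
qed

lemma addable_row_len:
  assumes "Y \<in> young_diagrams" "(p, q) \<in> addable Y"
  shows "row_len Y q = p - 1"
proof -
  have "\<not> p \<le> row_len Y q" "p = 1 \<or> p - 1 \<le> row_len Y q"
    using assms(2) young_mem_row[OF assms(1)] by (auto simp: addable_def)
  then show ?thesis by linarith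
qed

lemma col_len_insert:
  assumes "Y \<in> young_diagrams" "(p, q) \<in> addable Y"
  shows "col_len (insert (p, q) Y) i = (if i = p then q else col_len Y i)"
proof (cases "i = p")
  case True
  have fin: "finite {j. (p, j) \<in> Y}"
    by (rule finite_subset[OF _ finite_imageI[OF finite_young[OF assms(1)], of snd]]) force
  have "{j. (p, j) \<in> insert (p, q) Y} = insert q {j. (p, j) \<in> Y}" by auto
  then show ?thesis using True addable_col_len[OF assms] addable_pos[OF assms(2)] fin
    by (simp add: col_len_def)
qed (simp add: col_len_def)

lemma row_len_insert:
  assumes "Y \<in> young_diagrams" "(p, q) \<in> addable Y"
  shows "row_len (insert (p, q) Y) j = (if j = q then p else row_len Y j)"
proof (cases "j = q")
  case True
  have fin: "finite {i. (i, q) \<in> Y}"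
    by (rule finite_subset[OF _ finite_imageI[OF finite_young[OF assms(1)], of fst]]) force
  have "{i. (i, q) \<in> insert (p, q) Y} = insert p {i. (i, q) \<in> Y}" by auto
  then show ?thesis using True addable_row_len[OF assms] addable_pos[OF assms(2)] fin
    by (simp add: row_len_def)
qed (simp add: row_len_def)

section \<open>Arm-leg sums and sums over pairs of boxes\<close>

definition arm_leg_sum ::
    "(int \<Rightarrow> int \<Rightarrow> 'b::ab_group_add) \<Rightarrow> (nat \<times> nat) set \<Rightarrow> (nat \<times> nat) set \<Rightarrow> 'b" where
  "arm_leg_sum F \<mu> \<nu> =
     (\<Sum>(i, j)\<in>\<mu>. F (int i - int (row_len \<nu> j)) (int (col_len \<mu> i) - int j + 1)) +
     (\<Sum>(i, j)\<in>\<nu>. F (int (row_len \<mu> j) - int i + 1) (int j - int (col_len \<nu> i)))"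

text \<open>For characters t1^x t2^y in place of F this is multiplication by -(1 - t1)(1 -
  t2).\<close>

definition mixed_diff :: "(int \<Rightarrow> int \<Rightarrow> 'b::ab_group_add) \<Rightarrow> int \<Rightarrow> int \<Rightarrow> 'b" where
  "mixed_diff F x y = F (x + 1) y + F x (y + 1) - F x y - F (x + 1) (y + 1)"

text \<open>The class of the ADHM complex at a fixed point, with F applied to each weight: the
  single sums come from the maps i and j, the double sum from B1, B2, the gauge group and the moment
  map equation. \<open>arm_leg_sum\<close> lists the same class without cancellation.\<close>

definition box_pair_sum ::
    "(int \<Rightarrow> int \<Rightarrow> 'b::ab_group_add) \<Rightarrow> (nat \<times> nat) set \<Rightarrow> (nat \<times> nat) set \<Rightarrow> 'b" where
  "box_pair_sum F \<mu> \<nu> =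
     (\<Sum>(i, j)\<in>\<mu>. F (int i) (int j)) + (\<Sum>(i, j)\<in>\<nu>. F (1 - int i) (1 - int j)) +
     (\<Sum>(i, j)\<in>\<mu>. \<Sum>(k, l)\<in>\<nu>. mixed_diff F (int i - int k) (int j - int l))"

text \<open>Only the summands of column p see the changed column length, so both sums split into the
  untouched columns and this one.\<close>

lemma sum_col_len_insert:
  fixes G :: "nat \<Rightarrow> nat \<Rightarrow> nat \<Rightarrow> 'b::ab_group_add"
  assumes "Y \<in> young_diagrams" "(p, q) \<in> addable Y"
  shows "(\<Sum>(i, j)\<in>insert (p, q) Y. G i j (col_len (insert (p, q) Y) i)) =
    (\<Sum>(i, j)\<in>Y. G i j (col_len Y i)) + ((\<Sum>j=1..q. G p j q) - (\<Sum>j=1..<q. G p j (q - 1)))"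
proof -
  let ?Y = "insert (p, q) Y" and ?R = "{s\<in>Y. fst s \<noteq> p}"
  note fin = finite_young[OF assms(1)] and y' = young_insert[OF assms]
  have pos: "1 \<le> p" "1 \<le> q" using addable_pos[OF assms(2)] by auto
  have 1: "?Y = ?R \<union> Pair p ` {1..q}"
  proof (intro set_eqI)
    fix s show "s \<in> ?Y \<longleftrightarrow> s \<in> ?R \<union> Pair p ` {1..q}"
      using young_mem_col[OF y', of "fst s" "snd s"] col_len_insert[OF assms, of "fst s"] pos
      by (cases s) (auto simp: image_iff)
  qed
  have 2: "Y = ?R \<union> Pair p ` {1..<q}"
    using young_mem_col[OF assms(1)] addable_col_len[OF assms] pos by (auto simp: image_iff)
  have "(\<Sum>(i, j)\<in>?Y. G i j (col_len ?Y i)) =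
      (\<Sum>(i, j)\<in>?R. G i j (col_len ?Y i)) + (\<Sum>(i, j)\<in>Pair p ` {1..q}. G i j (col_len ?Y i))"
    by (subst (1) 1, rule sum.union_disjoint) (use fin in auto)
  also have "(\<Sum>(i, j)\<in>?R. G i j (col_len ?Y i)) = (\<Sum>(i, j)\<in>?R. G i j (col_len Y i))"
    by (rule sum.cong) (auto simp: col_len_insert[OF assms])
  also have "(\<Sum>(i, j)\<in>Pair p ` {1..q}. G i j (col_len ?Y i)) = (\<Sum>j=1..q. G p j q)"
    by (subst sum.reindex) (auto simp: inj_on_def col_len_insert[OF assms])
  finally have A: "(\<Sum>(i, j)\<in>?Y. G i j (col_len ?Y i)) =
      (\<Sum>(i, j)\<in>?R. G i j (col_len Y i)) + (\<Sum>j=1..q. G p j q)" .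
  have "(\<Sum>(i, j)\<in>Y. G i j (col_len Y i)) =
      (\<Sum>(i, j)\<in>?R. G i j (col_len Y i)) + (\<Sum>(i, j)\<in>Pair p ` {1..<q}. G i j (col_len Y i))"
    by (subst (1) 2, rule sum.union_disjoint) (use fin in auto)
  also have "(\<Sum>(i, j)\<in>Pair p ` {1..<q}. G i j (col_len Y i)) = (\<Sum>j=1..<q. G p j (q - 1))"
    by (subst sum.reindex) (auto simp: inj_on_def addable_col_len[OF assms])
  finally show ?thesis using A by simp
qed

lemma sum_row_len_insert:
  fixes H :: "nat \<Rightarrow> nat \<Rightarrow> 'b::ab_group_add"
  assumes "Y \<in> young_diagrams" "(k, l) \<in> addable Y" "finite S"
  shows "(\<Sum>j\<in>S. H j (row_len (insert (k, l) Y) j)) =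
    (\<Sum>j\<in>S. H j (row_len Y j)) + (if l \<in> S then H l k - H l (k - 1) else 0)"
proof -
  have "(\<Sum>j\<in>S. H j (row_len (insert (k, l) Y) j)) =
      (\<Sum>j\<in>S. H j (row_len Y j) + (if j = l then H l k - H l (k - 1) else 0))"
    by (rule sum.cong) (auto simp: row_len_insert[OF assms(1,2)] addable_row_len[OF assms(1,2)])
  then show ?thesis using assms(3) by (simp add: sum.distrib)
qed

text \<open>The two insertions interact only where column p of \<open>\<mu>\<close> meets row l, or
  column k of \<open>\<nu>\<close> meets row q, so the second difference consists of a few values of
  F.\<close>

lemma arm_leg_sum_mixed_diff:
  fixes F :: "int \<Rightarrow> int \<Rightarrow> 'b::ab_group_add"
  assumes \<mu>: "\<mu> \<in> young_diagrams" "(p, q) \<in> addable \<mu>"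
    and \<nu>: "\<nu> \<in> young_diagrams" "(k, l) \<in> addable \<nu>"
  shows "arm_leg_sum F (insert (p, q) \<mu>) (insert (k, l) \<nu>) =
    arm_leg_sum F (insert (p, q) \<mu>) \<nu> + arm_leg_sum F \<mu> (insert (k, l) \<nu>) - arm_leg_sum F \<mu> \<nu> +
    mixed_diff F (int p - int k) (int q - int l)"
proof -
  define A1 where "A1 \<mu> \<nu> = (\<Sum>(i, j)\<in>\<mu>. F (int i - int (row_len \<nu> j)) (int (col_len \<mu> i) - int j + 1))" for \<mu> \<nu>
  define A2 where "A2 \<mu> \<nu> = (\<Sum>(i, j)\<in>\<nu>. F (int (row_len \<mu> j) - int i + 1) (int j - int (col_len \<nu> i)))" for \<mu> \<nu>
  define D1 where "D1 \<nu> = (\<Sum>j=1..q. F (int p - int (row_len \<nu> j)) (int q - int j + 1)) -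
     (\<Sum>j=1..<q. F (int p - int (row_len \<nu> j)) (int (q - 1) - int j + 1))" for \<nu>
  define D2 where "D2 \<mu> = (\<Sum>j=1..l. F (int (row_len \<mu> j) - int k + 1) (int j - int l)) -
     (\<Sum>j=1..<l. F (int (row_len \<mu> j) - int k + 1) (int j - int (l - 1)))" for \<mu>
  have A1: "A1 (insert (p, q) \<mu>) \<nu>' = A1 \<mu> \<nu>' + D1 \<nu>'" for \<nu>'
    unfolding A1_def D1_def
    by (rule sum_col_len_insert[OF \<mu>, of "\<lambda>i j c. F (int i - int (row_len \<nu>' j)) (int c - int j + 1)"])
  have A2: "A2 \<mu>' (insert (k, l) \<nu>) = A2 \<mu>' \<nu> + D2 \<mu>'" for \<mu>'
    unfolding A2_def D2_def
    by (rule sum_col_len_insert[OF \<nu>, of "\<lambda>i j c. F (int (row_len \<mu>' j) - int i + 1) (int j - int c)"])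
  have pos: "1 \<le> p" "1 \<le> q" "1 \<le> k" "1 \<le> l" using addable_pos \<mu> \<nu> by blast+
  have D1: "D1 (insert (k, l) \<nu>) = D1 \<nu> +
      (if l \<le> q then F (int p - int k) (int q - int l + 1) - F (int p - int (k - 1)) (int q - int l + 1) else 0) -
      (if l < q then F (int p - int k) (int (q - 1) - int l + 1) - F (int p - int (k - 1)) (int (q - 1) - int l + 1) else 0)"
    unfolding D1_def
    using pos sum_row_len_insert[OF \<nu>, of "{1..q}" "\<lambda>j c. F (int p - int c) (int q - int j + 1)"]
      sum_row_len_insert[OF \<nu>, of "{1..<q}" "\<lambda>j c. F (int p - int c) (int (q - 1) - int j + 1)"]
    by simp
  have D2: "D2 (insert (p, q) \<mu>) = D2 \<mu> +
      (if q \<le> l then F (int p - int k + 1) (int q - int l) - F (int (p - 1) - int k + 1) (int q - int l) else 0) -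
      (if q < l then F (int p - int k + 1) (int q - int (l - 1)) - F (int (p - 1) - int k + 1) (int q - int (l - 1)) else 0)"
    unfolding D2_def
    using pos sum_row_len_insert[OF \<mu>, of "{1..l}" "\<lambda>j c. F (int c - int k + 1) (int j - int l)"]
      sum_row_len_insert[OF \<mu>, of "{1..<l}" "\<lambda>j c. F (int c - int k + 1) (int j - int (l - 1))"]
    by simp
  define x y where xy: "x = int p - int k" "y = int q - int l"
  have nat: "int p - int (k - 1) = x + 1" "int (q - 1) - int l + 1 = y"
    "int (p - 1) - int k + 1 = x" "int q - int (l - 1) = y + 1" "int p - int k = x" "int q - int l = y"
    using pos xy by linarith+
  have *: "arm_leg_sum F \<mu> \<nu> = A1 \<mu> \<nu> + A2 \<mu> \<nu>" for \<mu> \<nu>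
    by (simp add: arm_leg_sum_def A1_def A2_def)
  note D = D1[unfolded nat] D2[unfolded nat]
  \<comment> \<open>For l < q only the first sum of \<open>arm_leg_sum\<close> contributes, for q <
    l only the second, for l = q both.\<close>
  consider "l < q" | "l = q" "y = 0" | "q < l" using xy by linarith
  then show ?thesis
    unfolding * A1 A2 D nat mixed_diff_def by cases (simp_all add: algebra_simps)
qed

text \<open>The row lengths of the empty diagram are 0, and along each column of
  \<open>\<nu>\<close> the numbers j - col_len are the numbers 1 - j in reverse order.\<close>

lemma arm_leg_sum_empty_left:
  assumes "\<nu> \<in> young_diagrams"
  shows "arm_leg_sum F {} \<nu> = (\<Sum>(i, j)\<in>\<nu>. F (1 - int i) (1 - int j))"
proof -
  have "(\<Sum>(i, j)\<in>\<nu>. F (1 - int i) (int j - int (col_len \<nu> i))) = (\<Sum>(i, j)\<in>\<nu>. F (1 - int i) (1 - int j))"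
    using assms
  proof (induction rule: young_induct)
    case (insert Y b)
    obtain k l where b: "b = (k, l)" by force
    note Y = insert.hyps[unfolded b]
    have pos: "1 \<le> k" "1 \<le> l" "(k, l) \<notin> Y" using addable_pos[OF Y(2)] by auto
    have "(\<Sum>j=1..l. F (1 - int k) (int j - int l)) = (\<Sum>j=1..<l. F (1 - int k) (int j - int (l - 1))) + F (1 - int k) (1 - int l)"
    proof -
      have "(\<Sum>j=1..l. F (1 - int k) (int j - int l)) = F (1 - int k) (1 - int l) + (\<Sum>j=Suc 1..l. F (1 - int k) (int j - int l))"
        using pos by (subst sum.atLeast_Suc_atMost) auto
      also have "(\<Sum>j=Suc 1..l. F (1 - int k) (int j - int l)) = (\<Sum>j=Suc 1..<Suc l. F (1 - int k) (int j - int l))"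
        by (rule sum.cong) auto
      also have "\<dots> = (\<Sum>j=1..<l. F (1 - int k) (int j - int (l - 1)))"
        by (subst sum.shift_bounds_Suc_ivl) (rule sum.cong, auto simp: of_nat_diff algebra_simps)
      finally show ?thesis by (simp add: add.commute)
    qed
    then show ?case
      using insert.IH pos finite_young[OF Y(1)]
        sum_col_len_insert[OF Y, of "\<lambda>i j c. F (1 - int i) (int j - int c)"] b
      by simp
  qed simp
  then show ?thesis by (simp add: arm_leg_sum_def add.commute)
qed

lemma arm_leg_sum_empty_right:
  assumes "\<mu> \<in> young_diagrams"
  shows "arm_leg_sum F \<mu> {} = (\<Sum>(i, j)\<in>\<mu>. F (int i) (int j))"
proof -
  have "(\<Sum>(i, j)\<in>\<mu>. F (int i) (int (col_len \<mu> i) - int j + 1)) = (\<Sum>(i, j)\<in>\<mu>. F (int i) (int j))"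
    using assms
  proof (induction rule: young_induct)
    case (insert Y b)
    obtain p q where b: "b = (p, q)" by force
    note Y = insert.hyps[unfolded b]
    have pos: "1 \<le> p" "1 \<le> q" "(p, q) \<notin> Y" using addable_pos[OF Y(2)] by auto
    have "(\<Sum>j=1..q. F (int p) (int q - int j + 1)) = (\<Sum>j=1..q. F (int p) (int j))"
      by (rule sum.reindex_bij_witness[of _ "\<lambda>j. q + 1 - j" "\<lambda>j. q + 1 - j"])
        (auto intro!: arg_cong[of _ _ "F (int p)"])
    moreover have "(\<Sum>j=1..<q. F (int p) (int (q - 1) - int j + 1)) = (\<Sum>j=1..<q. F (int p) (int j))"
      by (rule sum.reindex_bij_witness[of _ "\<lambda>j. q - j" "\<lambda>j. q - j"]) (auto simp: of_nat_diff)
    moreover have "{1..q} = insert q {1..<q}" using pos by auto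
    ultimately show ?case
      using insert.IH pos finite_young[OF Y(1)]
        sum_col_len_insert[OF Y, of "\<lambda>i j c. F (int i) (int c - int j + 1)"] b
      by simp
  qed simp
  then show ?thesis by (simp add: arm_leg_sum_def)
qed

lemma arm_leg_sum_insert_left:
  assumes \<mu>: "\<mu> \<in> young_diagrams" "(p, q) \<in> addable \<mu>" and \<nu>: "\<nu> \<in> young_diagrams"
  shows "arm_leg_sum F (insert (p, q) \<mu>) \<nu> = arm_leg_sum F \<mu> \<nu> + F (int p) (int q) +
    (\<Sum>(k, l)\<in>\<nu>. mixed_diff F (int p - int k) (int q - int l))"
  using \<nu>
proof (induction rule: young_induct)
  case empty
  show ?case using addable_pos[OF \<mu>(2)] finite_young[OF \<mu>(1)]
    by (simp add: arm_leg_sum_empty_right \<mu> young_insert add.commute)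
next
  case (insert Y b)
  obtain k l where b: "b = (k, l)" by force
  note Y = insert.hyps[unfolded b]
  show ?case using insert.IH addable_pos[OF Y(2)] finite_young[OF Y(1)]
    by (simp add: b arm_leg_sum_mixed_diff[OF \<mu> Y] algebra_simps)
qed

text \<open>Both sides agree when one diagram is empty and acquire the same
  \<open>mixed_diff\<close> term when a box is added to each, so two inductions over boxes suffice.
  Since F is arbitrary, its value at (0, 0) can later be chosen at will.\<close>

theorem arm_leg_sum_eq_box_pair_sum:
  assumes "\<mu> \<in> young_diagrams" "\<nu> \<in> young_diagrams"
  shows "arm_leg_sum F \<mu> \<nu> = box_pair_sum F \<mu> \<nu>"
  using assms(1)
proof (induction rule: young_induct)
  case empty
  show ?case by (simp add: arm_leg_sum_empty_left[OF assms(2)] box_pair_sum_def)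
next
  case (insert Y b)
  obtain k l where b: "b = (k, l)" by force
  note Y = insert.hyps[unfolded b]
  show ?case using insert.IH addable_pos[OF Y(2)] finite_young[OF Y(1)]
    by (simp add: b arm_leg_sum_insert_left[OF Y assms(2)] box_pair_sum_def algebra_simps)
qed

section \<open>Counting the corners of a diagram\<close>

lemma addable_removable_finite:
  assumes "Y \<in> young_diagrams"
  shows "finite (addable Y)" "finite (removable Y)"
proof -
  have "addable Y \<subseteq> insert (1, 1) ((\<lambda>(i, j). (i + 1, j)) ` Y \<union> (\<lambda>(i, j). (i, j + 1)) ` Y)"
  proof
    fix x assume "x \<in> addable Y"
    then obtain i j where "x = (i, j)" "1 \<le> i" "1 \<le> j" "i = 1 \<or> (i - 1, j) \<in> Y" "j = 1 \<or> (i, j - 1) \<in> Y"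
      by (auto simp: addable_def)
    then show "x \<in> insert (1, 1) ((\<lambda>(i, j). (i + 1, j)) ` Y \<union> (\<lambda>(i, j). (i, j + 1)) ` Y)"
      by (cases "i = 1"; cases "j = 1") (force simp: image_iff)+
  qed
  then show "finite (addable Y)" using finite_young[OF assms] by (auto intro: finite_subset)
  show "finite (removable Y)" by (rule finite_subset[OF _ finite_young[OF assms]]) (auto simp: removable_def)
qed

text \<open>The local identity behind \<open>corner_mset\<close> at a point (i, j): a, b, c, e say
  that (i, j), (i - 1, j), (i, j - 1), (i - 1, j - 1) lie in Y, and I, J that i = 1, j = 1. The
  premises express that Y is closed downwards.\<close>

lemma corner_count:
  "\<lbrakk>b \<longrightarrow> \<not> I; c \<longrightarrow> \<not> J; e \<longrightarrow> \<not> I \<and> \<not> J; a \<and> \<not> I \<longrightarrow> b; a \<and> \<not> J \<longrightarrow> c; b \<and> \<not> J \<longrightarrow> e; c \<and> \<not> I \<longrightarrow> e\<rbrakk>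
   \<Longrightarrow> (of_bool (\<not> a \<and> (I \<or> b) \<and> (J \<or> c)) :: nat) + of_bool a + of_bool e =
     of_bool (I \<and> J) + of_bool (e \<and> \<not> c \<and> \<not> b) + of_bool b + of_bool c"
  by (cases a; cases I; cases J; cases b; cases c; cases e; simp)

text \<open>Both sides count each lattice point equally often: the boundary of \<open>Y\<close> turns exactly at its corners.\<close>

lemma corner_mset:
  assumes "Y \<in> young_diagrams"
  shows "mset_set (addable Y) + mset_set Y + mset_set ((\<lambda>(i, j). (i + 1, j + 1)) ` Y) =
    {#(1, 1)#} + mset_set ((\<lambda>(i, j). (i + 1, j + 1)) ` removable Y) +
      mset_set ((\<lambda>(i, j). (i + 1, j)) ` Y) + mset_set ((\<lambda>(i, j). (i, j + 1)) ` Y)"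
    (is "?L = ?R")
proof (rule multiset_eqI)
  fix x :: "nat \<times> nat"
  obtain i j where x: "x = (i, j)" by force
  note fin = finite_young[OF assms] addable_removable_finite[OF assms]
  have cnt: "count (mset_set A) x = of_bool (x \<in> A)" if "finite A" for A
    using that by (simp add: count_mset_set')
  have im: "(i, j) \<in> (\<lambda>(i, j). (i + 1, j + 1)) ` A \<longleftrightarrow> 1 \<le> i \<and> 1 \<le> j \<and> (i - 1, j - 1) \<in> A"
    "(i, j) \<in> (\<lambda>(i, j). (i + 1, j)) ` A \<longleftrightarrow> 1 \<le> i \<and> (i - 1, j) \<in> A"
    "(i, j) \<in> (\<lambda>(i, j). (i, j + 1)) ` A \<longleftrightarrow> 1 \<le> j \<and> (i, j - 1) \<in> A" for A
    by (force simp: image_iff)+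
  have d: "(i, j) \<in> Y \<Longrightarrow> 1 \<le> i \<and> 1 \<le> j" "(i - 1, j) \<in> Y \<Longrightarrow> 2 \<le> i \<and> 1 \<le> j"
    "(i, j - 1) \<in> Y \<Longrightarrow> 1 \<le> i \<and> 2 \<le> j" "(i - 1, j - 1) \<in> Y \<Longrightarrow> 2 \<le> i \<and> 2 \<le> j"
    using young_pos[OF assms, of i j] young_pos[OF assms, of "i - 1" j]
      young_pos[OF assms, of i "j - 1"] young_pos[OF assms, of "i - 1" "j - 1"] by auto
  have e: "(i, j) \<in> Y \<Longrightarrow> 2 \<le> i \<Longrightarrow> (i - 1, j) \<in> Y" "(i, j) \<in> Y \<Longrightarrow> 2 \<le> j \<Longrightarrow> (i, j - 1) \<in> Y"
    "(i - 1, j) \<in> Y \<Longrightarrow> 2 \<le> j \<Longrightarrow> (i - 1, j - 1) \<in> Y"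
    "(i, j - 1) \<in> Y \<Longrightarrow> 2 \<le> i \<Longrightarrow> (i - 1, j - 1) \<in> Y"
    using young_down[OF assms, of i j "i - 1" j] young_down[OF assms, of i j i "j - 1"]
      young_down[OF assms, of "i - 1" j "i - 1" "j - 1"] young_down[OF assms, of i "j - 1" "i - 1" "j - 1"] d
    by auto
  have r: "(i - 1, j - 1) \<in> removable Y \<longleftrightarrow> (i - 1, j - 1) \<in> Y \<and> (i, j - 1) \<notin> Y \<and> (i - 1, j) \<notin> Y"
    if "1 \<le> i" "1 \<le> j" using that by (simp add: removable_def)
  have a: "(i, j) \<in> addable Y \<longleftrightarrow> 1 \<le> i \<and> 1 \<le> j \<and> (i, j) \<notin> Y \<and> (i = 1 \<or> (i - 1, j) \<in> Y) \<and> (j = 1 \<or> (i, j - 1) \<in> Y)"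
    by (simp add: addable_def)
  show "count ?L x = count ?R x"
  proof (cases "1 \<le> i \<and> 1 \<le> j")
    case True
    have one: "count {#(1, 1)#} (i, j) = of_bool (i = 1 \<and> j = 1)" by auto
    have le: "2 \<le> i \<longleftrightarrow> i \<noteq> 1" "2 \<le> j \<longleftrightarrow> j \<noteq> 1" using True by auto
    show ?thesis
      unfolding x count_union cnt[unfolded x, OF fin(1)] cnt[unfolded x, OF fin(2)]
        cnt[unfolded x, OF finite_imageI[OF fin(1)]] cnt[unfolded x, OF finite_imageI[OF fin(3)]] im one a
        r[OF conjunct1[OF True] conjunct2[OF True]]
      by (simp only: simp_thms True, rule corner_count) (use True d e in \<open>unfold le, blast+\<close>)
  next
    \<comment> \<open>Truncated subtraction makes the points with a zero coordinate a separate case;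
      they have multiplicity 0 on both sides.\<close>
    case False
    have z: "((i, j) \<in> Y) = False" "(1 \<le> i \<and> (i - 1, j) \<in> Y) = False" "(1 \<le> j \<and> (i, j - 1) \<in> Y) = False"
      "((i, j) \<in> addable Y) = False" "count {#(1, 1)#} (i, j) = 0"
      using False d unfolding a by auto
    have z': "(1 \<le> i \<and> 1 \<le> j \<and> P) = False" for P using False by blast
    show ?thesis
      unfolding x count_union cnt[unfolded x, OF fin(1)] cnt[unfolded x, OF fin(2)]
        cnt[unfolded x, OF finite_imageI[OF fin(1)]] cnt[unfolded x, OF finite_imageI[OF fin(3)]] im z z'
      by simp
  qed
qed

text \<open>Second differences telescope to the corners. Applied to the pairs of a new box with all
  old ones, this replaces a sum over boxes by one over corners.\<close>

lemma corner_sum: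
  fixes f :: "nat \<times> nat \<Rightarrow> 'b::ab_group_add"
  assumes "Y \<in> young_diagrams"
  shows "f (1, 1) + (\<Sum>(i, j)\<in>Y. f (i + 1, j) + f (i, j + 1) - f (i, j) - f (i + 1, j + 1)) =
    sum f (addable Y) - (\<Sum>(i, j)\<in>removable Y. f (i + 1, j + 1))"
proof -
  have m: "sum_mset (image_mset f (mset_set A)) = sum f A" for A by (simp add: sum_unfold_sum_mset)
  have im: "sum f ((\<lambda>(i, j). (i + c, j + d)) ` A) = (\<Sum>(i, j)\<in>A. f (i + c, j + d))" for A and c d :: nat
    by (subst sum.reindex) (auto simp: inj_on_def case_prod_unfold)
  note arg_cong[OF corner_mset[OF assms], of "\<lambda>M. sum_mset (image_mset f M)"]
  then have "sum f (addable Y) + sum f Y + (\<Sum>(i, j)\<in>Y. f (i + 1, j + 1)) =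
      f (1, 1) + (\<Sum>(i, j)\<in>removable Y. f (i + 1, j + 1)) + (\<Sum>(i, j)\<in>Y. f (i + 1, j)) + (\<Sum>(i, j)\<in>Y. f (i, j + 1))"
    using im[of 1 1] im[of 1 0] im[of 0 1] by (simp add: m)
  moreover have "(\<Sum>(i, j)\<in>Y. f (i + 1, j) + f (i, j + 1) - f (i, j) - f (i + 1, j + 1)) =
      (\<Sum>(i, j)\<in>Y. f (i + 1, j)) + (\<Sum>(i, j)\<in>Y. f (i, j + 1)) - sum f Y - (\<Sum>(i, j)\<in>Y. f (i + 1, j + 1))"
    by (simp add: sum.distrib sum_subtractf case_prod_unfold)
  moreover have "u + (B + C - y - D) = A - R" if "A + y + D = u + R + B + C" for u A B C D R y :: 'b
  proof -
    have "A = u + R + B + C - D - y" using that by (metis add_diff_cancel_right')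
    then show ?thesis by (simp add: algebra_simps)
  qed
  ultimately show ?thesis by presburger
qed

text \<open>This version is kept free of inverses because it is applied to power series.\<close>

lemma corner_prod:
  fixes f :: "nat \<times> nat \<Rightarrow> 'b::comm_monoid_mult"
  assumes "Y \<in> young_diagrams"
  shows "prod f (addable Y) * (\<Prod>(i, j)\<in>Y. f (i, j) * f (i + 1, j + 1)) =
    f (1, 1) * (\<Prod>(i, j)\<in>removable Y. f (i + 1, j + 1)) * (\<Prod>(i, j)\<in>Y. f (i + 1, j) * f (i, j + 1))"
proof -
  have m: "prod_mset (image_mset f (mset_set A)) = prod f A" for A by (simp add: prod_unfold_prod_mset)
  have im: "prod f ((\<lambda>(i, j). (i + c, j + d)) ` A) = (\<Prod>(i, j)\<in>A. f (i + c, j + d))" for A and c d :: nat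
    by (subst prod.reindex) (auto simp: inj_on_def case_prod_unfold)
  have "prod f (addable Y) * prod f Y * (\<Prod>(i, j)\<in>Y. f (i + 1, j + 1)) =
      f (1, 1) * (\<Prod>(i, j)\<in>removable Y. f (i + 1, j + 1)) * (\<Prod>(i, j)\<in>Y. f (i + 1, j)) * (\<Prod>(i, j)\<in>Y. f (i, j + 1))"
    using arg_cong[OF corner_mset[OF assms], of "\<lambda>M. prod_mset (image_mset f M)"] im[of 1 1] im[of 1 0] im[of 0 1]
    unfolding image_mset_union prod_mset.union m by simp
  then show ?thesis
    by (simp add: prod.distrib case_prod_unfold mult_ac)
qed

lemma corner_card:
  assumes "Y \<in> young_diagrams"
  shows "card (addable Y) = card (removable Y) + 1"
proof -
  have "card ((\<lambda>(i, j). (i + 1, j + 1)) ` removable Y) = card (removable Y)"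
    "card ((\<lambda>(i, j). (i + 1, j + 1)) ` Y) = card Y" "card ((\<lambda>(i, j). (i + 1, j)) ` Y) = card Y"
    "card ((\<lambda>(i, j). (i, j + 1)) ` Y) = card Y"
    by (rule card_image, auto simp: inj_on_def)+
  then show ?thesis using arg_cong[OF corner_mset[OF assms], of size] by simp
qed

section \<open>The multiplicative group of a field, written additively\<close>

text \<open>Through this group, identities such as \<open>arm_leg_sum_eq_box_pair_sum\<close> and
  \<open>corner_sum\<close> become identities between products and quotients of nonzero field
  elements.\<close>

typedef (overloaded) 'a nz = "{x :: 'a::field. x \<noteq> 0}" morphisms of_nz to_nz
  by (rule exI[of _ 1]) simp

setup_lifting type_definition_nz

instantiation nz :: (field) ab_group_add
begin
lift_definition zero_nz :: "'a nz" is 1 by simp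
lift_definition plus_nz :: "'a nz \<Rightarrow> 'a nz \<Rightarrow> 'a nz" is "(*)" by simp
lift_definition uminus_nz :: "'a nz \<Rightarrow> 'a nz" is inverse by simp
lift_definition minus_nz :: "'a nz \<Rightarrow> 'a nz \<Rightarrow> 'a nz" is "(/)" by simp
instance by standard (transfer; simp add: field_simps)+
end

lemma of_nz_zero [simp]: "of_nz 0 = 1" by (rule zero_nz.rep_eq)
lemma of_nz_add [simp]: "of_nz (x + y) = of_nz x * of_nz y" by (rule plus_nz.rep_eq)
lemma of_nz_uminus [simp]: "of_nz (- x) = inverse (of_nz x)" by (rule uminus_nz.rep_eq)
lemma of_nz_diff [simp]: "of_nz (x - y) = of_nz x / of_nz y" by (rule minus_nz.rep_eq)
lemma of_nz_neq_0 [simp]: "of_nz x \<noteq> 0" by transfer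
lemma of_nz_sum: "of_nz (sum f A) = (\<Prod>x\<in>A. of_nz (f x))"
  by (induction A rule: infinite_finite_induct) simp_all

text \<open>A vanishing linear form is sent to the neutral element and so contributes the factor
  1.\<close>

lift_definition star :: "'a::field \<Rightarrow> 'a nz" is "\<lambda>x. if x = 0 then 1 else x" by simp

lemma of_nz_star: "of_nz (star x) = (if x = 0 then 1 else x)" by (rule star.rep_eq)

section \<open>Weights of tuples of diagrams\<close>

text \<open>Field and parameters are abstract so that the results can be applied again with e1 and
  e2 exchanged.\<close>

locale nekrasov_params =
  fixes r :: nat and e1 e2 :: "'a::field_char_0" and a :: "nat \<Rightarrow> 'a"
  assumes generic: "\<lbrakk>\<alpha> \<in> {1..r}; \<beta> \<in> {1..r}; \<alpha> \<noteq> \<beta> \<or> k \<noteq> 0 \<or> l \<noteq> 0\<rbrakk> \<Longrightarrow>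
    of_int k * e1 + of_int l * e2 + a \<beta> - a \<alpha> \<noteq> 0"
begin

definition slin :: "nat \<Rightarrow> nat \<Rightarrow> int \<Rightarrow> int \<Rightarrow> 'a nz" where
  "slin \<alpha> \<beta> k l = star (of_int k * e1 + of_int l * e2 + a \<beta> - a \<alpha>)"

definition factor :: "(nat \<Rightarrow> (nat \<times> nat) set) \<Rightarrow> nat \<Rightarrow> nat \<Rightarrow> 'a" where
  "factor Y \<alpha> \<beta> =
     (\<Prod>s\<in>Y \<alpha>. - of_int (leg (Y \<beta>) s) * e1 + of_int (arm (Y \<alpha>) s + 1) * e2 + a \<beta> - a \<alpha>) *
     (\<Prod>t\<in>Y \<beta>. of_int (leg (Y \<alpha>) t + 1) * e1 - of_int (arm (Y \<beta>) t) * e2 + a \<beta> - a \<alpha>)"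

definition weight :: "(nat \<Rightarrow> (nat \<times> nat) set) \<Rightarrow> 'a" where
  "weight Y = 1 / (\<Prod>\<alpha>=1..r. \<Prod>\<beta>=1..r. factor Y \<alpha> \<beta>)"

definition Zcoeff :: "nat \<Rightarrow> 'a" where
  "Zcoeff n = (\<Sum>Y\<in>young_tuples r n. weight Y)"

definition tuple :: "(nat \<Rightarrow> (nat \<times> nat) set) \<Rightarrow> bool" where
  "tuple Y \<longleftrightarrow> (\<forall>\<alpha>\<in>{1..r}. Y \<alpha> \<in> young_diagrams)"

lemma tuple_young_tuples: "Y \<in> young_tuples r n \<Longrightarrow> tuple Y"
  by (auto simp: young_tuples_def tuple_def)

lemma of_nz_slin:
  assumes "\<alpha> \<in> {1..r}" "\<beta> \<in> {1..r}" "\<alpha> \<noteq> \<beta> \<or> k \<noteq> 0 \<or> l \<noteq> 0"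
  shows "of_nz (slin \<alpha> \<beta> k l) = of_int k * e1 + of_int l * e2 + a \<beta> - a \<alpha>"
  using generic[OF assms] by (simp add: slin_def of_nz_star)

text \<open>\<open>star\<close> changes nothing here: for \<alpha> = \<beta> each box lies in its
  own diagram, so arm and leg are nonnegative and arm + 1 or leg + 1 is a nonzero
  coefficient.\<close>

lemma factor_eq:
  assumes Y: "tuple Y" "\<alpha> \<in> {1..r}" "\<beta> \<in> {1..r}"
  shows "factor Y \<alpha> \<beta> = of_nz (arm_leg_sum (slin \<alpha> \<beta>) (Y \<alpha>) (Y \<beta>))"
proof -
  have yd: "Y \<alpha> \<in> young_diagrams" "Y \<beta> \<in> young_diagrams" using Y by (auto simp: tuple_def)
  have "- of_int (leg (Y \<beta>) s) * e1 + of_int (arm (Y \<alpha>) s + 1) * e2 + a \<beta> - a \<alpha> =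
      of_nz (slin \<alpha> \<beta> (int (fst s) - int (row_len (Y \<beta>) (snd s))) (int (col_len (Y \<alpha>) (fst s)) - int (snd s) + 1))"
    if "s \<in> Y \<alpha>" for s
  proof -
    have eq: "int (fst s) - int (row_len (Y \<beta>) (snd s)) = - leg (Y \<beta>) s"
      "int (col_len (Y \<alpha>) (fst s)) - int (snd s) + 1 = arm (Y \<alpha>) s + 1" by (simp_all add: leg_def arm_def)
    show ?thesis
      unfolding eq using of_nz_slin[OF Y(2,3), of "- leg (Y \<beta>) s" "arm (Y \<alpha>) s + 1"] leg_arm_nonneg[OF yd(1) that]
      by simp
  qed
  moreover have "of_int (leg (Y \<alpha>) t + 1) * e1 - of_int (arm (Y \<beta>) t) * e2 + a \<beta> - a \<alpha> =
      of_nz (slin \<alpha> \<beta> (int (row_len (Y \<alpha>) (snd t)) - int (fst t) + 1) (int (snd t) - int (col_len (Y \<beta>) (fst t))))"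
    if t: "t \<in> Y \<beta>" for t
  proof -
    have "\<alpha> \<noteq> \<beta> \<or> leg (Y \<alpha>) t + 1 \<noteq> 0 \<or> - arm (Y \<beta>) t \<noteq> 0"
      using leg_arm_nonneg[OF yd(2) t] by fastforce
    note ne = of_nz_slin[OF Y(2,3) this]
    have eq: "int (row_len (Y \<alpha>) (snd t)) - int (fst t) + 1 = leg (Y \<alpha>) t + 1"
      "int (snd t) - int (col_len (Y \<beta>) (fst t)) = - arm (Y \<beta>) t" by (simp_all add: leg_def arm_def)
    show ?thesis unfolding eq ne by simp
  qed
  ultimately show ?thesis
    by (simp add: factor_def arm_leg_sum_def of_nz_sum case_prod_unfold)
qed

definition log_euler :: "(nat \<Rightarrow> (nat \<times> nat) set) \<Rightarrow> 'a nz" where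
  "log_euler Y = (\<Sum>\<alpha>=1..r. \<Sum>\<beta>=1..r. box_pair_sum (slin \<alpha> \<beta>) (Y \<alpha>) (Y \<beta>))"

lemma weight_eq: "tuple Y \<Longrightarrow> weight Y = 1 / of_nz (log_euler Y)"
  unfolding weight_def log_euler_def of_nz_sum
  by (intro arg_cong[of _ _ "\<lambda>x. 1 / x"] prod.cong refl)
    (simp add: factor_eq flip: arm_leg_sum_eq_box_pair_sum add: tuple_def)

text \<open>The weight of the box in the tautological bundle of rank n, in the sign convention for
  which differences of contents are forms of the kind used in \<open>slin\<close>.\<close>

definition box_content :: "nat \<Rightarrow> nat \<times> nat \<Rightarrow> 'a" where
  "box_content \<alpha> s = a \<alpha> - (of_nat (fst s) - 1) * e1 - (of_nat (snd s) - 1) * e2"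

abbreviation add_box :: "nat \<Rightarrow> nat \<times> nat \<Rightarrow> (nat \<Rightarrow> (nat \<times> nat) set) \<Rightarrow> nat \<Rightarrow> (nat \<times> nat) set" where
  "add_box \<gamma> b Y \<equiv> Y(\<gamma> := insert b (Y \<gamma>))"

lemma tuple_add_box: "tuple Y \<Longrightarrow> \<gamma> \<in> {1..r} \<Longrightarrow> b \<in> addable (Y \<gamma>) \<Longrightarrow> tuple (add_box \<gamma> b Y)"
  by (auto simp: tuple_def young_insert)

definition corner_log :: "(nat \<Rightarrow> nat \<times> nat \<Rightarrow> 'b::ab_group_add) \<Rightarrow> (nat \<Rightarrow> (nat \<times> nat) set) \<Rightarrow> 'b" where
  "corner_log f Y = (\<Sum>\<alpha>=1..r. sum (f \<alpha>) (addable (Y \<alpha>)) - (\<Sum>(i, j)\<in>removable (Y \<alpha>). f \<alpha> (i + 1, j + 1)))"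

text \<open>The new box meets every old box once in each position of the pair, and itself once.
  \<open>corner_sum\<close> reduces the first two contributions, together with the single sums, to
  corners; the third is the constant \<open>mixed_diff\<close> at (0, 0).\<close>

lemma log_euler_add_box:
  assumes Y: "tuple Y" and \<gamma>: "\<gamma> \<in> {1..r}" and b: "b \<in> addable (Y \<gamma>)"
  shows "log_euler (add_box \<gamma> b Y) = log_euler Y +
    corner_log (\<lambda>\<beta> t. star (box_content \<beta> t - box_content \<gamma> b + (e1 + e2))) Y +
    corner_log (\<lambda>\<alpha> s. star (box_content \<gamma> b - box_content \<alpha> s)) Y + mixed_diff (slin \<gamma> \<gamma>) 0 0"
proof -
  obtain p q where pq: "b = (p, q)" by force
  let ?Y = "add_box \<gamma> b Y"
  have yd: "Y \<alpha> \<in> young_diagrams" if "\<alpha> \<in> {1..r}" for \<alpha> using Y that by (auto simp: tuple_def)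
  have nb: "(p, q) \<notin> Y \<gamma>" using addable_pos b pq by blast
  define E1 where "E1 \<beta> = slin \<gamma> \<beta> (int p) (int q) +
      (\<Sum>(i, j)\<in>Y \<beta>. mixed_diff (slin \<gamma> \<beta>) (int p - int i) (int q - int j))" for \<beta>
  define E2 where "E2 \<alpha> = slin \<alpha> \<gamma> (1 - int p) (1 - int q) +
      (\<Sum>(i, j)\<in>Y \<alpha>. mixed_diff (slin \<alpha> \<gamma>) (int i - int p) (int j - int q))" for \<alpha>
  have step: "box_pair_sum (slin \<alpha> \<beta>) (?Y \<alpha>) (?Y \<beta>) = box_pair_sum (slin \<alpha> \<beta>) (Y \<alpha>) (Y \<beta>) +
      (if \<alpha> = \<gamma> then E1 \<beta> else 0) + (if \<beta> = \<gamma> then E2 \<alpha> else 0) +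
      (if \<beta> = \<gamma> then if \<alpha> = \<gamma> then mixed_diff (slin \<gamma> \<gamma>) 0 0 else 0 else 0)"
    if "\<alpha> \<in> {1..r}" "\<beta> \<in> {1..r}" for \<alpha> \<beta>
    using nb finite_young[OF yd[OF \<gamma>]] finite_young[OF yd] that
    by (simp add: box_pair_sum_def E1_def E2_def pq sum.distrib algebra_simps case_prod_unfold)
  have "log_euler ?Y = log_euler Y + (\<Sum>\<beta>=1..r. E1 \<beta>) + (\<Sum>\<alpha>=1..r. E2 \<alpha>) + mixed_diff (slin \<gamma> \<gamma>) 0 0"
  proof -
    have i: "(\<Sum>\<beta>=1..r. if \<alpha> = \<gamma> then E1 \<beta> else 0) = (if \<alpha> = \<gamma> then \<Sum>\<beta>=1..r. E1 \<beta> else 0)" for \<alpha> by simp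
    have "log_euler ?Y = (\<Sum>\<alpha>=1..r. \<Sum>\<beta>=1..r. box_pair_sum (slin \<alpha> \<beta>) (Y \<alpha>) (Y \<beta>) +
      (if \<alpha> = \<gamma> then E1 \<beta> else 0) + (if \<beta> = \<gamma> then E2 \<alpha> else 0) +
      (if \<beta> = \<gamma> then if \<alpha> = \<gamma> then mixed_diff (slin \<gamma> \<gamma>) 0 0 else 0 else 0))"
      unfolding log_euler_def by (intro sum.cong refl step)
    then show ?thesis using \<gamma> by (simp add: sum.distrib i[simplified] log_euler_def)
  qed
  moreover have "E1 \<beta> = sum (\<lambda>t. star (box_content \<beta> t - box_content \<gamma> b + (e1 + e2))) (addable (Y \<beta>)) -
      (\<Sum>(i, j)\<in>removable (Y \<beta>). star (box_content \<beta> (i + 1, j + 1) - box_content \<gamma> b + (e1 + e2)))"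
    if "\<beta> \<in> {1..r}" for \<beta>
    unfolding E1_def
    by (rule trans[OF _ corner_sum[OF yd[OF that]]], intro arg_cong2[of _ _ _ _ "(+)"] sum.cong refl)
      (auto simp: slin_def mixed_diff_def box_content_def pq algebra_simps)
  moreover have "E2 \<alpha> = sum (\<lambda>s. star (box_content \<gamma> b - box_content \<alpha> s)) (addable (Y \<alpha>)) -
      (\<Sum>(i, j)\<in>removable (Y \<alpha>). star (box_content \<gamma> b - box_content \<alpha> (i + 1, j + 1)))"
    if "\<alpha> \<in> {1..r}" for \<alpha>
    unfolding E2_def
    by (rule trans[OF _ corner_sum[OF yd[OF that]]], intro arg_cong2[of _ _ _ _ "(+)"] sum.cong refl)
      (auto simp: slin_def mixed_diff_def box_content_def pq algebra_simps)
  ultimately show ?thesis by (simp add: corner_log_def)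
qed

lemma box_content_diff:
  "box_content \<alpha> s - box_content \<beta> t =
    of_int (int (fst t) - int (fst s)) * e1 + of_int (int (snd t) - int (snd s)) * e2 + a \<alpha> - a \<beta>"
  by (simp add: box_content_def algebra_simps)

lemma box_content_eq_iff:
  assumes "\<alpha> \<in> {1..r}" "\<beta> \<in> {1..r}"
  shows "box_content \<alpha> s = box_content \<beta> t \<longleftrightarrow> \<alpha> = \<beta> \<and> s = t"
proof
  assume "box_content \<alpha> s = box_content \<beta> t"
  then have "box_content \<alpha> s - box_content \<beta> t = 0" by simp
  then show "\<alpha> = \<beta> \<and> s = t"
    using generic[OF assms(2,1), of "int (fst t) - int (fst s)" "int (snd t) - int (snd s)"]
    unfolding box_content_diff prod_eq_iff by linarith
qed simp

lemma box_content_add_eps: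
  assumes "\<alpha> \<in> {1..r}" "\<beta> \<in> {1..r}"
  shows "box_content \<alpha> s - box_content \<beta> t + (e1 + e2) = 0 \<longleftrightarrow> \<alpha> = \<beta> \<and> s = (fst t + 1, snd t + 1)"
proof -
  have eq: "box_content \<alpha> s - box_content \<beta> t + (e1 + e2) =
      of_int (int (fst t) - int (fst s) + 1) * e1 + of_int (int (snd t) - int (snd s) + 1) * e2 + a \<alpha> - a \<beta>"
    by (simp add: box_content_def algebra_simps)
  show ?thesis
  proof
    assume "box_content \<alpha> s - box_content \<beta> t + (e1 + e2) = 0"
    then show "\<alpha> = \<beta> \<and> s = (fst t + 1, snd t + 1)"
      using generic[OF assms(2,1), of "int (fst t) - int (fst s) + 1" "int (snd t) - int (snd s) + 1"]
      unfolding eq prod_eq_iff fst_conv snd_conv by linarith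
  qed (simp add: box_content_def algebra_simps)
qed

definition Add :: "(nat \<Rightarrow> (nat \<times> nat) set) \<Rightarrow> (nat \<times> nat \<times> nat) set" where
  "Add Y = (SIGMA \<alpha>:{1..r}. addable (Y \<alpha>))"

definition Rem :: "(nat \<Rightarrow> (nat \<times> nat) set) \<Rightarrow> (nat \<times> nat \<times> nat) set" where
  "Rem Y = (SIGMA \<alpha>:{1..r}. removable (Y \<alpha>))"

abbreviation cont :: "nat \<times> nat \<times> nat \<Rightarrow> 'a" where "cont x \<equiv> box_content (fst x) (snd x)"

lemma finite_Add: "tuple Y \<Longrightarrow> finite (Add Y)" and finite_Rem: "tuple Y \<Longrightarrow> finite (Rem Y)"
  by (auto simp: Add_def Rem_def tuple_def addable_removable_finite)

lemma card_Add: "tuple Y \<Longrightarrow> card (Add Y) = card (Rem Y) + r"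
proof -
  assume "tuple Y"
  then have "(\<Sum>\<alpha>=1..r. card (addable (Y \<alpha>))) = (\<Sum>\<alpha>=1..r. card (removable (Y \<alpha>)) + 1)"
    by (intro sum.cong refl corner_card) (auto simp: tuple_def)
  then show ?thesis using \<open>tuple Y\<close>
    by (simp add: Add_def Rem_def tuple_def addable_removable_finite sum_Suc)
qed

lemma corner_log_eq:
  assumes "tuple Y"
  shows "corner_log f Y = (\<Sum>x\<in>Add Y. f (fst x) (snd x)) -
    (\<Sum>x\<in>Rem Y. f (fst x) (fst (snd x) + 1, snd (snd x) + 1))"
  using assms unfolding corner_log_def Add_def Rem_def
  by (simp add: sum_subtractf sum.Sigma case_prod_unfold tuple_def addable_removable_finite)

text \<open>Up to a constant the change of the weight is a rational function evaluated at c, with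
  poles from the addable and zeros from the removable corners. The only factor that vanishes belongs
  to b itself, and \<open>star\<close> removes it.\<close>

lemma weight_add_box:
  assumes Y: "tuple Y" and \<gamma>: "\<gamma> \<in> {1..r}" and b: "b \<in> addable (Y \<gamma>)"
  defines "c \<equiv> box_content \<gamma> b"
  shows "weight (add_box \<gamma> b Y) = weight Y * ((- 1) ^ r * (e1 + e2) / (e1 * e2)) *
    ((\<Prod>t\<in>Rem Y. (c - cont t) * (c - cont t + (e1 + e2))) /
     ((\<Prod>t\<in>Add Y - {(\<gamma>, b)}. c - cont t) * (\<Prod>t\<in>Add Y. c - cont t - (e1 + e2))))"
proof -
  let ?e = "e1 + e2"
  note fin = finite_Add[OF Y] finite_Rem[OF Y]
  have bA: "(\<gamma>, b) \<in> Add Y" using \<gamma> b by (auto simp: Add_def)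
  have e: "e1 \<noteq> 0" "e2 \<noteq> 0" "?e \<noteq> 0"
    using generic[OF \<gamma> \<gamma>, of 1 0] generic[OF \<gamma> \<gamma>, of 0 1] generic[OF \<gamma> \<gamma>, of 1 1] by auto
  have nb: "b \<notin> Y \<gamma>" "(fst b + 1, snd b + 1) \<notin> Y \<gamma>"
  proof -
    have yd: "Y \<gamma> \<in> young_diagrams" using Y \<gamma> by (auto simp: tuple_def)
    show "b \<notin> Y \<gamma>" using addable_pos[of "fst b" "snd b"] b by auto
    then show "(fst b + 1, snd b + 1) \<notin> Y \<gamma>"
      using young_down[OF yd, of "fst b + 1" "snd b + 1" "fst b" "snd b"] addable_pos[of "fst b" "snd b"] b by auto
  qed
  \<comment> \<open>If the diagonal neighbour of b = (p, q) were addable, (p, q + 1) and hence b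
    would lie in the diagram; so no factor in \<open>A1\<close> vanishes.\<close>
  have nA: "(fst b + 1, snd b + 1) \<notin> addable (Y \<gamma>)"
    using nb(1) addable_pos[of "fst b" "snd b" "Y \<gamma>"] b young_down[of "Y \<gamma>" "fst b" "snd b + 1" "fst b" "snd b"] Y \<gamma>
    by (auto simp: addable_def tuple_def)
  have A1: "of_nz (\<Sum>x\<in>Add Y. star (cont x - c + ?e)) = (\<Prod>x\<in>Add Y. cont x - c + ?e)"
    unfolding of_nz_sum of_nz_star c_def
    by (rule prod.cong) (use nA \<gamma> in \<open>auto simp: box_content_add_eps Add_def\<close>)
  have A2: "of_nz (\<Sum>x\<in>Add Y. star (c - cont x)) = (\<Prod>x\<in>Add Y - {(\<gamma>, b)}. c - cont x)"
  proof -
    have "of_nz (\<Sum>x\<in>Add Y. star (c - cont x)) = of_nz (star (c - cont (\<gamma>, b))) * (\<Prod>x\<in>Add Y - {(\<gamma>, b)}. of_nz (star (c - cont x)))"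
      unfolding of_nz_sum by (rule prod.remove[OF fin(1) bA])
    also have "of_nz (star (c - cont (\<gamma>, b))) = 1" by (simp add: c_def of_nz_star)
    also have "(\<Prod>x\<in>Add Y - {(\<gamma>, b)}. of_nz (star (c - cont x))) = (\<Prod>x\<in>Add Y - {(\<gamma>, b)}. c - cont x)"
      unfolding of_nz_star c_def
      by (rule prod.cong) (use \<gamma> in \<open>auto simp: box_content_eq_iff Add_def\<close>)
    finally show ?thesis by simp
  qed
  have sh: "box_content \<alpha> (fst t + 1, snd t + 1) = box_content \<alpha> t - ?e" for \<alpha> t by (simp add: box_content_def algebra_simps)
  have R1: "of_nz (\<Sum>x\<in>Rem Y. star (box_content (fst x) (fst (snd x) + 1, snd (snd x) + 1) - c + ?e)) = (\<Prod>x\<in>Rem Y. cont x - c)"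
    unfolding of_nz_sum of_nz_star c_def sh
    by (rule prod.cong) (use nb \<gamma> in \<open>auto simp: box_content_eq_iff Rem_def removable_def\<close>)
  have R2: "of_nz (\<Sum>x\<in>Rem Y. star (c - box_content (fst x) (fst (snd x) + 1, snd (snd x) + 1))) = (\<Prod>x\<in>Rem Y. c - cont x + ?e)"
  proof -
    have "c - cont x + ?e \<noteq> 0" if "x \<in> Rem Y" for x
    proof
      assume "c - cont x + ?e = 0"
      then have "\<gamma> = fst x" "b = (fst (snd x) + 1, snd (snd x) + 1)"
        using that \<gamma> box_content_add_eps[of \<gamma> "fst x" b "snd x"] by (auto simp: c_def Rem_def)
      then show False using that b Y \<gamma> young_pos[of "Y \<gamma>" "fst (snd x)" "snd (snd x)"]
        by (auto simp: Rem_def removable_def addable_def tuple_def)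
    qed
    then show ?thesis unfolding of_nz_sum of_nz_star sh
      by (intro prod.cong) (auto simp: algebra_simps)
  qed
  \<comment> \<open>The form at (0, 0) is read as 1 by \<open>star\<close>; the other three values
    of \<open>mixed_diff\<close> give this constant.\<close>
  have K: "of_nz (mixed_diff (slin \<gamma> \<gamma>) 0 0) = e1 * e2 / ?e"
    using e by (simp add: mixed_diff_def slin_def of_nz_star)
  have W: "weight (add_box \<gamma> b Y) = 1 / (of_nz (log_euler Y) *
      ((\<Prod>x\<in>Add Y. cont x - c + ?e) / (\<Prod>x\<in>Rem Y. cont x - c)) *
      ((\<Prod>x\<in>Add Y - {(\<gamma>, b)}. c - cont x) / (\<Prod>x\<in>Rem Y. c - cont x + ?e)) * (e1 * e2 / ?e))"
    unfolding weight_eq[OF tuple_add_box[OF Y \<gamma> b]] log_euler_add_box[OF Y \<gamma> b] corner_log_eq[OF Y]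
      of_nz_add of_nz_diff A1[unfolded c_def] A2[unfolded c_def] R1[unfolded c_def] R2[unfolded c_def] K c_def ..
  have s1: "(\<Prod>x\<in>Add Y. cont x - c + ?e) = (- 1) ^ card (Add Y) * (\<Prod>x\<in>Add Y. c - cont x - ?e)"
    by (simp add: prod_constant[symmetric] prod.distrib[symmetric] del: prod_constant) (simp add: algebra_simps)
  have s2: "(\<Prod>x\<in>Rem Y. cont x - c) = (- 1) ^ card (Rem Y) * (\<Prod>x\<in>Rem Y. c - cont x)"
    by (simp add: prod_constant[symmetric] prod.distrib[symmetric] del: prod_constant)
  have sq: "(- 1) ^ n * (- 1) ^ n = (1::'a)" for n by (simp flip: power_mult_distrib)
  \<comment> \<open>The signs from reversing differences combine to (-1)^r because there are r more
    addable than removable corners.\<close>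
  have sg: "(- 1) ^ card (Rem Y) / (- 1) ^ card (Add Y) = ((- 1) ^ r :: 'a)"
    using sq[of r] by (simp add: card_Add[OF Y] power_add field_simps)
  have "weight (add_box \<gamma> b Y) = weight Y * ((- 1) ^ card (Rem Y) / (- 1) ^ card (Add Y)) * (?e / (e1 * e2)) *
    ((\<Prod>x\<in>Rem Y. c - cont x) * (\<Prod>x\<in>Rem Y. c - cont x + ?e) /
     ((\<Prod>t\<in>Add Y - {(\<gamma>, b)}. c - cont t) * (\<Prod>t\<in>Add Y. c - cont t - ?e)))"
    unfolding W s1 s2 weight_eq[OF Y] by (simp add: divide_inverse mult_ac)
  then show ?thesis unfolding sg by (simp add: prod.distrib)
qed

end

section \<open>Lagrange interpolation sums as coefficients of power series\<close>

text \<open>The divided difference of h at the nodes X.\<close>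

definition lagrange_sum :: "'a::field set \<Rightarrow> ('a \<Rightarrow> 'a) \<Rightarrow> 'a" where
  "lagrange_sum X h = (\<Sum>x\<in>X. h x / (\<Prod>y\<in>X - {x}. x - y))"

lemma lagrange_sum_insert_diff:
  assumes "finite X" "z \<notin> X"
  shows "lagrange_sum (insert z X) (\<lambda>x. (x - z) * h x) = lagrange_sum X h"
proof -
  have "(x - z) * h x / (\<Prod>y\<in>insert z X - {x}. x - y) = h x / (\<Prod>y\<in>X - {x}. x - y)" if "x \<in> X" for x
  proof -
    have "insert z X - {x} = insert z (X - {x})" "z \<notin> X - {x}" "x \<noteq> z" using that assms by auto
    then show ?thesis using assms by simp
  qed
  then show ?thesis using assms by (simp add: lagrange_sum_def)
qed

lemma lagrange_sum_lin:
  "lagrange_sum X (\<lambda>x. b * h x - c * g x) = b * lagrange_sum X h - c * lagrange_sum X g"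
  by (simp add: lagrange_sum_def sum_distrib_left sum_subtractf diff_divide_distrib)

text \<open>Multiplying by x - z removes the node z. Two nodes y and y' give equal results by
  induction, and subtracting eliminates the sum of h x = x, leaving y' - y times the sum in
  question.\<close>

lemma lagrange_sum_one:
  assumes "finite X" "card X \<ge> 2"
  shows "lagrange_sum X (\<lambda>_. 1) = 0"
  using assms
proof (induction "card X" arbitrary: X rule: less_induct)
  case less
  obtain y where y: "y \<in> X" using less.prems by fastforce
  have "card (X - {y}) \<ge> 1" using less.prems y by simp
  then have "X - {y} \<noteq> {}" by (metis card.empty not_one_le_zero)
  then obtain y' where y': "y' \<in> X - {y}" by blast
  have *: "lagrange_sum X (\<lambda>x. x) - z * lagrange_sum X (\<lambda>_. 1) = lagrange_sum (X - {z}) (\<lambda>_. 1)" if "z \<in> X" for z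
    using lagrange_sum_insert_diff[of "X - {z}" z "\<lambda>_. 1"] lagrange_sum_lin[of X 1 "\<lambda>x. x" z "\<lambda>_. 1"] less.prems that
    by (simp add: insert_absorb)
  have "lagrange_sum (X - {z}) (\<lambda>_. 1) = (if card X = 2 then 1 else 0)" if "z \<in> X" for z
  proof (cases "card X = 2")
    case True
    then have "card (X - {z}) = 1" using that less.prems by simp
    then obtain u where "X - {z} = {u}" by (auto simp: card_1_singleton_iff)
    then show ?thesis using True by (simp add: lagrange_sum_def)
  next
    case False
    then show ?thesis using less.hyps[of "X - {z}"] that less.prems by simp
  qed
  then have "lagrange_sum X (\<lambda>x. x) - y * lagrange_sum X (\<lambda>_. 1) = lagrange_sum X (\<lambda>x. x) - y' * lagrange_sum X (\<lambda>_. 1)"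
    using *[of y] *[of y'] y y' by simp
  then have "(y' - y) * lagrange_sum X (\<lambda>_. 1) = 0" by (simp add: algebra_simps)
  then show ?case using y' by simp
qed

abbreviation fps_lin :: "'a::field \<Rightarrow> 'a fps" where
  "fps_lin c \<equiv> 1 - fps_const c * fps_X"

lemma fps_lin_mult_nth: "(fps_lin c * F) $ n = F $ n - (if n = 0 then 0 else c * F $ (n - 1))"
  by (simp add: left_diff_distrib mult.assoc fps_X_mult_nth)

lemma inverse_fps_lin: "inverse (fps_lin c) = Abs_fps (\<lambda>n. c ^ n)"
proof -
  have "fps_lin c * Abs_fps (\<lambda>n. c ^ n) = 1"
    by (rule fps_ext) (auto simp: fps_lin_mult_nth power_eq_if)
  then show ?thesis by (metis fps_inverse_unique)
qed

text \<open>Divided differences of monomials are complete homogeneous symmetric polynomials, here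
  read off from their generating series. In this form no denominators x - y remain.\<close>

lemma lagrange_sum_power:
  assumes "finite X" "X \<noteq> {}"
  shows "lagrange_sum X (\<lambda>x. x ^ m) =
    (if card X \<le> m + 1 then inverse (\<Prod>x\<in>X. fps_lin x) $ (m + 1 - card X) else 0)"
  using assms
proof (induction X arbitrary: m rule: finite_ne_induct)
  case (singleton x)
  show ?case by (simp add: inverse_fps_lin lagrange_sum_def)
next
  case (insert z X)
  let ?H = "inverse (\<Prod>x\<in>X. fps_lin x)" and ?H' = "inverse (\<Prod>x\<in>insert z X. fps_lin x)"
  have "fps_lin z * ?H' = ?H * (inverse (fps_lin z) * fps_lin z)"
    using insert by (simp add: fps_inverse_mult mult_ac)
  also have "inverse (fps_lin z) * fps_lin z = 1" by (rule inverse_mult_eq_1) simp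
  finally have H: "?H $ n = ?H' $ n - (if n = 0 then 0 else z * ?H' $ (n - 1))" for n
    using fps_lin_mult_nth[of z ?H' n] by simp
  have card: "card (insert z X) = card X + 1" "card X \<ge> 1"
    using insert by (simp_all add: Suc_le_eq card_gt_0_iff)
  show ?case
  proof (induction m)
    case 0
    show ?case using lagrange_sum_one[of "insert z X"] card insert by simp
  next
    case (Suc m)
    have "lagrange_sum (insert z X) (\<lambda>x. x ^ Suc m) - z * lagrange_sum (insert z X) (\<lambda>x. x ^ m) =
        lagrange_sum X (\<lambda>x. x ^ m)"
      using lagrange_sum_lin[of "insert z X" 1 "\<lambda>x. x ^ Suc m" z "\<lambda>x. x ^ m"]
        lagrange_sum_insert_diff[of X z "\<lambda>x. x ^ m"] insert by (simp add: algebra_simps)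
    then show ?case
      using Suc insert.IH[of m] H[of "m + 1 - card X"] card by (auto split: if_splits simp: Suc_diff_le)
  qed
qed

text \<open>A factor x - g i replaces x^m by x^(m+1) - g i x^m, which multiplies the generating
  series by \<open>fps_lin (g i)\<close> and raises the degree by one.\<close>

lemma lagrange_sum_power_prod:
  assumes "finite X" "X \<noteq> {}" "finite I"
  shows "lagrange_sum X (\<lambda>x. x ^ m * (\<Prod>i\<in>I. x - g i)) =
    (if card X \<le> m + card I + 1
     then ((\<Prod>i\<in>I. fps_lin (g i)) * inverse (\<Prod>x\<in>X. fps_lin x)) $ (m + card I + 1 - card X) else 0)"
  using assms(3)
proof (induction I arbitrary: m)
  case empty
  show ?case using lagrange_sum_power[OF assms(1,2)] by simp
next
  case (insert j I)
  let ?E = "(\<Prod>i\<in>I. fps_lin (g i)) * inverse (\<Prod>x\<in>X. fps_lin x)"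
  have L: "lagrange_sum X (\<lambda>x. x ^ m * (\<Prod>i\<in>insert j I. x - g i)) =
      lagrange_sum X (\<lambda>x. x ^ (m + 1) * (\<Prod>i\<in>I. x - g i)) - g j * lagrange_sum X (\<lambda>x. x ^ m * (\<Prod>i\<in>I. x - g i))"
    using lagrange_sum_lin[of X 1 "\<lambda>x. x ^ (m + 1) * (\<Prod>i\<in>I. x - g i)" "g j" "\<lambda>x. x ^ m * (\<Prod>i\<in>I. x - g i)"] insert
    by (simp add: algebra_simps)
  have E: "(\<Prod>i\<in>insert j I. fps_lin (g i)) * inverse (\<Prod>x\<in>X. fps_lin x) = fps_lin (g j) * ?E"
    using insert by (simp add: mult_ac)
  \<comment> \<open>In the second case only the power m + 1 contributes, through a constant
    coefficient; in the third everything is 0.\<close>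
  consider "card X \<le> m + card I + 1" | "card X = m + card I + 2" | "m + card I + 2 < card X" by linarith
  then show ?case
  proof cases
    case 1
    then obtain N where "m + card I + 1 = card X + N" using le_Suc_ex by blast
    then have i: "m + card I + 1 - card X = N" "m + 1 + card I + 1 - card X = Suc N"
      "m + card (insert j I) + 1 - card X = Suc N"
      "card X \<le> m + 1 + card I + 1" "card X \<le> m + card (insert j I) + 1" using insert.hyps by auto
    show ?thesis
      unfolding L E insert.IH[of m] insert.IH[of "m + 1"] i using 1 i(4,5) fps_lin_mult_nth[of "g j" ?E "Suc N"]
      by simp
  next
    case 2
    then show ?thesis
      using L E insert.IH[of m] insert.IH[of "m + 1"] insert.hyps fps_lin_mult_nth[of "g j" ?E 0] by simp
  next
    case 3
    then show ?thesis using L insert.IH[of m] insert.IH[of "m + 1"] insert.hyps by simp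
  qed
qed

section \<open>Subrings of a field\<close>

text \<open>Subrings containing the rational numbers: later the local rings of hyperplanes and the
  fractions with controlled denominators. Division by positive integers serves to undo
  multiplicities of contents and to extract coefficients of the logarithm.\<close>

locale rat_subring =
  fixes R :: "'a::field_char_0 set"
  assumes one [intro, simp]: "1 \<in> R"
    and add [intro]: "x \<in> R \<Longrightarrow> y \<in> R \<Longrightarrow> x + y \<in> R"
    and mult [intro]: "x \<in> R \<Longrightarrow> y \<in> R \<Longrightarrow> x * y \<in> R"
    and uminus [intro]: "x \<in> R \<Longrightarrow> - x \<in> R"
    and inverse_nat: "n > 0 \<Longrightarrow> inverse (of_nat n) \<in> R"
begin

lemma zero [intro, simp]: "0 \<in> R" using add[OF one uminus[OF one]] by simp
lemma diff [intro]: "x \<in> R \<Longrightarrow> y \<in> R \<Longrightarrow> x - y \<in> R" using add[of x "- y"] uminus by simp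
lemma of_nat [intro, simp]: "of_nat n \<in> R" by (induction n) auto
lemma of_int [intro, simp]: "of_int k \<in> R" by (cases k) (auto simp del: of_nat_Suc)
lemma sum [intro]: "(\<And>i. i \<in> A \<Longrightarrow> f i \<in> R) \<Longrightarrow> sum f A \<in> R" by (induction A rule: infinite_finite_induct) auto
lemma prod [intro]: "(\<And>i. i \<in> A \<Longrightarrow> f i \<in> R) \<Longrightarrow> prod f A \<in> R" by (induction A rule: infinite_finite_induct) auto
lemma power [intro]: "x \<in> R \<Longrightarrow> x ^ n \<in> R" by (induction n) auto
lemma inverse_int: "k \<noteq> 0 \<Longrightarrow> inverse (of_int k) \<in> R"
  using inverse_nat[of "nat \<bar>k\<bar>"] uminus[OF inverse_nat[of "nat \<bar>k\<bar>"]] by (cases "k > 0") auto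
lemma cancel_nat: "n > 0 \<Longrightarrow> of_nat n * x \<in> R \<Longrightarrow> x \<in> R"
  using mult[OF inverse_nat[of n], of "of_nat n * x"] by (simp add: field_simps)

definition Rpoly :: "'a poly set" where "Rpoly = {p. \<forall>i. coeff p i \<in> R}"

lemma Rpoly_add: "p \<in> Rpoly \<Longrightarrow> q \<in> Rpoly \<Longrightarrow> p + q \<in> Rpoly" by (auto simp: Rpoly_def)
lemma Rpoly_diff: "p \<in> Rpoly \<Longrightarrow> q \<in> Rpoly \<Longrightarrow> p - q \<in> Rpoly" by (auto simp: Rpoly_def)
lemma Rpoly_mult: "p \<in> Rpoly \<Longrightarrow> q \<in> Rpoly \<Longrightarrow> p * q \<in> Rpoly"
  unfolding Rpoly_def mem_Collect_eq coeff_mult by blast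
lemma Rpoly_pCons: "x \<in> R \<Longrightarrow> p \<in> Rpoly \<Longrightarrow> pCons x p \<in> Rpoly"
  by (auto simp: Rpoly_def coeff_pCons split: nat.split)
lemma Rpoly_0: "0 \<in> Rpoly" by (simp add: Rpoly_def)
lemma Rpoly_const: "x \<in> R \<Longrightarrow> [:x:] \<in> Rpoly" by (intro Rpoly_pCons Rpoly_0)
lemma Rpoly_power: "p \<in> Rpoly \<Longrightarrow> p ^ n \<in> Rpoly"
  using Rpoly_const[OF one] by (induction n) (auto intro: Rpoly_mult simp: one_pCons)
lemma Rpoly_prod: "(\<And>i. i \<in> A \<Longrightarrow> f i \<in> Rpoly) \<Longrightarrow> prod f A \<in> Rpoly"
  using Rpoly_const[OF one]
  by (induction A rule: infinite_finite_induct) (auto intro: Rpoly_mult simp: one_pCons)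
lemma Rpoly_sum: "(\<And>i. i \<in> A \<Longrightarrow> f i \<in> Rpoly) \<Longrightarrow> sum f A \<in> Rpoly"
  by (induction A rule: infinite_finite_induct) (auto intro: Rpoly_add Rpoly_0)
lemma Rpoly_coeffs: "pCons x p \<in> Rpoly \<Longrightarrow> x \<in> R \<and> p \<in> Rpoly"
  unfolding Rpoly_def mem_Collect_eq using coeff_pCons_0 coeff_pCons_Suc by metis

lemma poly_in_R: "p \<in> Rpoly \<Longrightarrow> x \<in> R \<Longrightarrow> poly p x \<in> R"
  by (induction p) (auto dest: Rpoly_coeffs)

lemma poly_diff_multiple:
  assumes "p \<in> Rpoly" "x \<in> R" "y \<in> R"
  shows "\<exists>z\<in>R. poly p x - poly p y = (x - y) * z"
  using assms(1)
proof (induction p)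
  case (pCons c p)
  then obtain z where z: "z \<in> R" "poly p x - poly p y = (x - y) * z" by (auto dest: Rpoly_coeffs)
  have "poly (pCons c p) x - poly (pCons c p) y = (x - y) * (poly p x + y * z)"
  proof -
    have eq: "poly p x = poly p y + (x - y) * z" using z(2) by (metis add.commute diff_add_cancel)
    show ?thesis unfolding poly_pCons eq by (simp add: algebra_simps)
  qed
  moreover have "poly p x + y * z \<in> R" using z(1) assms(2,3) pCons.prems by (blast dest: Rpoly_coeffs intro: poly_in_R)
  ultimately show ?case by blast
qed auto

text \<open>Inserting such a polynomial restricts an interpolation sum to the poles in one residue class modulo
  \<open>v\<close>, up to high order in \<open>v\<close>.\<close>

lemma cutoff_poly:
  assumes "finite A" "A \<subseteq> R" "c \<in> R" "v \<in> R" "\<And>y. y \<in> A \<Longrightarrow> inverse (c - y) \<in> R" "\<And>y. y \<in> A \<Longrightarrow> c \<noteq> y"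
  obtains e where "e \<in> Rpoly" "\<And>y. y \<in> A \<Longrightarrow> poly e y = 0"
    "\<And>u. u \<in> R \<Longrightarrow> \<exists>z\<in>R. poly e (c + v * u) = 1 + v ^ K * z"
proof
  \<comment> \<open>g vanishes on A and is a unit at c, so h = 1 - g / g(c) is 1 on A and divisible
    by v on c + v R. Its power is still 1 on A but divisible by v^(K+1) on that class; e is the
    complement.\<close>
  define g where "g = (\<Prod>y\<in>A. [:- y, 1:])"
  define i where "i = inverse (poly g c)"
  define h where "h = [:1:] - [:i:] * g"
  define e where "e = [:1:] - h ^ Suc K"
  have g: "g \<in> Rpoly" unfolding g_def using assms(2) by (intro Rpoly_prod Rpoly_pCons Rpoly_0) auto
  have "poly g c \<noteq> 0" using assms(1,6) by (auto simp: g_def poly_prod)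
  have i: "i \<in> R" using assms(5) by (auto simp: i_def g_def poly_prod prod_inversef[symmetric])
  have h: "h \<in> Rpoly" unfolding h_def by (intro Rpoly_diff Rpoly_mult Rpoly_const g i) auto
  show "e \<in> Rpoly" unfolding e_def by (intro Rpoly_diff Rpoly_const Rpoly_power h) auto
  show "poly e y = 0" if "y \<in> A" for y
  proof -
    have "poly g y = 0" unfolding g_def poly_prod by (rule prod_zero) (use that assms(1) in auto)
    then show ?thesis by (simp add: e_def h_def poly_power)
  qed
  show "\<exists>z\<in>R. poly e (c + v * u) = 1 + v ^ K * z" if u: "u \<in> R" for u
  proof -
    have cu: "c + v * u \<in> R" using assms(3,4) u by blast
    obtain z where z: "z \<in> R" "poly h (c + v * u) - poly h c = v * u * z"
      using poly_diff_multiple[OF h cu assms(3)] by auto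
    have "poly h c = 0" using \<open>poly g c \<noteq> 0\<close> by (simp add: h_def i_def)
    then have "poly e (c + v * u) = 1 + v ^ K * (- (v * (u * z) ^ Suc K))"
      using z(2) by (simp add: e_def poly_power power_mult_distrib algebra_simps)
    moreover have "- (v * (u * z) ^ Suc K) \<in> R" using u z(1) assms(4) by blast
    ultimately show ?thesis by blast
  qed
qed

end

section \<open>Symmetric functions of the contents\<close>

locale nekrasov_subring = nekrasov_params r e1 e2 a + rat_subring R
  for r :: nat and e1 e2 :: "'a::field_char_0" and a :: "nat \<Rightarrow> 'a" and R :: "'a set" +
  assumes params_in_R: "e1 \<in> R" "e2 \<in> R" "\<alpha> \<in> {1..r} \<Longrightarrow> a \<alpha> \<in> R"
begin

lemma content_in_R: "\<alpha> \<in> {1..r} \<Longrightarrow> box_content \<alpha> s \<in> R"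
  unfolding box_content_def using params_in_R by (intro diff mult) auto

definition boxes :: "(nat \<Rightarrow> (nat \<times> nat) set) \<Rightarrow> (nat \<times> nat \<times> nat) set" where
  "boxes Y = (SIGMA \<alpha>:{1..r}. Y \<alpha>)"

lemma finite_boxes: "tuple Y \<Longrightarrow> finite (boxes Y)"
  by (auto simp: boxes_def tuple_def finite_young)

lemma boxes_add_box: "\<gamma> \<in> {1..r} \<Longrightarrow> boxes (add_box \<gamma> b Y) = insert (\<gamma>, b) (boxes Y)"
  by (auto simp: boxes_def split: if_splits)

definition poly_fps :: "('a \<Rightarrow> 'a fps) \<Rightarrow> bool" where
  "poly_fps \<Theta> \<longleftrightarrow> (\<forall>m. \<exists>p\<in>Rpoly. \<forall>c. \<Theta> c $ m = poly p c)"

lemma poly_fps_mult: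
  assumes "poly_fps \<Theta>" "poly_fps \<Theta>'"
  shows "poly_fps (\<lambda>c. \<Theta> c * \<Theta>' c)"
  unfolding poly_fps_def
proof
  fix m
  obtain p p' where p: "\<And>m. p m \<in> Rpoly" "\<And>m c. \<Theta> c $ m = poly (p m) c"
    and p': "\<And>m. p' m \<in> Rpoly" "\<And>m c. \<Theta>' c $ m = poly (p' m) c"
    using assms unfolding poly_fps_def by metis
  have "(\<Sum>i=0..m. p i * p' (m - i)) \<in> Rpoly" using p p' by (intro Rpoly_sum Rpoly_mult)
  moreover have "(\<Theta> c * \<Theta>' c) $ m = poly (\<Sum>i=0..m. p i * p' (m - i)) c" for c
    by (simp add: fps_mult_nth p p' poly_sum)
  ultimately show "\<exists>p\<in>Rpoly. \<forall>c. (\<Theta> c * \<Theta>' c) $ m = poly p c" by blast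
qed

lemma poly_fps_lin:
  assumes "k \<in> R"
  shows "poly_fps (\<lambda>c. fps_lin (c + k))" "poly_fps (\<lambda>c. inverse (fps_lin (c + k)))"
proof -
  have "\<exists>p\<in>Rpoly. \<forall>c. fps_lin (c + k) $ m = poly p c" for m
  proof -
    consider "m = 0" | "m = 1" | "m > 1" by linarith
    then show ?thesis
    proof cases
      case 1 then show ?thesis by (intro bexI[of _ "[:1:]"] Rpoly_const) auto
    next
      case 2 then show ?thesis using assms by (intro bexI[of _ "[:- k, - 1:]"] Rpoly_pCons Rpoly_0) auto
    next
      case 3 then show ?thesis by (intro bexI[of _ 0] Rpoly_0) auto
    qed
  qed
  then show "poly_fps (\<lambda>c. fps_lin (c + k))" unfolding poly_fps_def by blast
  have "[:k, 1:] ^ m \<in> Rpoly" for m using assms by (intro Rpoly_power Rpoly_pCons Rpoly_0) auto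
  then show "poly_fps (\<lambda>c. inverse (fps_lin (c + k)))"
    unfolding poly_fps_def by (auto simp: inverse_fps_lin poly_power add.commute intro!: bexI[of _ "[:k, 1:] ^ m" for m])
qed

lemma fps_mult_in_R: "(\<And>n. F $ n \<in> R) \<Longrightarrow> (\<And>n. G $ n \<in> R) \<Longrightarrow> (F * G) $ n \<in> R"
  unfolding fps_mult_nth by (intro sum mult)

lemma fps_prod_in_R: "(\<And>i n. i \<in> A \<Longrightarrow> F i $ n \<in> R) \<Longrightarrow> (\<Prod>i\<in>A. F i) $ n \<in> R"
  by (induction A arbitrary: n rule: infinite_finite_induct) (auto intro: fps_mult_in_R)

lemma poly_fps_in_R: "poly_fps \<Theta> \<Longrightarrow> c \<in> R \<Longrightarrow> \<Theta> c $ m \<in> R"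
  unfolding poly_fps_def using poly_in_R by metis

text \<open>Symmetric functions of the contents with coefficients in R. Generating them by products
  over boxes makes visible what the induction needs: a new box acts by multiplication
  (\<open>obs_add_box\<close>), and the zeros and poles of the Lagrange sum are themselves such a
  product (\<open>pole_series\<close>).\<close>

inductive obs :: "((nat \<Rightarrow> (nat \<times> nat) set) \<Rightarrow> 'a) \<Rightarrow> bool" where
  obs_const: "x \<in> R \<Longrightarrow> obs (\<lambda>_. x)"
| obs_gen: "poly_fps \<Theta> \<Longrightarrow> obs (\<lambda>Y. (\<Prod>s\<in>boxes Y. \<Theta> (cont s)) $ m)"
| obs_add: "obs f \<Longrightarrow> obs g \<Longrightarrow> obs (\<lambda>Y. f Y + g Y)"
| obs_mult: "obs f \<Longrightarrow> obs g \<Longrightarrow> obs (\<lambda>Y. f Y * g Y)"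

lemma obs_sum: "(\<And>i. i \<in> A \<Longrightarrow> obs (f i)) \<Longrightarrow> obs (\<lambda>Y. \<Sum>i\<in>A. f i Y)"
  by (induction A rule: infinite_finite_induct) (auto intro: obs_const obs_add)

lemma obs_in_R: "obs f \<Longrightarrow> f Y \<in> R"
proof (induction rule: obs.induct)
  case (obs_gen \<Theta> m)
  then show ?case
    by (intro fps_prod_in_R poly_fps_in_R) (auto simp: boxes_def intro: content_in_R)
qed auto

text \<open>The degree bound is uniform in Y, so that expansion into powers of x is one finite sum
  for all Y.\<close>

definition poly_obs :: "((nat \<Rightarrow> (nat \<times> nat) set) \<Rightarrow> 'a poly) \<Rightarrow> bool" where
  "poly_obs Q \<longleftrightarrow> (\<forall>k. obs (\<lambda>Y. coeff (Q Y) k)) \<and> (\<exists>D. \<forall>Y. degree (Q Y) \<le> D)"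

lemma poly_obs_add:
  assumes "poly_obs P" "poly_obs Q"
  shows "poly_obs (\<lambda>Y. P Y + Q Y)"
proof -
  obtain D E where "\<And>Y. degree (P Y) \<le> D" "\<And>Y. degree (Q Y) \<le> E" using assms by (auto simp: poly_obs_def)
  then have "degree (P Y + Q Y) \<le> max D E" for Y by (intro degree_add_le) (simp_all add: le_max_iff_disj)
  then show ?thesis using assms by (auto simp: poly_obs_def intro: obs_add)
qed

lemma poly_obs_mult:
  assumes "poly_obs P" "poly_obs Q"
  shows "poly_obs (\<lambda>Y. P Y * Q Y)"
proof -
  obtain D E where "\<And>Y. degree (P Y) \<le> D" "\<And>Y. degree (Q Y) \<le> E" using assms by (auto simp: poly_obs_def)
  then have "degree (P Y * Q Y) \<le> D + E" for Y by (meson add_mono degree_mult_le order_trans)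
  then show ?thesis using assms by (auto simp: poly_obs_def coeff_mult intro!: obs_sum obs_mult)
qed

lemma poly_obs_const: "p \<in> Rpoly \<Longrightarrow> poly_obs (\<lambda>_. p)"
  by (auto simp: poly_obs_def Rpoly_def intro: obs_const)

lemma poly_obs_obs: "obs f \<Longrightarrow> poly_obs (\<lambda>Y. [:f Y:])"
  unfolding poly_obs_def
proof (intro conjI allI exI)
  fix k assume "obs f"
  then show "obs (\<lambda>Y. coeff [:f Y:] k)" by (cases k) (auto intro: obs_const)
  show "degree [:f Y:] \<le> 0" for Y by simp
qed

lemma poly_obs_sum: "finite A \<Longrightarrow> (\<And>i. i \<in> A \<Longrightarrow> poly_obs (Q i)) \<Longrightarrow> poly_obs (\<lambda>Y. \<Sum>i\<in>A. Q i Y)"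
  by (induction A rule: finite_induct) (auto intro: poly_obs_add poly_obs_const Rpoly_0)

text \<open>A generator acquires the factor \<open>\<Theta>\<close> at the new content, whose
  coefficients are polynomials in that content; sums and products inherit this.\<close>

lemma obs_add_box:
  assumes "obs f"
  obtains Q where "poly_obs Q"
    "\<And>Y \<gamma> b. tuple Y \<Longrightarrow> \<gamma> \<in> {1..r} \<Longrightarrow> b \<notin> Y \<gamma> \<Longrightarrow> f (add_box \<gamma> b Y) = poly (Q Y) (box_content \<gamma> b)"
proof -
  have "\<exists>Q. poly_obs Q \<and> (\<forall>Y \<gamma> b. tuple Y \<longrightarrow> \<gamma> \<in> {1..r} \<longrightarrow> b \<notin> Y \<gamma> \<longrightarrow>
      f (add_box \<gamma> b Y) = poly (Q Y) (box_content \<gamma> b))"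
    using assms
  proof (induction rule: obs.induct)
    case (obs_const x)
    then show ?case by (intro exI[of _ "\<lambda>_. [:x:]"]) (auto intro: poly_obs_const Rpoly_const)
  next
    case (obs_gen \<Theta> m)
    then obtain p where p: "\<And>m. p m \<in> Rpoly" "\<And>m c. \<Theta> c $ m = poly (p m) c" unfolding poly_fps_def by metis
    define Q where "Q Y = (\<Sum>l=0..m. p l * [:(\<Prod>s\<in>boxes Y. \<Theta> (cont s)) $ (m - l):])" for Y
    have "poly_obs Q" unfolding Q_def
      by (intro poly_obs_sum poly_obs_mult poly_obs_const poly_obs_obs obs.obs_gen obs_gen p) auto
    moreover have "(\<Prod>s\<in>boxes (add_box \<gamma> b Y). \<Theta> (cont s)) $ m = poly (Q Y) (box_content \<gamma> b)"
      if "tuple Y" "\<gamma> \<in> {1..r}" "b \<notin> Y \<gamma>" for Y \<gamma> b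
    proof -
      have "(\<gamma>, b) \<notin> boxes Y" using that by (simp add: boxes_def)
      then show ?thesis using finite_boxes[OF that(1)]
        unfolding boxes_add_box[OF that(2)] by (simp add: fps_mult_nth p Q_def poly_sum mult.commute)
    qed
    ultimately show ?case by blast
  next
    case (obs_add f g)
    then obtain P Q where P: "poly_obs P" "poly_obs Q"
      "\<forall>Y \<gamma> b. tuple Y \<longrightarrow> \<gamma> \<in> {1..r} \<longrightarrow> b \<notin> Y \<gamma> \<longrightarrow> f (add_box \<gamma> b Y) = poly (P Y) (box_content \<gamma> b)"
      "\<forall>Y \<gamma> b. tuple Y \<longrightarrow> \<gamma> \<in> {1..r} \<longrightarrow> b \<notin> Y \<gamma> \<longrightarrow> g (add_box \<gamma> b Y) = poly (Q Y) (box_content \<gamma> b)"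
      by blast
    show ?case by (rule exI[of _ "\<lambda>Y. P Y + Q Y"]) (use P poly_obs_add in \<open>simp del: fun_upd_apply\<close>)
  next
    case (obs_mult f g)
    then obtain P Q where P: "poly_obs P" "poly_obs Q"
      "\<forall>Y \<gamma> b. tuple Y \<longrightarrow> \<gamma> \<in> {1..r} \<longrightarrow> b \<notin> Y \<gamma> \<longrightarrow> f (add_box \<gamma> b Y) = poly (P Y) (box_content \<gamma> b)"
      "\<forall>Y \<gamma> b. tuple Y \<longrightarrow> \<gamma> \<in> {1..r} \<longrightarrow> b \<notin> Y \<gamma> \<longrightarrow> g (add_box \<gamma> b Y) = poly (Q Y) (box_content \<gamma> b)"
      by blast
    show ?case by (rule exI[of _ "\<lambda>Y. P Y * Q Y"]) (use P poly_obs_mult in \<open>simp del: fun_upd_apply\<close>)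
  qed
  then show ?thesis using that by blast
qed

section \<open>Summing over the addable corners\<close>

text \<open>The second family comes from the factors c - cont t - (e1 + e2) in
  \<open>weight_add_box\<close> and corresponds to no addable box.\<close>

definition poles :: "(nat \<Rightarrow> (nat \<times> nat) set) \<Rightarrow> 'a set" where
  "poles Y = cont ` Add Y \<union> (\<lambda>t. cont t + (e1 + e2)) ` Add Y"

text \<open>The poles are interpolation nodes and have to be distinct; for the zeros an indexed
  family is enough.\<close>

definition zero_index :: "(nat \<Rightarrow> (nat \<times> nat) set) \<Rightarrow> ((nat \<times> nat \<times> nat) \<times> 'a) set" where
  "zero_index Y = Rem Y \<times> {0, e1 + e2}"

abbreviation zero_val :: "(nat \<times> nat \<times> nat) \<times> 'a \<Rightarrow> 'a" where
  "zero_val i \<equiv> cont (fst i) - snd i"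

lemma Add_subset: "t \<in> Add Y \<Longrightarrow> fst t \<in> {1..r} \<and> snd t \<in> addable (Y (fst t))"
  by (auto simp: Add_def)

lemma inj_cont: "A \<subseteq> {1..r} \<times> UNIV \<Longrightarrow> inj_on cont A"
proof (rule inj_onI)
  fix s t assume "A \<subseteq> {1..r} \<times> UNIV" and st: "s \<in> A" "t \<in> A" "cont s = cont t"
  then have "fst s \<in> {1..r}" "fst t \<in> {1..r}" by auto
  then show "s = t" using box_content_eq_iff st(3) by (simp add: prod_eq_iff)
qed

text \<open>Equality would place t diagonally outside s = (i, j); as t is addable, (i, j + 1) and
  then s itself would lie in the diagram.\<close>

lemma Add_shift:
  assumes "tuple Y" "s \<in> Add Y" "t \<in> Add Y"
  shows "cont s \<noteq> cont t + (e1 + e2)"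
proof
  assume "cont s = cont t + (e1 + e2)"
  then have "cont t - cont s + (e1 + e2) = 0" by simp
  then have *: "fst t = fst s" "snd t = (fst (snd s) + 1, snd (snd s) + 1)"
    using box_content_add_eps[of "fst t" "fst s"] Add_subset assms by blast+
  let ?Y = "Y (fst s)"
  have yd: "?Y \<in> young_diagrams" using assms Add_subset[of s] by (auto simp: tuple_def)
  have "snd s \<in> addable ?Y" "snd t \<in> addable ?Y" using assms * Add_subset by metis+
  then have "snd s \<notin> ?Y" "1 \<le> fst (snd s)" "1 \<le> snd (snd s)" "(fst (snd s), snd (snd s) + 1) \<in> ?Y"
    by (auto simp: addable_def *)
  then show False using young_down[OF yd, of "fst (snd s)" "snd (snd s) + 1" "fst (snd s)" "snd (snd s)"] by simp
qed

lemma prod_poles: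
  fixes h :: "'a \<Rightarrow> 'b::comm_monoid_mult"
  assumes "tuple Y"
  shows "prod h (poles Y) = (\<Prod>t\<in>Add Y. h (cont t)) * (\<Prod>t\<in>Add Y. h (cont t + (e1 + e2)))"
proof -
  have inj: "inj_on cont (Add Y)" by (rule inj_cont) (auto simp: Add_def)
  then have inj': "inj_on (\<lambda>t. cont t + (e1 + e2)) (Add Y)" by (auto simp: inj_on_def)
  have "cont ` Add Y \<inter> (\<lambda>t. cont t + (e1 + e2)) ` Add Y = {}" using Add_shift[OF assms] by auto
  then show ?thesis unfolding poles_def using finite_Add[OF assms]
    by (subst prod.union_disjoint) (auto simp: prod.reindex[OF inj] prod.reindex[OF inj'])
qed

lemma finite_poles: "tuple Y \<Longrightarrow> finite (poles Y)"
  by (auto simp: poles_def finite_Add)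

lemma card_poles: "tuple Y \<Longrightarrow> card (poles Y) = 2 * card (Add Y)"
proof -
  assume Y: "tuple Y"
  have inj: "inj_on cont (Add Y)" by (rule inj_cont) (auto simp: Add_def)
  then have inj': "inj_on (\<lambda>t. cont t + (e1 + e2)) (Add Y)" by (auto simp: inj_on_def)
  have "cont ` Add Y \<inter> (\<lambda>t. cont t + (e1 + e2)) ` Add Y = {}" using Add_shift[OF Y] by auto
  then show ?thesis unfolding poles_def using finite_Add[OF Y]
    by (subst card_Un_disjoint) (auto simp: card_image[OF inj] card_image[OF inj'])
qed

lemma eps_neq_0: "r \<ge> 1 \<Longrightarrow> e1 + e2 \<noteq> 0"
  using generic[of 1 1 1 1] by simp

lemma prod_zero_index:
  fixes h :: "'a \<Rightarrow> 'b::comm_monoid_mult"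
  assumes "tuple Y" "r \<ge> 1"
  shows "(\<Prod>i\<in>zero_index Y. h (zero_val i)) = (\<Prod>t\<in>Rem Y. h (cont t) * h (cont t - (e1 + e2)))"
proof -
  have "(\<Prod>i\<in>zero_index Y. h (zero_val i)) = (\<Prod>t\<in>Rem Y. \<Prod>d\<in>{0, e1 + e2}. h (cont t - d))"
    unfolding zero_index_def using finite_Rem[OF assms(1)] by (subst prod.cartesian_product) (simp add: case_prod_unfold)
  then show ?thesis using eps_neq_0[OF assms(2)] by simp
qed

lemma card_zero_index: "tuple Y \<Longrightarrow> r \<ge> 1 \<Longrightarrow> card (zero_index Y) = 2 * card (Rem Y)"
  using eps_neq_0 by (simp add: zero_index_def card_cartesian_product)

lemma finite_zero_index: "tuple Y \<Longrightarrow> finite (zero_index Y)"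
  by (simp add: zero_index_def finite_Rem)

text \<open>Up to the constant this is the summand at c of a Lagrange sum with nodes
  \<open>poles Y\<close>. The weights of the enlarged tuples are thus one part of that sum; the
  other part sits at the shifted nodes.\<close>

lemma weight_add_box_poles:
  assumes Y: "tuple Y" and \<gamma>: "\<gamma> \<in> {1..r}" and b: "b \<in> addable (Y \<gamma>)"
  defines "c \<equiv> box_content \<gamma> b"
  shows "weight (add_box \<gamma> b Y) = weight Y * ((- 1) ^ r * (e1 + e2) / (e1 * e2)) *
    ((\<Prod>i\<in>zero_index Y. c - zero_val i) / (\<Prod>x\<in>poles Y - {c}. c - x))"
proof -
  have r: "r \<ge> 1" using \<gamma> by simp
  have bA: "(\<gamma>, b) \<in> Add Y" using \<gamma> b by (auto simp: Add_def)
  have inj: "inj_on cont (Add Y)" by (rule inj_cont) (auto simp: Add_def)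
  then have inj': "inj_on (\<lambda>t. cont t + (e1 + e2)) (Add Y)" by (auto simp: inj_on_def)
  have img: "cont ` Add Y - {c} = cont ` (Add Y - {(\<gamma>, b)})"
    using bA inj_on_image_set_diff[OF inj, of "Add Y" "{(\<gamma>, b)}"] by (auto simp: c_def)
  have nc: "c \<notin> (\<lambda>t. cont t + (e1 + e2)) ` Add Y" using Add_shift[OF Y bA] by (auto simp: c_def)
  have dj: "cont ` (Add Y - {(\<gamma>, b)}) \<inter> (\<lambda>t. cont t + (e1 + e2)) ` Add Y = {}" using Add_shift[OF Y] by auto
  have "poles Y - {c} = cont ` (Add Y - {(\<gamma>, b)}) \<union> (\<lambda>t. cont t + (e1 + e2)) ` Add Y"
    unfolding poles_def Un_Diff img using nc by simp
  then have "(\<Prod>x\<in>poles Y - {c}. c - x) =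
      (\<Prod>x\<in>cont ` (Add Y - {(\<gamma>, b)}). c - x) * (\<Prod>x\<in>(\<lambda>t. cont t + (e1 + e2)) ` Add Y. c - x)"
    using dj finite_Add[OF Y] by (simp add: prod.union_disjoint)
  also have "(\<Prod>x\<in>cont ` (Add Y - {(\<gamma>, b)}). c - x) = (\<Prod>t\<in>Add Y - {(\<gamma>, b)}. c - cont t)"
    by (subst prod.reindex[OF inj_on_subset[OF inj]]) auto
  also have "(\<Prod>x\<in>(\<lambda>t. cont t + (e1 + e2)) ` Add Y. c - x) = (\<Prod>t\<in>Add Y. c - cont t - (e1 + e2))"
    by (subst prod.reindex[OF inj']) (simp add: diff_diff_eq)
  finally have "(\<Prod>x\<in>poles Y - {c}. c - x) = (\<Prod>t\<in>Add Y - {(\<gamma>, b)}. c - cont t) * (\<Prod>t\<in>Add Y. c - cont t - (e1 + e2))" .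
  then show ?thesis
    unfolding weight_add_box[OF Y \<gamma> b] prod_zero_index[OF Y r] c_def[symmetric]
    by (simp add: algebra_simps)
qed

end

section \<open>The generating series of zeros and poles as a product over boxes\<close>

context nekrasov_subring
begin

lemma corner_prod_tuple:
  fixes f :: "nat \<Rightarrow> nat \<times> nat \<Rightarrow> 'b::comm_monoid_mult"
  assumes "tuple Y"
  shows "(\<Prod>t\<in>Add Y. f (fst t) (snd t)) *
      (\<Prod>x\<in>boxes Y. f (fst x) (snd x) * f (fst x) (fst (snd x) + 1, snd (snd x) + 1)) =
    (\<Prod>\<alpha>=1..r. f \<alpha> (1, 1)) * (\<Prod>t\<in>Rem Y. f (fst t) (fst (snd t) + 1, snd (snd t) + 1)) *
      (\<Prod>x\<in>boxes Y. f (fst x) (fst (snd x) + 1, snd (snd x)) * f (fst x) (fst (snd x), snd (snd x) + 1))"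
proof -
  have yd: "Y \<alpha> \<in> young_diagrams" if "\<alpha> \<in> {1..r}" for \<alpha> using assms that by (simp add: tuple_def)
  note fin = addable_removable_finite[OF yd] finite_young[OF yd]
  have S: "(\<Prod>x\<in>(SIGMA \<alpha>:{1..r}. A \<alpha>). g (fst x) (snd x)) = (\<Prod>\<alpha>=1..r. \<Prod>s\<in>A \<alpha>. g \<alpha> s)"
    if "\<And>\<alpha>. \<alpha> \<in> {1..r} \<Longrightarrow> finite (A \<alpha>)" for A and g :: "nat \<Rightarrow> nat \<times> nat \<Rightarrow> 'b"
    using that by (subst prod.Sigma) (auto simp: case_prod_unfold)
  have "(\<Prod>\<alpha>=1..r. (\<Prod>t\<in>addable (Y \<alpha>). f \<alpha> t) * (\<Prod>x\<in>Y \<alpha>. f \<alpha> x * f \<alpha> (fst x + 1, snd x + 1))) =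
    (\<Prod>\<alpha>=1..r. f \<alpha> (1, 1) * (\<Prod>t\<in>removable (Y \<alpha>). f \<alpha> (fst t + 1, snd t + 1)) *
      (\<Prod>x\<in>Y \<alpha>. f \<alpha> (fst x + 1, snd x) * f \<alpha> (fst x, snd x + 1)))"
    by (rule prod.cong) (use corner_prod[OF yd] in \<open>simp_all add: case_prod_unfold\<close>)
  then show ?thesis
    unfolding Add_def Rem_def boxes_def
    by (subst (asm) (1 2 3) prod.distrib)
      (simp only: S[of "\<lambda>\<alpha>. addable (Y \<alpha>)" f, OF fin(1)] S[of "\<lambda>\<alpha>. removable (Y \<alpha>)" "\<lambda>\<alpha> t. f \<alpha> (fst t + 1, snd t + 1)", OF fin(2)]
        S[of Y "\<lambda>\<alpha> x. f \<alpha> x * f \<alpha> (fst x + 1, snd x + 1)", OF fin(3)]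
        S[of Y "\<lambda>\<alpha> x. f \<alpha> (fst x + 1, snd x) * f \<alpha> (fst x, snd x + 1)", OF fin(3)])
qed

lemma fps_prod_nth_0: "(\<Prod>i\<in>A. F i) $ 0 = (\<Prod>i\<in>A. (F i $ 0 :: 'a))"
  by (induction A rule: infinite_finite_induct) simp_all

text \<open>What one box with content c contributes to the quotient of zeros by poles. Writing c + 0
  and c + - e1 keeps each factor in the shape of \<open>poly_fps_lin\<close>.\<close>

definition theta :: "'a \<Rightarrow> 'a fps" where
  "theta c = fps_lin (c + 0) * fps_lin (c + - (e1 + e2)) * fps_lin (c + (e1 + e2)) * fps_lin (c + 0) *
     inverse (fps_lin (c + - e1)) * inverse (fps_lin (c + - e2)) *
     inverse (fps_lin (c + e1)) * inverse (fps_lin (c + e2))"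

text \<open>The contribution of empty diagrams, whose only addable box is (1, 1) with content
  \<open>a \<alpha>\<close>.\<close>

definition theta0 :: "'a fps" where
  "theta0 = (\<Prod>\<alpha>=1..r. inverse (fps_lin (a \<alpha>)) * inverse (fps_lin (a \<alpha> + (e1 + e2))))"

lemma poly_fps_theta: "poly_fps theta"
  unfolding theta_def using params_in_R
  by (intro poly_fps_mult poly_fps_lin) auto

lemma theta0_in_R: "theta0 $ n \<in> R"
  unfolding theta0_def using params_in_R
  by (intro fps_prod_in_R fps_mult_in_R) (auto simp: inverse_fps_lin)

lemma fps_eq_of_mult_eq:
  fixes A B F P Q :: "'a fps"
  assumes "A * P = F * B * Q" "A $ 0 \<noteq> 0" "F $ 0 \<noteq> 0" "Q $ 0 \<noteq> 0"
  shows "B * inverse A = inverse F * (P * inverse Q)"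
proof -
  have "B * inverse A = (inverse F * F) * (inverse Q * Q) * B * inverse A" using assms by (simp add: inverse_mult_eq_1)
  also have "\<dots> = inverse F * inverse Q * inverse A * (A * P)" using assms(1) by (simp add: mult_ac)
  also have "\<dots> = inverse F * inverse Q * P * (inverse A * A)" by (simp add: mult_ac)
  finally show ?thesis unfolding inverse_mult_eq_1[OF assms(2)] by (simp add: mult_ac)
qed

text \<open>\<open>corner_prod_tuple\<close> is applied to (1 - c T)(1 - (c + e1 + e2) T). Addable
  corners give the poles; removable corners, moved by (1, 1) and hence with content lowered by e1 +
  e2, give the zeros. A product over corners becomes one that depends only on the contents.\<close>

lemma pole_series:
  assumes "tuple Y" "r \<ge> 1"
  shows "(\<Prod>i\<in>zero_index Y. fps_lin (zero_val i)) * inverse (\<Prod>x\<in>poles Y. fps_lin x) =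
    theta0 * (\<Prod>s\<in>boxes Y. theta (cont s))"
proof -
  let ?e = "e1 + e2"
  let ?f = "\<lambda>\<alpha> s. fps_lin (box_content \<alpha> s) * fps_lin (box_content \<alpha> s + ?e)"
  have s: "box_content \<alpha> (i + 1, j + 1) = box_content \<alpha> (i, j) - ?e" "box_content \<alpha> (i + 1, j) = box_content \<alpha> (i, j) - e1"
    "box_content \<alpha> (i, j + 1) = box_content \<alpha> (i, j) - e2" "box_content \<alpha> (1, 1) = a \<alpha>"
    for \<alpha> i j by (simp_all add: box_content_def algebra_simps)
  let ?A = "\<Prod>t\<in>Add Y. ?f (fst t) (snd t)"
  let ?P = "\<Prod>x\<in>boxes Y. ?f (fst x) (snd x) * ?f (fst x) (fst (snd x) + 1, snd (snd x) + 1)"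
  let ?Q = "\<Prod>x\<in>boxes Y. ?f (fst x) (fst (snd x) + 1, snd (snd x)) * ?f (fst x) (fst (snd x), snd (snd x) + 1)"
  let ?F = "\<Prod>\<alpha>=1..r. ?f \<alpha> (1, 1)"
  let ?B = "\<Prod>t\<in>Rem Y. ?f (fst t) (fst (snd t) + 1, snd (snd t) + 1)"
  have "?A * ?P = ?F * ?B * ?Q" by (rule corner_prod_tuple[OF assms(1)])
  then have "?B * inverse ?A = inverse ?F * (?P * inverse ?Q)"
    by (rule fps_eq_of_mult_eq) (auto simp: fps_prod_nth_0)
  moreover have "?A = (\<Prod>x\<in>poles Y. fps_lin x)"
    unfolding prod_poles[OF assms(1)] by (simp add: prod.distrib)
  moreover have "?B = (\<Prod>i\<in>zero_index Y. fps_lin (zero_val i))"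
    unfolding prod_zero_index[OF assms, of "\<lambda>x. fps_lin x"] by (rule prod.cong) (simp_all only: s(1) prod.collapse mult.commute diff_add_cancel)
  moreover have "inverse ?F = theta0"
    unfolding theta0_def s by (simp add: inverse_prod_fps fps_inverse_mult)
  moreover have "?P * inverse ?Q = (\<Prod>s\<in>boxes Y. theta (cont s))"
    unfolding inverse_prod_fps prod.distrib[symmetric] s prod.collapse
    by (rule prod.cong) (simp_all add: theta_def fps_inverse_mult mult_ac)
  ultimately show ?thesis by simp
qed

text \<open>The sum over all poles of a polynomial insertion is again symmetric in the contents, hence free
  of the singularities of its individual terms.\<close>

lemma lagrange_sum_poles:
  assumes "poly_obs Q" "r \<ge> 1"
  shows "\<exists>f. obs f \<and> (\<forall>Y. tuple Y \<longrightarrow>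
    lagrange_sum (poles Y) (\<lambda>x. poly (Q Y) x * (\<Prod>i\<in>zero_index Y. x - zero_val i)) = f Y)"
proof -
  obtain D where D: "\<And>Y. degree (Q Y) \<le> D" using assms(1) by (auto simp: poly_obs_def)
  define S where "S Y = theta0 * (\<Prod>s\<in>boxes Y. theta (cont s))" for Y
  \<comment> \<open>There are 2 r more poles than zeros for every Y, so
    \<open>lagrange_sum_power_prod\<close> picks the coefficient of degree k + 1 - 2 r.\<close>
  define f where "f Y = (\<Sum>k\<le>D. coeff (Q Y) k * (if 2 * r \<le> k + 1 then S Y $ (k + 1 - 2 * r) else 0))" for Y
  have S: "obs (\<lambda>Y. S Y $ n)" for n
    unfolding S_def fps_mult_nth
    by (intro obs_sum obs_mult obs_const theta0_in_R obs_gen poly_fps_theta)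
  have "obs f"
    unfolding f_def
  proof (intro obs_sum obs_mult)
    fix k
    show "obs (\<lambda>Y. coeff (Q Y) k)" using assms(1) by (simp add: poly_obs_def)
    show "obs (\<lambda>Y. if 2 * r \<le> k + 1 then S Y $ (k + 1 - 2 * r) else 0)"
      by (cases "2 * r \<le> k + 1") (auto intro: S obs_const)
  qed
  moreover have "lagrange_sum (poles Y) (\<lambda>x. poly (Q Y) x * (\<Prod>i\<in>zero_index Y. x - zero_val i)) = f Y"
    if Y: "tuple Y" for Y
  proof -
    note fin = finite_poles[OF Y] finite_zero_index[OF Y]
    have c: "card (poles Y) = card (zero_index Y) + 2 * r"
      using card_Add[OF Y] assms(2) by (simp add: card_poles[OF Y] card_zero_index[OF Y])
    have ne: "poles Y \<noteq> {}" using c assms(2) by auto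
    have "poly (Q Y) x = (\<Sum>k\<le>D. coeff (Q Y) k * x ^ k)" for x
      unfolding poly_altdef using D[of Y] by (intro sum.mono_neutral_left) (auto simp: coeff_eq_0)
    then have "lagrange_sum (poles Y) (\<lambda>x. poly (Q Y) x * (\<Prod>i\<in>zero_index Y. x - zero_val i)) =
        (\<Sum>x\<in>poles Y. \<Sum>k\<le>D. coeff (Q Y) k * (x ^ k * (\<Prod>i\<in>zero_index Y. x - zero_val i) / (\<Prod>y\<in>poles Y - {x}. x - y)))"
      unfolding lagrange_sum_def by (simp add: sum_distrib_right sum_divide_distrib mult.assoc)
    also have "\<dots> = (\<Sum>k\<le>D. coeff (Q Y) k * lagrange_sum (poles Y) (\<lambda>x. x ^ k * (\<Prod>i\<in>zero_index Y. x - zero_val i)))"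
      unfolding lagrange_sum_def sum_distrib_left by (rule sum.swap)
    also have "\<dots> = f Y"
      unfolding f_def lagrange_sum_power_prod[OF fin(1) ne fin(2)] pole_series[OF Y assms(2)] S_def[symmetric] c
      by (rule sum.cong) auto
    finally show ?thesis .
  qed
  ultimately show ?thesis by blast
qed

end

section \<open>Regularity along a hyperplane of positive slope\<close>

text \<open>Along \<open>v = 0\<close>, where \<open>v = e1 - (q / p) e2\<close>, the contents of two boxes in the
  same component coincide iff their heights \<open>q i + p j\<close> agree.\<close>

locale nekrasov_cluster = nekrasov_subring r e1 e2 a R
  for r :: nat and e1 e2 :: "'a::field_char_0" and a :: "nat \<Rightarrow> 'a" and R :: "'a set" +
  fixes v w :: 'a and p q :: nat
  assumes r_pos: "r \<ge> 1" and e1_eq: "e1 = of_nat q * w + v" and e2_eq: "e2 = of_nat p * w"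
    and pq: "p > 0" "q > 0" and v_in_R: "v \<in> R"
    and unit: "\<lbrakk>\<alpha> \<in> {1..r}; \<beta> \<in> {1..r}; \<alpha> \<noteq> \<beta> \<or> int q * k + int p * l \<noteq> 0\<rbrakk> \<Longrightarrow>
      inverse (of_int k * e1 + of_int l * e2 + a \<beta> - a \<alpha>) \<in> R"
begin

definition key :: "nat \<times> nat \<times> nat \<Rightarrow> nat \<times> nat" where
  "key x = (fst x, q * fst (snd x) + p * snd (snd x))"

lemma lin_same_height:
  assumes "int q * k + int p * l = 0"
  shows "of_int k * e1 + of_int l * e2 = of_int k * v"
proof -
  have "of_int k * e1 + of_int l * e2 = of_int k * v + of_int (int q * k + int p * l) * w"
    by (simp add: e1_eq e2_eq algebra_simps)
  then show ?thesis unfolding assms by simp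
qed

lemma cont_same_key:
  assumes "key x = key y"
  shows "\<exists>u\<in>R. cont x = cont y + v * u"
proof -
  let ?k = "int (fst (snd y)) - int (fst (snd x))" and ?l = "int (snd (snd y)) - int (snd (snd x))"
  have f: "fst x = fst y" and n: "q * fst (snd x) + p * snd (snd x) = q * fst (snd y) + p * snd (snd y)"
    using assms by (auto simp: key_def)
  have "int q * ?k + int p * ?l = 0"
    using arg_cong[OF n, of int] by (simp add: algebra_simps)
  from lin_same_height[OF this] have "cont x - cont y = of_int ?k * v"
    using f box_content_diff[of "fst x" "snd x" "fst y" "snd y"] by simp
  then have "cont x = cont y + v * of_int ?k" by (simp add: algebra_simps)
  then show ?thesis by blast
qed

lemma cont_diff_unit:
  assumes "fst x \<in> {1..r}" "fst y \<in> {1..r}" "key x \<noteq> key y"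
  shows "inverse (cont x - cont y) \<in> R"
proof -
  let ?k = "int (fst (snd y)) - int (fst (snd x))" and ?l = "int (snd (snd y)) - int (snd (snd x))"
  have "fst y \<noteq> fst x \<or> int q * ?k + int p * ?l \<noteq> 0"
  proof (rule ccontr)
    assume "\<not> ?thesis"
    then have "fst y = fst x" "int (q * fst (snd x) + p * snd (snd x)) = int (q * fst (snd y) + p * snd (snd y))"
      by (simp_all add: algebra_simps)
    then show False using assms(3) unfolding key_def of_nat_eq_iff by simp
  qed
  from unit[OF assms(2,1) this] show ?thesis unfolding box_content_diff .
qed

lemma cont_diff_eps_unit:
  assumes "fst x \<in> {1..r}" "fst t \<in> {1..r}"
    "fst t \<noteq> fst x \<or> q * fst (snd t) + p * snd (snd t) \<noteq> q * fst (snd x) + p * snd (snd x) + p + q"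
  shows "inverse (cont x - (cont t + (e1 + e2))) \<in> R"
proof -
  let ?k = "int (fst (snd t)) - int (fst (snd x)) - 1" and ?l = "int (snd (snd t)) - int (snd (snd x)) - 1"
  have "fst t \<noteq> fst x \<or> int q * ?k + int p * ?l \<noteq> 0"
  proof (rule ccontr)
    assume "\<not> ?thesis"
    then have "fst t = fst x"
      "int (q * fst (snd t) + p * snd (snd t)) = int (q * fst (snd x) + p * snd (snd x) + p + q)"
      by (simp_all add: algebra_simps)
    then show False using assms(3) unfolding of_nat_eq_iff by simp
  qed
  note u = unit[OF assms(2,1) this]
  have "cont x - (cont t + (e1 + e2)) = of_int ?k * e1 + of_int ?l * e2 + a (fst x) - a (fst t)"
    by (simp add: box_content_def algebra_simps)
  then show ?thesis using u by simp
qed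

section \<open>Orders of the poles along v = 0\<close>

definition pole_bounded :: "'a \<Rightarrow> bool" where
  "pole_bounded x \<longleftrightarrow> (\<exists>K. v ^ K * x \<in> R)"

lemma pole_bounded_mult:
  assumes "pole_bounded x" "pole_bounded y"
  shows "pole_bounded (x * y)"
proof -
  obtain K L where "v ^ K * x \<in> R" "v ^ L * y \<in> R" using assms by (auto simp: pole_bounded_def)
  then have "v ^ (K + L) * (x * y) \<in> R" using mult[of "v ^ K * x" "v ^ L * y"] by (simp add: power_add mult_ac)
  then show ?thesis unfolding pole_bounded_def by blast
qed

lemma pole_bounded_in_R: "x \<in> R \<Longrightarrow> pole_bounded x"
  unfolding pole_bounded_def by (intro exI[of _ 0]) simp

lemma pole_bounded_prod: "(\<And>i. i \<in> A \<Longrightarrow> pole_bounded (f i)) \<Longrightarrow> pole_bounded (prod f A)"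
  by (induction A rule: infinite_finite_induct) (auto intro: pole_bounded_mult pole_bounded_in_R)

text \<open>A form with \<alpha> = \<beta> and height 0 is an integer multiple of v; every other
  form is a unit.\<close>

lemma pole_bounded_lin:
  assumes "\<alpha> \<in> {1..r}" "\<beta> \<in> {1..r}"
  shows "pole_bounded (inverse (of_int k * e1 + of_int l * e2 + a \<beta> - a \<alpha>))"
proof (cases "\<alpha> \<noteq> \<beta> \<or> int q * k + int p * l \<noteq> 0")
  case True
  then show ?thesis using unit[OF assms] by (intro pole_bounded_in_R) auto
next
  case False
  then have eq: "of_int k * e1 + of_int l * e2 + a \<beta> - a \<alpha> = of_int k * v" using lin_same_height[of k l] by simp
  have "v ^ 1 * inverse (of_int k * v) \<in> R"
    using inverse_int[of k] by (cases "k = 0 \<or> v = 0") (auto simp: field_simps)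
  then show ?thesis unfolding eq pole_bounded_def by blast
qed

lemma pole_bounded_weight: "pole_bounded (weight Y)"
proof -
  have "pole_bounded (inverse (factor Y \<alpha> \<beta>))" if "\<alpha> \<in> {1..r}" "\<beta> \<in> {1..r}" for \<alpha> \<beta>
    unfolding factor_def inverse_mult_distrib prod_inversef[symmetric] comp_def
    using pole_bounded_lin[OF that, of "- leg (Y \<beta>) s" "arm (Y \<alpha>) s + 1" for s]
      pole_bounded_lin[OF that, of "leg (Y \<alpha>) t + 1" "- arm (Y \<beta>) t" for t]
    by (intro pole_bounded_mult pole_bounded_prod) simp_all
  then show ?thesis
    unfolding weight_def divide_inverse prod_inversef[symmetric] comp_def mult_1_left
    by (intro pole_bounded_prod) auto
qed

lemma pole_bounded_uniform:
  assumes "finite A"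
  shows "\<exists>K. \<forall>Y\<in>A. v ^ K * weight Y \<in> R"
  using assms
proof (induction A rule: finite_induct)
  case (insert Y A)
  obtain K where K: "\<forall>Y\<in>A. v ^ K * weight Y \<in> R" using insert.IH by blast
  obtain L where L: "v ^ L * weight Y \<in> R" using pole_bounded_weight by (auto simp: pole_bounded_def)
  have "v ^ (K + L) * weight Z \<in> R" if "Z \<in> insert Y A" for Z
  proof (cases "Z \<in> A")
    case True
    then show ?thesis using mult[OF power[OF v_in_R, of L] bspec[OF K True]] by (simp add: power_add mult_ac)
  next
    case False
    then show ?thesis using mult[OF power[OF v_in_R, of K] L] that by (simp add: power_add mult_ac)
  qed
  then show ?case by blast
qed simp

section \<open>Classes of tuples with equal contents modulo v\<close>

definition key_count :: "(nat \<Rightarrow> (nat \<times> nat) set) \<Rightarrow> nat \<times> nat \<Rightarrow> nat" where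
  "key_count Y \<kappa> = card {x\<in>boxes Y. key x = \<kappa>}"

lemma key_count_pos: "tuple Y \<Longrightarrow> x \<in> boxes Y \<Longrightarrow> key_count Y (key x) > 0"
proof -
  assume Y: "tuple Y" "x \<in> boxes Y"
  then have "x \<in> {y\<in>boxes Y. key y = key x}" "finite {y\<in>boxes Y. key y = key x}" using finite_boxes by auto
  then show ?thesis unfolding key_count_def card_gt_0_iff by blast
qed

lemma key_count_posD: "key_count Y \<kappa> > 0 \<Longrightarrow> \<exists>x\<in>boxes Y. key x = \<kappa>"
  by (auto simp: key_count_def card_gt_0_iff)

lemma key_count_add_box:
  assumes "tuple Y" "\<gamma> \<in> {1..r}" "b \<notin> Y \<gamma>"
  shows "key_count (add_box \<gamma> b Y) = (key_count Y)(key (\<gamma>, b) := key_count Y (key (\<gamma>, b)) + 1)"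
proof
  fix \<kappa>
  have n: "(\<gamma>, b) \<notin> boxes Y" using assms by (simp add: boxes_def)
  have "{x\<in>insert (\<gamma>, b) (boxes Y). key x = \<kappa>} =
      (if key (\<gamma>, b) = \<kappa> then insert (\<gamma>, b) {x\<in>boxes Y. key x = \<kappa>} else {x\<in>boxes Y. key x = \<kappa>})" by auto
  then show "key_count (add_box \<gamma> b Y) \<kappa> = ((key_count Y)(key (\<gamma>, b) := key_count Y (key (\<gamma>, b)) + 1)) \<kappa>"
    using n finite_boxes[OF assms(1)] by (simp add: key_count_def boxes_add_box[OF assms(2)])
qed

lemma card_add_box:
  assumes "Y \<in> young_tuples r n" "\<gamma> \<in> {1..r}" "b \<in> addable (Y \<gamma>)"
  shows "add_box \<gamma> b Y \<in> young_tuples r (Suc n)"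
proof -
  have t: "tuple Y" using assms tuple_young_tuples by blast
  have nb: "b \<notin> Y \<gamma>" "finite (Y \<gamma>)"
    using assms(3) addable_pos[of "fst b" "snd b"] t assms(2) by (auto simp: tuple_def finite_young)
  have "(\<Sum>\<alpha>=1..r. card ((add_box \<gamma> b Y) \<alpha>)) = (\<Sum>\<alpha>=1..r. card (Y \<alpha>) + (if \<alpha> = \<gamma> then 1 else 0))"
    by (rule sum.cong) (use nb in auto)
  also have "\<dots> = Suc n" using assms by (simp add: sum.distrib young_tuples_def)
  finally show ?thesis using assms young_insert[of "Y \<gamma>" b]
    by (auto simp: young_tuples_def PiE_iff extensional_def)
qed

lemma card_remove_box:
  assumes "Y \<in> young_tuples r (Suc n)" "\<gamma> \<in> {1..r}" "b \<in> removable (Y \<gamma>)"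
  shows "Y(\<gamma> := Y \<gamma> - {b}) \<in> young_tuples r n"
proof -
  have t: "tuple Y" using assms tuple_young_tuples by blast
  have nb: "b \<in> Y \<gamma>" "finite (Y \<gamma>)"
    using assms(3) t assms(2) by (auto simp: tuple_def finite_young removable_def)
  have "(\<Sum>\<alpha>=1..r. card (Y \<alpha>)) = (\<Sum>\<alpha>=1..r. card ((Y(\<gamma> := Y \<gamma> - {b})) \<alpha>) + (if \<alpha> = \<gamma> then 1 else 0))"
  proof (rule sum.cong)
    fix \<alpha>
    show "card (Y \<alpha>) = card ((Y(\<gamma> := Y \<gamma> - {b})) \<alpha>) + (if \<alpha> = \<gamma> then 1 else 0)"
      using card_Suc_Diff1[OF nb(2,1)] by simp
  qed simp
  then have "(\<Sum>\<alpha>=1..r. card ((Y(\<gamma> := Y \<gamma> - {b})) \<alpha>)) = n"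
    using assms by (simp add: sum.distrib young_tuples_def del: fun_upd_apply)
  then show ?thesis using assms young_remove[of "Y \<gamma>" b]
    by (auto simp: young_tuples_def PiE_iff extensional_def)
qed

text \<open>Both outer neighbours are strictly higher, since p and q are positive.\<close>

lemma top_box_removable:
  assumes "tuple Y" "(\<gamma>, b) \<in> boxes Y" "\<And>x. x \<in> boxes Y \<Longrightarrow> snd (key x) \<le> snd (key (\<gamma>, b))"
  shows "b \<in> removable (Y \<gamma>)"
proof -
  have "(\<gamma>, fst b + 1, snd b) \<notin> boxes Y" "(\<gamma>, fst b, snd b + 1) \<notin> boxes Y"
    using assms(3)[of "(\<gamma>, fst b + 1, snd b)"] assms(3)[of "(\<gamma>, fst b, snd b + 1)"] pq by (auto simp: key_def)
  then show ?thesis using assms(2) by (cases b) (auto simp: boxes_def removable_def)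
qed

text \<open>A tuple in a class arises from a smaller class by adding a box of maximal height. By
  \<open>lagrange_sum_poles\<close> the sum over all ways of adding a box is regular, and the cutoff polynomial removes
  the boxes of the wrong content at the cost of an error divisible by a power of \<open>v\<close> that exceeds all
  pole orders.\<close>

lemma sum_key_class_in_R:
  assumes "obs f"
  shows "(\<Sum>Y\<in>{Y\<in>young_tuples r n. key_count Y = d}. weight Y * f Y) \<in> R"
  using assms
proof (induction n arbitrary: d f)
  case 0
  have "weight Y = 1" if "Y \<in> young_tuples r 0" for Y
  proof -
    have "Y \<alpha> = {}" if "\<alpha> \<in> {1..r}" for \<alpha>
      using \<open>Y \<in> young_tuples r 0\<close> that by (auto simp: young_tuples_def PiE_iff finite_young)
    then have "factor Y \<alpha> \<beta> = 1" if "\<alpha> \<in> {1..r}" "\<beta> \<in> {1..r}" for \<alpha> \<beta>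
      using that by (simp add: factor_def)
    then show ?thesis by (simp add: weight_def)
  qed
  then show ?case using obs_in_R[OF 0] by (intro sum) auto
next
  case (Suc n)
  let ?T = "{Y\<in>young_tuples r (Suc n). key_count Y = d}"
  show ?case
  proof (cases "?T = {}")
    case False
    then obtain Y0 where Y0: "Y0 \<in> young_tuples r (Suc n)" "key_count Y0 = d" by blast
    have tY0: "tuple Y0" using Y0 tuple_young_tuples by blast
    have "card (boxes Y0) = Suc n"
      using Y0 tY0 by (simp add: boxes_def tuple_def finite_young young_tuples_def)
    then have fin0: "finite (boxes Y0)" "boxes Y0 \<noteq> {}" using finite_boxes[OF tY0] by auto
    obtain x0 where x0: "x0 \<in> boxes Y0" "\<And>x. x \<in> boxes Y0 \<Longrightarrow> snd (key x) \<le> snd (key x0)"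
    proof -
      have "Max ((\<lambda>x. snd (key x)) ` boxes Y0) \<in> (\<lambda>x. snd (key x)) ` boxes Y0" using fin0 by (intro Max_in) auto
      then obtain x0 where "x0 \<in> boxes Y0" "snd (key x0) = Max ((\<lambda>x. snd (key x)) ` boxes Y0)" by auto
      then show ?thesis using that fin0 by auto
    qed
    define \<gamma> where "\<gamma> = fst x0"
    define \<kappa> where "\<kappa> = key x0"
    have \<gamma>: "\<gamma> \<in> {1..r}" using x0(1) by (auto simp: \<gamma>_def boxes_def)
    have \<kappa>: "fst \<kappa> = \<gamma>" by (simp add: \<kappa>_def key_def \<gamma>_def)
    have d\<kappa>: "d \<kappa> > 0" using key_count_pos[OF tY0 x0(1)] Y0(2) by (simp add: \<kappa>_def)
    have top: "snd (key x) \<le> snd \<kappa>" if "tuple Y" "\<And>\<kappa>'. key_count Y \<kappa>' \<le> d \<kappa>'" "x \<in> boxes Y" for Y x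
    proof -
      have "key_count Y0 (key x) > 0" using key_count_pos[OF that(1,3)] that(2)[of "key x"] Y0(2) by simp
      then show ?thesis using key_count_posD x0(2) unfolding \<kappa>_def by metis
    qed
    define d' where "d' = d(\<kappa> := d \<kappa> - 1)"
    let ?T' = "{Y\<in>young_tuples r n. key_count Y = d'}"
    define B where "B Y = {b\<in>addable (Y \<gamma>). key (\<gamma>, b) = \<kappa>}" for Y :: "nat \<Rightarrow> (nat \<times> nat) set"
    define C where "C Y = {b. (\<gamma>, b) \<in> boxes Y \<and> key (\<gamma>, b) = \<kappa>}" for Y
    have fT: "finite ?T" "finite ?T'" using finite_young_tuples by auto
    have tT: "tuple Y" if "Y \<in> ?T \<or> Y \<in> ?T'" for Y using that tuple_young_tuples by blast
    have yd: "Y \<gamma> \<in> young_diagrams" if "Y \<in> ?T \<or> Y \<in> ?T'" for Y using tT[OF that] \<gamma> by (simp add: tuple_def)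
    have fB: "finite (B Y)" if "Y \<in> ?T'" for Y
    proof -
      have "finite (addable (Y \<gamma>))" using that yd[of Y] addable_removable_finite(1) by blast
      then show ?thesis by (simp add: B_def)
    qed
    have cC: "finite (C Y) \<and> card (C Y) = d \<kappa>" if "Y \<in> ?T" for Y
    proof -
      have "Pair \<gamma> ` C Y = {x\<in>boxes Y. key x = \<kappa>}" using \<kappa> by (force simp: C_def key_def)
      moreover have "inj_on (Pair \<gamma>) (C Y)" by (simp add: inj_on_def)
      ultimately show ?thesis
        using that finite_boxes[OF tT] card_image[of "Pair \<gamma>" "C Y"] finite_image_iff[of "Pair \<gamma>" "C Y"]
        by (auto simp: key_count_def)
    qed
    define g where "g Y = weight Y * f Y" for Y
    \<comment> \<open>Count pairs of a tuple and one of its \<open>d \<kappa>\<close> boxes with key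
      \<open>\<kappa>\<close>. Each such box is removable, so the pairs match the ways of adding a
      box with this key to a tuple of class \<open>d'\<close>. The factor \<open>d \<kappa>\<close>
      is invertible in R.\<close>
    have "of_nat (d \<kappa>) * (\<Sum>Y\<in>?T. g Y) = (\<Sum>Y\<in>?T. \<Sum>b\<in>C Y. g Y)"
      using cC by (simp add: sum_distrib_left)
    also have "\<dots> = (\<Sum>z\<in>Sigma ?T C. g (fst z))"
      using fT cC by (subst sum.Sigma) (auto simp: case_prod_unfold)
    also have "\<dots> = (\<Sum>z\<in>Sigma ?T' B. g (add_box \<gamma> (snd z) (fst z)))"
    proof (rule sum.reindex_bij_witness[of _ "\<lambda>z. (add_box \<gamma> (snd z) (fst z), snd z)"
          "\<lambda>z. ((fst z)(\<gamma> := fst z \<gamma> - {snd z}), snd z)"])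
      fix z assume z: "z \<in> Sigma ?T C"
      obtain Y b where zb: "z = (Y, b)" by (meson surj_pair)
      have Y: "Y \<in> ?T" and b: "(\<gamma>, b) \<in> boxes Y" "key (\<gamma>, b) = \<kappa>" using z zb by (auto simp: C_def)
      have tY: "tuple Y" and ydY: "Y \<gamma> \<in> young_diagrams" using Y tT yd by blast+
      have bY: "b \<in> Y \<gamma>" using b by (simp add: boxes_def)
      have ad: "add_box \<gamma> b (Y(\<gamma> := Y \<gamma> - {b})) = Y" using bY by (auto simp: fun_eq_iff)
      show "(add_box \<gamma> (snd ((fst z)(\<gamma> := fst z \<gamma> - {snd z}), snd z)) (fst ((fst z)(\<gamma> := fst z \<gamma> - {snd z}), snd z)),
          snd ((fst z)(\<gamma> := fst z \<gamma> - {snd z}), snd z)) = z" using ad zb by simp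
      have rb: "b \<in> removable (Y \<gamma>)"
        using top_box_removable[OF tY b(1)] top[OF tY] Y b by auto
      have Y': "Y(\<gamma> := Y \<gamma> - {b}) \<in> young_tuples r n" using card_remove_box \<gamma> rb Y by blast
      have "d = (key_count (Y(\<gamma> := Y \<gamma> - {b})))(\<kappa> := key_count (Y(\<gamma> := Y \<gamma> - {b})) \<kappa> + 1)"
        using key_count_add_box[OF tuple_young_tuples[OF Y'] \<gamma>, of b] Y b unfolding ad by simp
      then have "key_count (Y(\<gamma> := Y \<gamma> - {b})) = d'" unfolding d'_def
        by (metis add_diff_cancel_right' fun_upd_same fun_upd_triv fun_upd_upd)
      then show "((fst z)(\<gamma> := fst z \<gamma> - {snd z}), snd z) \<in> Sigma ?T' B"
        using Y' young_remove(2)[OF ydY rb] Y b zb by (simp add: B_def)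
      show "g (add_box \<gamma> (snd ((fst z)(\<gamma> := fst z \<gamma> - {snd z}), snd z)) (fst ((fst z)(\<gamma> := fst z \<gamma> - {snd z}), snd z))) = g (fst z)"
        using ad zb by simp
    next
      fix z assume z: "z \<in> Sigma ?T' B"
      obtain Y b where zb: "z = (Y, b)" by (meson surj_pair)
      have Y: "Y \<in> ?T'" and b: "b \<in> addable (Y \<gamma>)" "key (\<gamma>, b) = \<kappa>" using z zb by (auto simp: B_def)
      have nb: "b \<notin> Y \<gamma>" using b addable_pos[of "fst b" "snd b"] by auto
      have rm: "(add_box \<gamma> b Y)(\<gamma> := (add_box \<gamma> b Y) \<gamma> - {b}) = Y" using nb by (auto simp: fun_eq_iff)
      show "((fst (add_box \<gamma> (snd z) (fst z), snd z))(\<gamma> := fst (add_box \<gamma> (snd z) (fst z), snd z) \<gamma> - {snd (add_box \<gamma> (snd z) (fst z), snd z)}),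
          snd (add_box \<gamma> (snd z) (fst z), snd z)) = z" using rm zb by simp
      have "key_count (add_box \<gamma> b Y) = d"
        using key_count_add_box[of Y \<gamma> b] tT[of Y] \<gamma> nb Y b d\<kappa> by (simp add: d'_def)
      then show "(add_box \<gamma> (snd z) (fst z), snd z) \<in> Sigma ?T C"
        using card_add_box[of Y n \<gamma> b] Y b \<gamma> zb by (simp add: C_def boxes_def)
    qed
    also have "\<dots> = (\<Sum>Y\<in>?T'. \<Sum>b\<in>B Y. g (add_box \<gamma> b Y))"
      using fT fB by (subst sum.Sigma) (auto simp: case_prod_unfold)
    finally have S1: "of_nat (d \<kappa>) * (\<Sum>Y\<in>?T. g Y) = (\<Sum>Y\<in>?T'. \<Sum>b\<in>B Y. g (add_box \<gamma> b Y))" .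

    \<comment> \<open>The pole cont t + e1 + e2 has the height of t lowered by p + q. An addable box
      never lies p + q above the top box, so such a pole never falls into the class
      \<open>\<kappa>\<close>.\<close>
    have top': "q * fst (snd t) + p * snd (snd t) \<noteq> q * fst (snd x0) + p * snd (snd x0) + p + q"
      if Y: "Y \<in> ?T'" and t: "t \<in> Add Y" for Y t
    proof
      assume h: "q * fst (snd t) + p * snd (snd t) = q * fst (snd x0) + p * snd (snd x0) + p + q"
      obtain \<alpha> i j where tij: "t = (\<alpha>, i, j)" by (metis prod.exhaust)
      have ad: "\<alpha> \<in> {1..r}" "(i, j) \<in> addable (Y \<alpha>)" using t tij by (auto simp: Add_def)
      have le: "q * i' + p * j' \<le> q * fst (snd x0) + p * snd (snd x0)" if "(i', j') \<in> Y \<alpha>" for i' j'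
        using top[OF tT, of Y "(\<alpha>, i', j')"] that ad(1) Y by (auto simp: boxes_def \<kappa>_def key_def d'_def)
      have "1 \<le> fst (snd x0)" "1 \<le> snd (snd x0)"
        using x0(1) tY0 young_pos[of "Y0 (fst x0)" "fst (snd x0)" "snd (snd x0)"] by (auto simp: boxes_def tuple_def)
      then have pos: "q * fst (snd x0) \<ge> 1" "p * snd (snd x0) \<ge> 1" using pq by (simp_all add: Suc_le_eq)
      consider "i = 1" "j = 1" | "(i - 1, j) \<in> Y \<alpha>" "i \<ge> 1" | "(i, j - 1) \<in> Y \<alpha>" "j \<ge> 1"
        using ad(2) unfolding addable_def by blast
      then show False
      proof cases
        case 1 then show False using h pos tij by simp
      next
        case 2
        then have "q * i = q * (i - 1) + q" by (cases i) auto
        then show False using le[OF 2(1)] h tij pq by simp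
      next
        case 3
        then have "p * j = p * (j - 1) + p" by (cases j) auto
        then show False using le[OF 3(1)] h tij pq by simp
      qed
    qed
    obtain Q where Q: "poly_obs Q"
      "\<And>Y \<gamma> b. tuple Y \<Longrightarrow> \<gamma> \<in> {1..r} \<Longrightarrow> b \<notin> Y \<gamma> \<Longrightarrow> f (add_box \<gamma> b Y) = poly (Q Y) (box_content \<gamma> b)"
      using obs_add_box[OF Suc.prems] by blast
    have QR: "Q Y \<in> Rpoly" for Y using Q(1) obs_in_R unfolding poly_obs_def Rpoly_def by blast
    \<comment> \<open>K bounds the pole orders of all weights with n + 1 boxes; a cutoff exact up to
      v^K then has an error that stays in R when multiplied by a weight.\<close>
    obtain K where K: "\<And>Y. Y \<in> young_tuples r (Suc n) \<Longrightarrow> v ^ K * weight Y \<in> R"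
      using pole_bounded_uniform[OF finite_young_tuples] by blast
    \<comment> \<open>All poles outside the class of x0, for all tuples of the smaller class at
      once, so that one cutoff polynomial serves every Y.\<close>
    define A where "A = (\<Union>Y\<in>?T'. cont ` {t\<in>Add Y. key t \<noteq> \<kappa>} \<union> (\<lambda>t. cont t + (e1 + e2)) ` Add Y)"
    have x0r: "fst x0 \<in> {1..r}" using \<gamma> by (simp add: \<gamma>_def)
    have "finite A" unfolding A_def using fT(2) finite_Add[OF tT] by auto
    moreover have "A \<subseteq> R"
      unfolding A_def using params_in_R by (auto simp: Add_def intro!: content_in_R add)
    moreover have "inverse (cont x0 - y) \<in> R \<and> cont x0 \<noteq> y" if yA: "y \<in> A" for y
    proof -
      obtain Y where Y: "Y \<in> ?T'" "y \<in> cont ` {t\<in>Add Y. key t \<noteq> \<kappa>} \<union> (\<lambda>t. cont t + (e1 + e2)) ` Add Y"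
        using yA unfolding A_def by (elim UN_E) blast
      then consider t where "t \<in> Add Y" "key t \<noteq> \<kappa>" "y = cont t" | t where "t \<in> Add Y" "y = cont t + (e1 + e2)" by blast
      then show ?thesis
      proof cases
        case 1
        then have t: "fst t \<in> {1..r}" using Add_subset by blast
        have "cont x0 \<noteq> cont t"
        proof
          assume "cont x0 = cont t"
          then have "x0 = t" using box_content_eq_iff[OF x0r t] by (simp add: prod_eq_iff)
          then show False using 1 by (simp add: \<kappa>_def)
        qed
        then show ?thesis using cont_diff_unit[OF x0r t] 1 by (auto simp: \<kappa>_def)
      next
        case 2
        then have t: "fst t \<in> {1..r}" using Add_subset by blast
        have "cont x0 \<noteq> cont t + (e1 + e2)"
        proof
          assume "cont x0 = cont t + (e1 + e2)"
          then have "cont t - cont x0 + (e1 + e2) = 0" by simp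
          then have "snd t = (fst (snd x0) + 1, snd (snd x0) + 1)" using box_content_add_eps[OF t x0r] by blast
          then show False using top'[OF Y(1) 2(1)] by (simp add: algebra_simps)
        qed
        then show ?thesis using cont_diff_eps_unit[OF x0r t] top'[OF Y(1) 2(1)] 2 by auto
      qed
    qed
    moreover have "cont x0 \<in> R" using x0r content_in_R by blast
    ultimately obtain e where e: "e \<in> Rpoly" "\<And>y. y \<in> A \<Longrightarrow> poly e y = 0"
      "\<And>u. u \<in> R \<Longrightarrow> \<exists>z\<in>R. poly e (cont x0 + v * u) = 1 + v ^ K * z"
      using cutoff_poly[of A "cont x0" v] v_in_R by metis
    define c where "c = (- 1) ^ r * (e1 + e2) / (e1 * e2)"
    have "inverse e1 \<in> R" "inverse e2 \<in> R"
      using unit[OF \<gamma> \<gamma>, of 1 0] unit[OF \<gamma> \<gamma>, of 0 1] pq by simp_all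
    then have cR: "c \<in> R" unfolding c_def divide_inverse inverse_mult_distrib using params_in_R by (intro mult power) auto
    have "poly_obs (\<lambda>Y. Q Y * e)" by (intro poly_obs_mult Q poly_obs_const e)
    from lagrange_sum_poles[OF this r_pos] obtain f' where f': "obs f'" "\<And>Y. tuple Y \<Longrightarrow>
        lagrange_sum (poles Y) (\<lambda>x. poly (Q Y * e) x * (\<Prod>i\<in>zero_index Y. x - zero_val i)) = f' Y"
      by blast
    \<comment> \<open>The cutoff kills every pole that is not an addable box with key
      \<open>\<kappa>\<close>, so the partial sum equals the full Lagrange sum, which is an
      observable.\<close>
    have S2: "(\<Sum>b\<in>B Y. weight (add_box \<gamma> b Y) * poly (Q Y * e) (box_content \<gamma> b)) = weight Y * (c * f' Y)"
      if Y: "Y \<in> ?T'" for Y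
    proof -
      have tY: "tuple Y" using tT Y by blast
      let ?h = "\<lambda>x. poly (Q Y * e) x * (\<Prod>i\<in>zero_index Y. x - zero_val i) / (\<Prod>y\<in>poles Y - {x}. x - y)"
      have sub: "box_content \<gamma> ` B Y \<subseteq> poles Y" using \<gamma> by (force simp: B_def poles_def Add_def)
      have z: "poly (Q Y * e) x = 0" if xp: "x \<in> poles Y - box_content \<gamma> ` B Y" for x
      proof -
        have "x \<in> A"
        proof (cases "x \<in> (\<lambda>t. cont t + (e1 + e2)) ` Add Y")
          case True then show ?thesis using Y by (auto simp: A_def)
        next
          case False
          then obtain t where t: "t \<in> Add Y" "x = cont t" using xp unfolding poles_def by blast
          have "key t \<noteq> \<kappa>"
          proof
            assume k: "key t = \<kappa>"
            then have "fst t = \<gamma>" using \<kappa> by (auto simp: key_def)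
            then have "x \<in> box_content \<gamma> ` B Y" using t k by (cases t) (auto simp: B_def Add_def)
            then show False using xp by simp
          qed
          then show ?thesis using t Y by (auto simp: A_def)
        qed
        then show ?thesis using e(2) by simp
      qed
      have inj: "inj_on (box_content \<gamma>) (B Y)" using box_content_eq_iff[OF \<gamma> \<gamma>] by (auto simp: inj_on_def)
      have "c * f' Y = c * (\<Sum>x\<in>poles Y. ?h x)" using f'(2)[OF tY] by (simp add: lagrange_sum_def)
      also have "(\<Sum>x\<in>poles Y. ?h x) = (\<Sum>x\<in>box_content \<gamma> ` B Y. ?h x)"
        by (rule sum.mono_neutral_right[OF finite_poles[OF tY] sub]) (use z in simp)
      also have "\<dots> = (\<Sum>b\<in>B Y. ?h (box_content \<gamma> b))" by (simp add: sum.reindex[OF inj])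
      finally have "weight Y * (c * f' Y) = (\<Sum>b\<in>B Y. weight Y * c * ?h (box_content \<gamma> b))"
        by (simp add: sum_distrib_left mult.assoc)
      also have "\<dots> = (\<Sum>b\<in>B Y. weight (add_box \<gamma> b Y) * poly (Q Y * e) (box_content \<gamma> b))"
      proof (rule sum.cong[OF refl])
        fix b assume "b \<in> B Y"
        then have b: "b \<in> addable (Y \<gamma>)" by (simp add: B_def)
        show "weight Y * c * ?h (box_content \<gamma> b) = weight (add_box \<gamma> b Y) * poly (Q Y * e) (box_content \<gamma> b)"
          unfolding weight_add_box_poles[OF tY \<gamma> b] c_def by (simp add: divide_inverse mult_ac)
      qed
      finally show ?thesis ..
    qed
    have S3: "(\<Sum>b\<in>B Y. g (add_box \<gamma> b Y)) - weight Y * (c * f' Y) \<in> R" if Y: "Y \<in> ?T'" for Y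
      unfolding S2[OF Y, symmetric] sum_subtractf[symmetric]
    proof (rule sum)
      fix b assume bB: "b \<in> B Y"
      have b: "b \<in> addable (Y \<gamma>)" and k: "key (\<gamma>, b) = key x0" using bB by (auto simp: B_def \<kappa>_def)
      have nb: "b \<notin> Y \<gamma>" using b addable_pos[of "fst b" "snd b"] by auto
      obtain u where u: "u \<in> R" "box_content \<gamma> b = cont x0 + v * u" using cont_same_key[OF k] by auto
      obtain z where z: "z \<in> R" "poly e (box_content \<gamma> b) = 1 + v ^ K * z" using e(3)[OF u(1)] u(2) by auto
      have "g (add_box \<gamma> b Y) - weight (add_box \<gamma> b Y) * poly (Q Y * e) (box_content \<gamma> b) =
          - (v ^ K * weight (add_box \<gamma> b Y) * (poly (Q Y) (box_content \<gamma> b) * z))"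
        unfolding g_def Q(2)[of Y \<gamma> b, OF tT[OF disjI2[OF Y]] \<gamma> nb] poly_mult z(2)
        by (simp add: algebra_simps)
      also have "\<dots> \<in> R"
      proof (intro uminus mult[OF _ mult])
        show "v ^ K * weight (add_box \<gamma> b Y) \<in> R" using K card_add_box[of Y n \<gamma> b] Y \<gamma> b by blast
        show "poly (Q Y) (box_content \<gamma> b) \<in> R" using poly_in_R[OF QR content_in_R[OF \<gamma>]] .
        show "z \<in> R" by (rule z(1))
      qed
      finally show "g (add_box \<gamma> b Y) - weight (add_box \<gamma> b Y) * poly (Q Y * e) (box_content \<gamma> b) \<in> R" .
    qed
    \<comment> \<open>The corrections lie in R by \<open>S3\<close>. The main term is a class sum
      with n boxes and observable \<open>c * f'\<close>, covered by the induction hypothesis; this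
      is why the statement carries an observable.\<close>
    have "(\<Sum>Y\<in>?T'. (\<Sum>b\<in>B Y. g (add_box \<gamma> b Y)) - weight Y * (c * f' Y)) + (\<Sum>Y\<in>?T'. weight Y * (c * f' Y)) \<in> R"
      by (intro add sum S3 Suc.IH obs_mult obs_const cR f'(1))
    then have "of_nat (d \<kappa>) * (\<Sum>Y\<in>?T. g Y) \<in> R" unfolding S1 by (simp add: sum_subtractf)
    then show ?thesis using cancel_nat[OF d\<kappa>] by (simp add: g_def)
  next
    case True
    show ?thesis unfolding True by simp
  qed
qed

theorem Zcoeff_in_R: "Zcoeff n \<in> R"
proof -
  have "Zcoeff n = (\<Sum>d\<in>key_count ` young_tuples r n. \<Sum>Y\<in>{Y\<in>young_tuples r n. key_count Y = d}. weight Y * 1)"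
    unfolding Zcoeff_def by (subst sum.image_gen[OF finite_young_tuples, of _ _ _ key_count]) simp
  also have "\<dots> \<in> R" by (intro sum sum_key_class_in_R obs_const one)
  finally show ?thesis .
qed

end

section \<open>Convolution of functions on multisets\<close>

lemma finite_submultisets: "finite {k. k \<subseteq># m}"
proof -
  show ?thesis
  proof (induction m)
    case (add x m)
    have "{k. k \<subseteq># add_mset x m} \<subseteq> {k. k \<subseteq># m} \<union> add_mset x ` {k. k \<subseteq># m}"
    proof
      fix k assume "k \<in> {k. k \<subseteq># add_mset x m}"
      then have k: "k \<subseteq># add_mset x m" by simp
      show "k \<in> {k. k \<subseteq># m} \<union> add_mset x ` {k. k \<subseteq># m}"
      proof (cases "x \<in># k")
        case True
        then obtain k' where "k = add_mset x k'" by (metis multi_member_split)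
        then show ?thesis using k by auto
      next
        case False
        have "k \<subseteq># m"
        proof (rule mset_subset_eqI)
          fix a show "count k a \<le> count m a"
            using mset_subset_eq_count[OF k, of a] False by (cases "a = x") (auto simp: not_in_iff)
        qed
        then show ?thesis by simp
      qed
    qed
    then show ?case using add by (auto intro: finite_subset)
  qed simp
qed

text \<open>Multiplication of formal power series in many variables, a multiset being the exponent
  of a monomial.\<close>

definition conv :: "('x multiset \<Rightarrow> 'a) \<Rightarrow> ('x multiset \<Rightarrow> 'a) \<Rightarrow> 'x multiset \<Rightarrow> 'a::comm_ring_1" where
  "conv A B m = (\<Sum>k\<in>{k. k \<subseteq># m}. A k * B (m - k))"

lemma submultiset_diff:
  assumes "j \<subseteq># k"
  shows "k \<subseteq># m \<Longrightarrow> k - j \<subseteq># m - j" "m - j - (k - j) = m - k"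
proof -
  show "k - j \<subseteq># m - j" if "k \<subseteq># m"
    by (rule mset_subset_eqI) (simp add: diff_le_mono mset_subset_eq_count[OF that])
  show "m - j - (k - j) = m - k"
  proof (rule multiset_eqI)
    fix a show "count (m - j - (k - j)) a = count (m - k) a"
      using mset_subset_eq_count[OF assms, of a] by simp
  qed
qed

lemma submultiset_add: "j \<subseteq># m \<Longrightarrow> i \<subseteq># m - j \<Longrightarrow> j + i \<subseteq># m"
  by (metis subset_mset.add_diff_inverse subset_mset.add_left_mono)

lemma conv_assoc: "conv (conv A B) C m = conv A (conv B C) m"
proof -
  have "conv (conv A B) C m = (\<Sum>k\<in>{k. k \<subseteq># m}. \<Sum>j\<in>{j. j \<subseteq># k}. A j * B (k - j) * C (m - k))"
    by (simp add: conv_def sum_distrib_right)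
  also have "\<dots> = (\<Sum>(k, j)\<in>(SIGMA k:{k. k \<subseteq># m}. {j. j \<subseteq># k}). A j * B (k - j) * C (m - k))"
    by (rule sum.Sigma) (auto simp: finite_submultisets)
  also have "\<dots> = (\<Sum>(j, i)\<in>(SIGMA j:{j. j \<subseteq># m}. {i. i \<subseteq># m - j}). A j * (B i * C (m - j - i)))"
    by (rule sum.reindex_bij_witness[of _ "\<lambda>(j, i). (j + i, j)" "\<lambda>(k, j). (j, k - j)"])
      (auto simp: subset_mset.add_diff_inverse submultiset_diff mult.assoc
        intro: subset_mset.order_trans submultiset_add)
  also have "\<dots> = (\<Sum>j\<in>{j. j \<subseteq># m}. \<Sum>i\<in>{i. i \<subseteq># m - j}. A j * (B i * C (m - j - i)))"
    by (rule sum.Sigma[symmetric]) (auto simp: finite_submultisets)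
  finally show ?thesis by (simp add: conv_def sum_distrib_left)
qed

lemma conv_split_empty: "conv W B m = W {#} * B m + (\<Sum>k\<in>{k. k \<subseteq># m \<and> k \<noteq> {#}}. W k * B (m - k))"
proof -
  have "{k. k \<subseteq># m} = insert {#} {k. k \<subseteq># m \<and> k \<noteq> {#}}" by auto
  then show ?thesis unfolding conv_def
    using finite_submultisets[of m] by (subst \<open>{k. k \<subseteq># m} = _\<close>, subst sum.insert) (auto elim: rev_finite_subset)
qed

lemma size_diff_less: "k \<subseteq># m \<Longrightarrow> k \<noteq> {#} \<Longrightarrow> size (m - k) < size m"
  by (simp add: size_Diff_submset) (metis diff_less nonempty_has_size size_mset_mono order_less_le_trans)

text \<open>The coefficients of the quotient F / W when W has constant term 1.\<close>

function conv_quot :: "('x multiset \<Rightarrow> 'a::comm_ring_1) \<Rightarrow> ('x multiset \<Rightarrow> 'a) \<Rightarrow> 'x multiset \<Rightarrow> 'a" where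
  "conv_quot W F m = F m - (\<Sum>k\<in>{k. k \<subseteq># m \<and> k \<noteq> {#}}. W k * conv_quot W F (m - k))"
  by auto
termination by (relation "measure (\<lambda>(W, F, m). size m)") (auto intro: size_diff_less)

declare conv_quot.simps [simp del]

lemma conv_conv_quot: "W {#} = 1 \<Longrightarrow> conv W (conv_quot W F) m = F m"
  by (subst conv_split_empty, subst conv_quot.simps) simp

lemma conv_quot_unique:
  assumes "W {#} = 1" "\<And>m. conv W B m = F m"
  shows "B m = conv_quot W F m"
proof (induction "size m" arbitrary: m rule: less_induct)
  case less
  have "B m = F m - (\<Sum>k\<in>{k. k \<subseteq># m \<and> k \<noteq> {#}}. W k * B (m - k))"
    using assms(2)[of m] assms(1) conv_split_empty[of W B m] by (simp add: algebra_simps)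
  also have "\<dots> = F m - (\<Sum>k\<in>{k. k \<subseteq># m \<and> k \<noteq> {#}}. W k * conv_quot W F (m - k))"
  proof (intro arg_cong2[of _ _ _ _ "(-)"] sum.cong refl)
    fix k assume "k \<in> {k. k \<subseteq># m \<and> k \<noteq> {#}}"
    then show "W k * B (m - k) = W k * conv_quot W F (m - k)"
      using less[of "m - k"] size_diff_less[of k m] by simp
  qed
  finally show ?case by (simp add: conv_quot.simps[of W F m])
qed

context rat_subring
begin

text \<open>The factors by which a weight changes when one column is added, as functions of the multiset of
  columns present.\<close>

inductive unit_ratio :: "'a \<Rightarrow> ('x multiset \<Rightarrow> 'a) \<Rightarrow> bool" for t where
  unit_ratio_1: "unit_ratio t (\<lambda>_. 1)"
| unit_ratio_mult: "\<lbrakk>unit_ratio t f; c \<in> R; \<And>m m'. l (m + m') = l m + l m'\<rbrakk>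
    \<Longrightarrow> unit_ratio t (\<lambda>m. (c + of_int (l m) * t) * f m)"
| unit_ratio_div: "\<lbrakk>unit_ratio t f; c \<in> R; \<And>m m'. l (m + m') = l m + l m';
      \<And>k. c + of_int k * t \<noteq> 0 \<and> inverse (c + of_int k * t) \<in> R\<rbrakk>
    \<Longrightarrow> unit_ratio t (\<lambda>m. f m / (c + of_int (l m) * t))"

end

text \<open>By \<open>W_rec\<close> each element of m may cost W a factor t in the denominator. The
  ratios \<open>g \<tau>\<close> have no such poles, and this suffices to keep the logarithmic
  derivatives, multiplied by a single t, in R.\<close>

locale multiset_recursion = rat_subring R for R :: "'a::field_char_0 set" +
  fixes t :: 'a and T :: "'x set" and W :: "'x multiset \<Rightarrow> 'a" and g :: "'x \<Rightarrow> 'x multiset \<Rightarrow> 'a"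
  assumes t_in_R: "t \<in> R" and finite_T: "finite T" and W_empty: "W {#} = 1"
    and W_outside: "\<not> set_mset m \<subseteq> T \<Longrightarrow> W m = 0"
    and g_ratio: "\<tau> \<in> T \<Longrightarrow> unit_ratio t (g \<tau>)"
    and W_rec: "\<tau> \<in> T \<Longrightarrow> set_mset m \<subseteq> T \<Longrightarrow> t * of_nat (count m \<tau> + 1) * W (add_mset \<tau> m) = g \<tau> m * W m"
begin

text \<open>The series with coefficients \<open>f m * W m\<close> divided by the series of
  W.\<close>

definition quot :: "('x multiset \<Rightarrow> 'a) \<Rightarrow> 'x multiset \<Rightarrow> 'a" where
  "quot f = conv_quot W (\<lambda>m. f m * W m)"

text \<open>The coefficients of the logarithmic derivative \<open>t x\<^sub>\<tau> d/dx\<^sub>\<tau> log\<close> of the generating function of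
  \<open>W\<close> in the variables \<open>x\<^sub>\<tau>\<close>.\<close>

definition U :: "'x \<Rightarrow> 'x multiset \<Rightarrow> 'a" where
  "U \<tau> = quot (\<lambda>m. t * of_nat (count m \<tau>))"

lemma conv_quot_eq: "conv W (quot f) m = f m * W m"
  unfolding quot_def by (rule conv_conv_quot[where W = W, OF W_empty])

lemma quot_eqI: "(\<And>m. conv W B m = f m * W m) \<Longrightarrow> B m = quot f m"
  unfolding quot_def by (rule conv_quot_unique[where W = W, OF W_empty])

lemma additive_sum:
  fixes l :: "'x multiset \<Rightarrow> int"
  assumes "\<And>m m'. l (m + m') = l m + l m'" "set_mset m \<subseteq> T"
  shows "l m = (\<Sum>\<tau>\<in>T. l {#\<tau>#} * int (count m \<tau>))"
  using assms(2)
proof (induction m)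
  case empty
  have "l {#} = 0" using assms(1)[of "{#}" "{#}"] by simp
  then show ?case by simp
next
  case (add x m)
  have "(\<Sum>\<tau>\<in>T. l {#\<tau>#} * int (count (add_mset x m) \<tau>)) =
      (\<Sum>\<tau>\<in>T. l {#\<tau>#} * int (count m \<tau>) + (if \<tau> = x then l {#x#} else 0))"
    by (rule sum.cong) (auto simp: algebra_simps)
  also have "\<dots> = l m + l {#x#}" using add finite_T by (simp add: sum.distrib)
  finally show ?case using assms(1)[of m "{#x#}"] by simp
qed

text \<open>Multiplying the coefficient at m by l m is a derivation D. With G the series of W, the
  Leibniz rule for G times \<open>quot f\<close>, divided by G, gives D of \<open>quot f\<close>
  plus D(G)/G times \<open>quot f\<close>; V is t D(G)/G.\<close>

lemma quot_lin:
  fixes l :: "'x multiset \<Rightarrow> int"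
  assumes l: "\<And>m m'. l (m + m') = l m + l m'"
  defines "V \<equiv> \<lambda>k. \<Sum>\<tau>\<in>T. of_int (l {#\<tau>#}) * U \<tau> k"
  shows "quot (\<lambda>m. (c + of_int (l m) * t) * f m) m = (c + of_int (l m) * t) * quot f m + conv V (quot f) m"
proof (rule sym, rule quot_eqI)
  fix m
  have WV: "conv W V k = of_int (l k) * t * W k" for k
  proof -
    have "conv W V k = (\<Sum>\<tau>\<in>T. of_int (l {#\<tau>#}) * conv W (U \<tau>) k)"
      unfolding conv_def V_def sum_distrib_left by (subst sum.swap) (simp add: mult_ac)
    also have "\<dots> = (\<Sum>\<tau>\<in>T. of_int (l {#\<tau>#} * int (count k \<tau>))) * t * W k"
      unfolding U_def conv_quot_eq by (simp add: sum_distrib_left sum_distrib_right mult_ac)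
    also have "\<dots> = of_int (l k) * t * W k"
    proof (cases "set_mset k \<subseteq> T")
      case True
      show ?thesis unfolding additive_sum[OF l True] by simp
    qed (simp add: W_outside)
    finally show ?thesis .
  qed
  have "conv W (\<lambda>m. (c + of_int (l m) * t) * quot f m + conv V (quot f) m) m =
      conv W (\<lambda>m. (c + of_int (l m) * t) * quot f m) m + conv W (conv V (quot f)) m"
    by (simp add: conv_def algebra_simps sum.distrib)
  also have "conv W (conv V (quot f)) m = conv (\<lambda>k. of_int (l k) * t * W k) (quot f) m"
    unfolding conv_assoc[symmetric] WV[abs_def] ..
  also have "conv W (\<lambda>m. (c + of_int (l m) * t) * quot f m) m + conv (\<lambda>k. of_int (l k) * t * W k) (quot f) m =
      (\<Sum>k\<in>{k. k \<subseteq># m}. (c + of_int (l m) * t) * (W k * quot f (m - k)))"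
    unfolding conv_def sum.distrib[symmetric]
  proof (rule sum.cong[OF refl])
    fix k assume "k \<in> {k. k \<subseteq># m}"
    then have "m = k + (m - k)" by (simp add: subset_mset.add_diff_inverse)
    then have "l m = l k + l (m - k)" using l by metis
    then show "W k * ((c + of_int (l (m - k)) * t) * quot f (m - k)) + of_int (l k) * t * W k * quot f (m - k) =
        (c + of_int (l m) * t) * (W k * quot f (m - k))" by (simp add: algebra_simps)
  qed
  also have "\<dots> = (c + of_int (l m) * t) * f m * W m"
    using conv_quot_eq[of f m] unfolding sum_distrib_left[symmetric] conv_def[symmetric] by (simp add: mult.assoc)
  finally show "conv W (\<lambda>m. (c + of_int (l m) * t) * quot f m + conv V (quot f) m) m = (c + of_int (l m) * t) * f m * W m" .
qed

lemma U_empty: "U \<tau> {#} = 0"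
  unfolding U_def quot_def by (subst conv_quot.simps) simp

lemma conv_in_R: "(\<And>k. k \<subseteq># m \<Longrightarrow> A k \<in> R) \<Longrightarrow> (\<And>k. k \<subseteq># m \<Longrightarrow> B (m - k) \<in> R) \<Longrightarrow> conv A B m \<in> R"
  unfolding conv_def by (intro sum mult) auto

text \<open>A linear factor of the ratio is treated by \<open>quot_lin\<close>. For a divisor the
  same identity is solved for the unknown at m, where its coefficient is a unit.\<close>

lemma quot_in_R:
  assumes U: "\<And>\<tau> k. \<tau> \<in> T \<Longrightarrow> size k \<le> d \<Longrightarrow> U \<tau> k \<in> R"
    and f: "unit_ratio t f"
  shows "size m \<le> d \<Longrightarrow> quot f m \<in> R"
  using f
proof (induction arbitrary: m rule: unit_ratio.induct)
  case unit_ratio_1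
  have "(if m = {#} then 1 else 0) = quot (\<lambda>_. 1) m" for m
  proof (rule quot_eqI)
    fix m
    have "conv W (\<lambda>m. if m = {#} then 1 else 0) m = (\<Sum>k\<in>{k. k \<subseteq># m}. if k = m then W m else 0)"
      unfolding conv_def by (rule sum.cong) (auto simp: Diff_eq_empty_iff_mset subset_mset.antisym)
    then show "conv W (\<lambda>m. if m = {#} then 1 else 0) m = 1 * W m" using finite_submultisets[of m] by simp
  qed
  then show ?case by (metis one zero)
next
  case (unit_ratio_mult f c l)
  have "conv (\<lambda>k. \<Sum>\<tau>\<in>T. of_int (l {#\<tau>#}) * U \<tau> k) (quot f) m \<in> R"
    using unit_ratio_mult.prems
    by (intro conv_in_R sum mult of_int U unit_ratio_mult.IH)
      (auto dest: size_mset_mono simp: size_Diff_submset)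
  then show ?case
    unfolding quot_lin[OF unit_ratio_mult.hyps(3)]
    using unit_ratio_mult t_in_R by (intro add mult of_int) auto
next
  case (unit_ratio_div f c l)
  define h where "h m = f m / (c + of_int (l m) * t)" for m
  define V where "V k = (\<Sum>\<tau>\<in>T. of_int (l {#\<tau>#}) * U \<tau> k)" for k
  have f: "f = (\<lambda>m. (c + of_int (l m) * t) * h m)"
    using unit_ratio_div.hyps(4) by (auto simp: h_def)
  have eq: "quot f m = (c + of_int (l m) * t) * quot h m + conv V (quot h) m" for m
    unfolding V_def by (subst f, rule quot_lin[OF unit_ratio_div.hyps(3)])
  have "size m \<le> d \<Longrightarrow> quot h m \<in> R" for m
  proof (induction "size m" arbitrary: m rule: less_induct)
    case less
    \<comment> \<open>V has no constant term, so the convolution involves \<open>quot h\<close> only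
      at smaller multisets.\<close>
    have V0: "V {#} = 0" by (simp add: V_def U_empty)
    have "conv V (quot h) m = (\<Sum>k\<in>{k. k \<subseteq># m \<and> k \<noteq> {#}}. V k * quot h (m - k))"
      by (subst conv_split_empty) (simp add: V0)
    also have "\<dots> \<in> R"
    proof (intro sum mult)
      fix k assume "k \<in> {k. k \<subseteq># m \<and> k \<noteq> {#}}"
      then have k: "k \<subseteq># m" "k \<noteq> {#}" by auto
      show "V k \<in> R" unfolding V_def using less.prems size_mset_mono[OF k(1)] by (intro sum mult of_int U) auto
      show "quot h (m - k) \<in> R"
        using less.hyps[OF size_diff_less[OF k]] less.prems size_diff_less[OF k] by simp
    qed
    finally have "quot f m - conv V (quot h) m \<in> R" using unit_ratio_div.IH[OF less.prems] by blast
    then have "(c + of_int (l m) * t) * quot h m \<in> R" by (simp add: eq)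
    then have "inverse (c + of_int (l m) * t) * ((c + of_int (l m) * t) * quot h m) \<in> R"
      using unit_ratio_div.hyps(4) by blast
    then show ?case using unit_ratio_div.hyps(4)[of "l m"] by (simp add: mult.assoc[symmetric])
  qed
  then show ?case using unit_ratio_div.prems by (simp add: h_def[abs_def])
qed

text \<open>\<open>W_rec\<close> says that t x d/dx of the series of W is x times the series of
  \<open>g \<tau> m * W m\<close>. Because of the factor x, U at size d + 1 comes from
  \<open>quot (g \<tau>)\<close> at size d, which needs U only up to size d.\<close>

lemma U_eq:
  assumes "\<tau> \<in> T"
  shows "U \<tau> m = (if \<tau> \<in># m then quot (g \<tau>) (m - {#\<tau>#}) else 0)"
  unfolding U_def
proof (rule sym, rule quot_eqI)
  fix m
  let ?V = "\<lambda>m. if \<tau> \<in># m then quot (g \<tau>) (m - {#\<tau>#}) else 0"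
  show "conv W ?V m = t * of_nat (count m \<tau>) * W m"
  proof (cases "\<tau> \<in># m")
    case True
    then obtain m' where m: "m = add_mset \<tau> m'" by (metis multi_member_split)
    have iff: "k \<subseteq># m \<and> \<tau> \<in># m - k \<longleftrightarrow> k \<subseteq># m'" for k
    proof
      assume "k \<subseteq># m \<and> \<tau> \<in># m - k"
      then show "k \<subseteq># m'" unfolding m
        by (auto simp: subseteq_mset_def in_diff_count) (metis Suc_leD less_Suc_eq_le)
    next
      assume k: "k \<subseteq># m'"
      then show "k \<subseteq># m \<and> \<tau> \<in># m - k" unfolding m
        by (auto simp: subseteq_mset_def in_diff_count le_Suc_eq less_Suc_eq_le)
    qed
    have "conv W ?V m = (\<Sum>k\<in>{k. k \<subseteq># m'}. W k * ?V (m - k))"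
      unfolding conv_def by (rule sum.mono_neutral_right[OF finite_submultisets]) (use iff in auto)
    also have "\<dots> = (\<Sum>k\<in>{k. k \<subseteq># m'}. W k * quot (g \<tau>) (m' - k))"
    proof (rule sum.cong[OF refl])
      fix k assume "k \<in> {k. k \<subseteq># m'}"
      then show "W k * ?V (m - k) = W k * quot (g \<tau>) (m' - k)"
        using iff[of k] by (simp add: m)
    qed
    also have "\<dots> = g \<tau> m' * W m'" using conv_quot_eq[of "g \<tau>" m'] by (simp add: conv_def)
    also have "\<dots> = t * of_nat (count m \<tau>) * W m"
    proof (cases "set_mset m' \<subseteq> T")
      case True
      then show ?thesis using W_rec[OF assms True] by (simp add: m)
    qed (use W_outside[of m'] W_outside[of m] in \<open>simp add: m\<close>)
    finally show ?thesis .
  next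
    case False
    then have "\<tau> \<notin># m - k" for k by (meson in_diffD)
    then have "conv W ?V m = 0" unfolding conv_def by (intro sum.neutral) simp
    then show ?thesis using False by (simp add: not_in_iff)
  qed
qed

theorem U_in_R: "\<tau> \<in> T \<Longrightarrow> U \<tau> m \<in> R"
proof -
  have "\<forall>\<tau>\<in>T. \<forall>m. size m \<le> d \<longrightarrow> U \<tau> m \<in> R" for d
  proof (induction d)
    case 0
    then show ?case by (simp add: U_empty)
  next
    case (Suc d)
    have "U \<tau> m \<in> R" if "\<tau> \<in> T" "size m \<le> Suc d" for \<tau> m
      unfolding U_eq[OF that(1)]
      using quot_in_R[of d, OF _ g_ratio[OF that(1)], of "m - {#\<tau>#}"] Suc that(2)
      by (auto simp: size_Diff_singleton)
    then show ?case by blast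
  qed
  then show "\<tau> \<in> T \<Longrightarrow> U \<tau> m \<in> R" by blast
qed

end

section \<open>The weights in terms of row lengths\<close>

text \<open>The antiderivative of F in its first argument that vanishes at 0. Negative n is allowed
  because differences of row lengths are inserted.\<close>

definition int_sum :: "(int \<Rightarrow> int \<Rightarrow> 'b::ab_group_add) \<Rightarrow> int \<Rightarrow> int \<Rightarrow> 'b" where
  "int_sum F y n = (if n \<ge> 0 then \<Sum>i\<in>{1..n}. F i y else - (\<Sum>i\<in>{n + 1..0}. F i y))"

lemma int_sum_0 [simp]: "int_sum F y 0 = 0" by (simp add: int_sum_def)

lemma int_sum_add_1: "int_sum F y (n + 1) = int_sum F y n + F (n + 1) y"
proof -
  consider "n \<ge> 0" | "n = -1" | "n < -1" by linarith
  then show ?thesis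
  proof cases
    case 1
    have "{1..n + 1} = insert (n + 1) {1..n}" using 1 by auto
    then show ?thesis using 1 by (simp add: int_sum_def add.commute)
  next
    case 3
    have "{n + 1..0} = insert (n + 1) {n + 1 + 1..0}" using 3 by auto
    then show ?thesis using 3 by (simp add: int_sum_def)
  qed (simp add: int_sum_def)
qed

lemma int_sum_diff_1: "int_sum F y (n - 1) = int_sum F y n - F n y"
  using int_sum_add_1[of F y "n - 1"] by simp

lemma sum_shift_int_sum: "(\<Sum>i=1..m. F (int i + c) y) = int_sum F y (int m + c) - int_sum F y c"
proof (induction m)
  case (Suc m)
  show ?case using Suc int_sum_add_1[of F y "int m + c"] by (simp add: add_ac)
qed simp

lemma sum_pair_int_sum:
  "(\<Sum>i=1..m. \<Sum>k=1..n. F (int i - int k + 1) y - F (int i - int k) y) =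
    int_sum F y (int m) - int_sum F y (int m - int n) + int_sum F y (- int n)"
proof (induction n)
  case (Suc n)
  have "(\<Sum>i=1..m. \<Sum>k=1..Suc n. F (int i - int k + 1) y - F (int i - int k) y) =
      (\<Sum>i=1..m. \<Sum>k=1..n. F (int i - int k + 1) y - F (int i - int k) y) +
      ((\<Sum>i=1..m. F (int i + (- int n)) y) - (\<Sum>i=1..m. F (int i + (- int n - 1)) y))"
    by (simp add: sum.distrib sum_subtractf algebra_simps)
  also have "\<dots> = int_sum F y (int m) - int_sum F y (int m - int (Suc n)) + int_sum F y (- int (Suc n))"
  proof -
    have e: "- int (Suc n) = - int n - 1" "int m - int (Suc n) = int m + (- int n - 1)" "int m - int n = int m + - int n"
      by simp_all
    show ?thesis unfolding Suc sum_shift_int_sum e by simp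
  qed
  finally show ?case .
qed simp

lemma sum_reflected_int_sum: "(\<Sum>k=1..n. F (1 - int k) y) = - int_sum F y (- int n)"
proof (induction n)
  case (Suc n)
  have e: "- int (Suc n) = - int n - 1" "1 - int (Suc n) = - int n" by simp_all
  show ?case using Suc int_sum_diff_1[of F y "- int n"] by (simp add: e del: of_nat_Suc)
qed simp

lemma sum_young_rows:
  assumes "Y \<in> young_diagrams" "\<And>i j. (i, j) \<in> Y \<Longrightarrow> j \<le> H"
  shows "(\<Sum>(i, j)\<in>Y. g i j) = (\<Sum>j=1..H. \<Sum>i=1..row_len Y j. g i j)"
proof -
  have "(\<Sum>j=1..H. \<Sum>i=1..row_len Y j. g i j) = (\<Sum>(j, i)\<in>(SIGMA j:{1..H}. {1..row_len Y j}). g i j)"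
    by (rule sum.Sigma) auto
  also have "\<dots> = (\<Sum>(i, j)\<in>Y. g i j)"
    by (rule sum.reindex_bij_witness[of _ "\<lambda>(i, j). (j, i)" "\<lambda>(j, i). (i, j)"])
      (use assms(2) young_mem_row[OF assms(1)] in auto)
  finally show ?thesis ..
qed

lemma telescope_down:
  fixes g :: "int \<Rightarrow> 'b::ab_group_add"
  shows "(\<Sum>k=1..H. g (x - int k) - g (x - int k + 1)) = g (x - int H) - g x"
  by (induction H) (simp_all add: algebra_simps)

lemma telescope_up:
  fixes g :: "int \<Rightarrow> 'b::ab_group_add"
  shows "(\<Sum>k=1..H. g (int k - x) - g (int k - x + 1)) = g (1 - x) - g (int H + 1 - x)"
  by (induction H) (simp_all add: algebra_simps)

text \<open>For two fixed rows the sum over pairs of boxes telescopes to the two row lengths and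
  their difference. The terms with a single row length telescope again over the other row index,
  which leaves boundary terms at H.\<close>

lemma box_pair_sum_rows:
  fixes F :: "int \<Rightarrow> int \<Rightarrow> 'b::ab_group_add"
  assumes \<mu>: "\<mu> \<in> young_diagrams" "\<And>i j. (i, j) \<in> \<mu> \<Longrightarrow> j \<le> H"
    and \<nu>: "\<nu> \<in> young_diagrams" "\<And>i j. (i, j) \<in> \<nu> \<Longrightarrow> j \<le> H"
  defines "\<rho> \<equiv> \<lambda>j. int (row_len \<mu> j)" and "\<sigma> \<equiv> \<lambda>j. int (row_len \<nu> j)"
  shows "box_pair_sum F \<mu> \<nu> =
    (\<Sum>j=1..H. \<Sum>k=1..H. int_sum F (int j - int k + 1) (\<rho> j - \<sigma> k)) -
    (\<Sum>j=1..H. \<Sum>k=1..H. int_sum F (int j - int k) (\<rho> j - \<sigma> k)) +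
    (\<Sum>j=1..H. int_sum F (int j - int H) (\<rho> j)) - (\<Sum>k=1..H. int_sum F (int H + 1 - int k) (- \<sigma> k))"
proof -
  have "(\<Sum>(i, j)\<in>\<mu>. F (int i) (int j)) = (\<Sum>j=1..H. \<Sum>i=1..row_len \<mu> j. F (int i) (int j))"
    by (rule sum_young_rows[OF \<mu>, where g = "\<lambda>i j. F (int i) (int j)"])
  also have "\<dots> = (\<Sum>j=1..H. int_sum F (int j) (\<rho> j))"
    using sum_shift_int_sum[of F 0] by (simp add: \<rho>_def)
  finally have A: "(\<Sum>(i, j)\<in>\<mu>. F (int i) (int j)) = (\<Sum>j=1..H. int_sum F (int j) (\<rho> j))" .
  have "(\<Sum>(i, j)\<in>\<nu>. F (1 - int i) (1 - int j)) = (\<Sum>j=1..H. \<Sum>i=1..row_len \<nu> j. F (1 - int i) (1 - int j))"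
    by (rule sum_young_rows[OF \<nu>, where g = "\<lambda>i j. F (1 - int i) (1 - int j)"])
  also have "\<dots> = - (\<Sum>k=1..H. int_sum F (1 - int k) (- \<sigma> k))"
    unfolding sum_reflected_int_sum \<sigma>_def sum_negf ..
  finally have B: "(\<Sum>(i, j)\<in>\<nu>. F (1 - int i) (1 - int j)) = - (\<Sum>k=1..H. int_sum F (1 - int k) (- \<sigma> k))" .
  define S where "S y m n = int_sum F y m - int_sum F y (m - n) + int_sum F y (- n)" for y m n
  have "(\<Sum>(i, j)\<in>\<mu>. \<Sum>(k, l)\<in>\<nu>. mixed_diff F (int i - int k) (int j - int l)) =
      (\<Sum>j=1..H. \<Sum>i=1..row_len \<mu> j. \<Sum>(k, l)\<in>\<nu>. mixed_diff F (int i - int k) (int j - int l))"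
    by (rule sum_young_rows[OF \<mu>])
  also have "\<dots> =
      (\<Sum>j=1..H. \<Sum>i=1..row_len \<mu> j. \<Sum>l=1..H. \<Sum>k=1..row_len \<nu> l. mixed_diff F (int i - int k) (int j - int l))"
    by (intro sum.cong refl sum_young_rows[OF \<nu>])
  also have "\<dots> = (\<Sum>j=1..H. \<Sum>l=1..H. \<Sum>i=1..row_len \<mu> j. \<Sum>k=1..row_len \<nu> l. mixed_diff F (int i - int k) (int j - int l))"
    by (intro sum.cong refl sum.swap)
  also have "\<dots> = (\<Sum>j=1..H. \<Sum>l=1..H. S (int j - int l) (\<rho> j) (\<sigma> l) - S (int j - int l + 1) (\<rho> j) (\<sigma> l))"
  proof (intro sum.cong refl)
    fix j l
    have "(\<Sum>i=1..row_len \<mu> j. \<Sum>k=1..row_len \<nu> l. mixed_diff F (int i - int k) (int j - int l)) =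
      (\<Sum>i=1..row_len \<mu> j. \<Sum>k=1..row_len \<nu> l. F (int i - int k + 1) (int j - int l) - F (int i - int k) (int j - int l)) -
      (\<Sum>i=1..row_len \<mu> j. \<Sum>k=1..row_len \<nu> l. F (int i - int k + 1) (int j - int l + 1) - F (int i - int k) (int j - int l + 1))"
      unfolding sum_subtractf[symmetric] by (intro sum.cong refl) (simp add: mixed_diff_def algebra_simps)
    then show "(\<Sum>i=1..row_len \<mu> j. \<Sum>k=1..row_len \<nu> l. mixed_diff F (int i - int k) (int j - int l)) =
        S (int j - int l) (\<rho> j) (\<sigma> l) - S (int j - int l + 1) (\<rho> j) (\<sigma> l)"
      unfolding sum_pair_int_sum S_def \<rho>_def \<sigma>_def by simp
  qed
  also have "\<dots> = (\<Sum>j=1..H. \<Sum>l=1..H. int_sum F (int j - int l) (\<rho> j) - int_sum F (int j - int l + 1) (\<rho> j)) +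
      (\<Sum>j=1..H. \<Sum>l=1..H. int_sum F (int j - int l) (- \<sigma> l) - int_sum F (int j - int l + 1) (- \<sigma> l)) +
      (\<Sum>j=1..H. \<Sum>k=1..H. int_sum F (int j - int k + 1) (\<rho> j - \<sigma> k)) -
      (\<Sum>j=1..H. \<Sum>k=1..H. int_sum F (int j - int k) (\<rho> j - \<sigma> k))"
    unfolding sum.distrib[symmetric] sum_subtractf[symmetric]
    by (intro sum.cong refl) (simp add: S_def algebra_simps)
  also have "(\<Sum>j=1..H. \<Sum>l=1..H. int_sum F (int j - int l) (\<rho> j) - int_sum F (int j - int l + 1) (\<rho> j)) =
      (\<Sum>j=1..H. int_sum F (int j - int H) (\<rho> j) - int_sum F (int j) (\<rho> j))"
    by (intro sum.cong refl telescope_down[of "\<lambda>y. int_sum F y (\<rho> j)" for j])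
  also have "(\<Sum>j=1..H. \<Sum>l=1..H. int_sum F (int j - int l) (- \<sigma> l) - int_sum F (int j - int l + 1) (- \<sigma> l)) =
      (\<Sum>l=1..H. \<Sum>j=1..H. int_sum F (int j - int l) (- \<sigma> l) - int_sum F (int j - int l + 1) (- \<sigma> l))"
    by (rule sum.swap)
  also have "\<dots> = (\<Sum>l=1..H. int_sum F (1 - int l) (- \<sigma> l) - int_sum F (int H + 1 - int l) (- \<sigma> l))"
    by (intro sum.cong refl telescope_up[of "\<lambda>y. int_sum F y (- \<sigma> l)" for l])
  finally have C: "(\<Sum>(i, j)\<in>\<mu>. \<Sum>(k, l)\<in>\<nu>. mixed_diff F (int i - int k) (int j - int l)) =
      (\<Sum>j=1..H. int_sum F (int j - int H) (\<rho> j) - int_sum F (int j) (\<rho> j)) +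
      (\<Sum>l=1..H. int_sum F (1 - int l) (- \<sigma> l) - int_sum F (int H + 1 - int l) (- \<sigma> l)) +
      (\<Sum>j=1..H. \<Sum>k=1..H. int_sum F (int j - int k + 1) (\<rho> j - \<sigma> k)) -
      (\<Sum>j=1..H. \<Sum>k=1..H. int_sum F (int j - int k) (\<rho> j - \<sigma> k))" .
  show ?thesis
    unfolding box_pair_sum_def A B C by (simp add: sum_subtractf)
qed

section \<open>Tuples of diagrams as multisets of columns\<close>

text \<open>A pair consists of a component and the height of one of its columns.\<close>

definition col_types :: "nat \<Rightarrow> nat \<Rightarrow> (nat \<times> nat) set" where
  "col_types r H = {1..r} \<times> {1..H}"

definition row_count :: "(nat \<times> nat) multiset \<Rightarrow> nat \<Rightarrow> nat \<Rightarrow> nat" where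
  "row_count m \<alpha> j = size (filter_mset (\<lambda>x. fst x = \<alpha> \<and> j \<le> snd x) m)"

definition diagram_tuple :: "nat \<Rightarrow> (nat \<times> nat) multiset \<Rightarrow> nat \<Rightarrow> (nat \<times> nat) set" where
  "diagram_tuple r m = (\<lambda>\<alpha>\<in>{1..r}. {(i, j). 1 \<le> i \<and> 1 \<le> j \<and> i \<le> row_count m \<alpha> j})"

definition box_number :: "(nat \<times> nat) multiset \<Rightarrow> nat" where
  "box_number m = (\<Sum>x\<in>#m. snd x)"

lemma row_count_empty [simp]: "row_count {#} \<alpha> j = 0" by (simp add: row_count_def)

lemma row_count_add_mset:
  "row_count (add_mset x m) \<alpha> j = row_count m \<alpha> j + of_bool (fst x = \<alpha> \<and> j \<le> snd x)"
  by (simp add: row_count_def)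

lemma row_count_union: "row_count (m + m') \<alpha> j = row_count m \<alpha> j + row_count m' \<alpha> j"
  by (simp add: row_count_def)

text \<open>Columns of height exactly j reach row j but not row j + 1; so the multiplicities can be
  recovered from the row lengths.\<close>

lemma row_count_eq_count: "row_count m \<alpha> j = row_count m \<alpha> (j + 1) + count m (\<alpha>, j)"
proof (induction m)
  case (add x m)
  then show ?case by (cases x) (auto simp: row_count_add_mset)
qed simp

lemma row_count_antimono: "j \<le> k \<Longrightarrow> row_count m \<alpha> k \<le> row_count m \<alpha> j"
  by (induction m) (auto simp: row_count_add_mset)

lemma row_count_large:
  assumes "set_mset m \<subseteq> col_types r H" "j > H"
  shows "row_count m \<alpha> j = 0"
proof -
  have "filter_mset (\<lambda>x. fst x = \<alpha> \<and> j \<le> snd x) m = {#}"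
    using assms by (force simp: col_types_def)
  then show ?thesis by (simp add: row_count_def)
qed

lemma diagram_tuple_young:
  assumes "set_mset m \<subseteq> col_types r H" "\<alpha> \<in> {1..r}"
  shows "diagram_tuple r m \<alpha> \<in> young_diagrams" "(i, j) \<in> diagram_tuple r m \<alpha> \<Longrightarrow> j \<le> H"
    "j \<ge> 1 \<Longrightarrow> row_len (diagram_tuple r m \<alpha>) j = row_count m \<alpha> j"
proof -
  show H: "j \<le> H" if "(i, j) \<in> diagram_tuple r m \<alpha>" for i j
    using row_count_large[OF assms(1), of j \<alpha>] that assms(2) by (cases "j \<le> H") (auto simp: diagram_tuple_def)
  have "diagram_tuple r m \<alpha> \<subseteq> {1..row_count m \<alpha> 1} \<times> {1..H}"
  proof
    fix x assume "x \<in> diagram_tuple r m \<alpha>"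
    then show "x \<in> {1..row_count m \<alpha> 1} \<times> {1..H}"
      using H[of "fst x" "snd x"] row_count_antimono[of 1 "snd x" m \<alpha>] assms(2) by (auto simp: diagram_tuple_def)
  qed
  then have "finite (diagram_tuple r m \<alpha>)" by (rule finite_subset) simp
  moreover have "(i', j') \<in> diagram_tuple r m \<alpha>"
    if "(i, j) \<in> diagram_tuple r m \<alpha>" "1 \<le> i'" "i' \<le> i" "1 \<le> j'" "j' \<le> j" for i j i' j'
    using that assms(2) row_count_antimono[OF that(5), of m \<alpha>] by (auto simp: diagram_tuple_def)
  moreover have "diagram_tuple r m \<alpha> \<subseteq> {1..} \<times> {1..}" using assms(2) by (auto simp: diagram_tuple_def)
  ultimately show "diagram_tuple r m \<alpha> \<in> young_diagrams" unfolding young_diagrams_def by blast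
  show "row_len (diagram_tuple r m \<alpha>) j = row_count m \<alpha> j" if "j \<ge> 1"
  proof -
    have "{i. (i, j) \<in> diagram_tuple r m \<alpha>} = {1..row_count m \<alpha> j}"
      using that assms(2) by (auto simp: diagram_tuple_def)
    then show ?thesis by (simp add: row_len_def)
  qed
qed

lemma card_young_rows:
  assumes "Y \<in> young_diagrams" "\<And>i j. (i, j) \<in> Y \<Longrightarrow> j \<le> H"
  shows "card Y = (\<Sum>j=1..H. row_len Y j)"
  using sum_young_rows[OF assms, where g = "\<lambda>_ _. 1::nat"] by simp

lemma sum_row_count:
  assumes "set_mset m \<subseteq> col_types r H"
  shows "(\<Sum>\<alpha>=1..r. \<Sum>j=1..H. row_count m \<alpha> j) = box_number m"
  using assms
proof (induction m)
  case (add x m)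
  obtain \<gamma> l where x: "x = (\<gamma>, l)" "\<gamma> \<in> {1..r}" "l \<in> {1..H}" using add.prems by (auto simp: col_types_def)
  have "(\<Sum>j=1..H. of_bool (\<gamma> = \<alpha> \<and> j \<le> l)) = (if \<alpha> = \<gamma> then l else 0)" for \<alpha> :: nat
  proof -
    have "(\<Sum>j=1..H. of_bool (j \<le> l)) = card {j\<in>{1..H}. j \<le> l}"
      by (simp add: sum_of_bool_eq) (intro arg_cong[of _ _ card], auto)
    also have "{j\<in>{1..H}. j \<le> l} = {1..l}" using x by auto
    finally show ?thesis by (auto simp: of_bool_def)
  qed
  then show ?case using add x by (simp add: row_count_add_mset sum.distrib box_number_def)
qed (simp add: box_number_def)

lemma diagram_tuple_in_young_tuples:
  assumes "set_mset m \<subseteq> col_types r H"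
  shows "diagram_tuple r m \<in> young_tuples r (box_number m)"
proof -
  have "card (diagram_tuple r m \<alpha>) = (\<Sum>j=1..H. row_count m \<alpha> j)" if "\<alpha> \<in> {1..r}" for \<alpha>
    using diagram_tuple_young[OF assms that] by (simp add: card_young_rows[of _ H])
  then have "(\<Sum>\<alpha>=1..r. card (diagram_tuple r m \<alpha>)) = box_number m"
    using sum_row_count[OF assms] by simp
  moreover have "diagram_tuple r m \<in> {1..r} \<rightarrow>\<^sub>E young_diagrams"
    using diagram_tuple_young(1)[OF assms] by (auto simp: PiE_iff diagram_tuple_def)
  ultimately show ?thesis by (simp add: young_tuples_def)
qed

lemma diagram_tuple_inj:
  assumes "set_mset m \<subseteq> col_types r H" "set_mset m' \<subseteq> col_types r H" "diagram_tuple r m = diagram_tuple r m'"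
  shows "m = m'"
proof (rule multiset_eqI)
  fix x :: "nat \<times> nat"
  obtain \<alpha> j where x: "x = (\<alpha>, j)" by force
  show "count m x = count m' x"
  proof (cases "\<alpha> \<in> {1..r} \<and> j \<ge> 1")
    case True
    have "row_count m \<alpha> k = row_count m' \<alpha> k" if "k \<ge> 1" for k
      using diagram_tuple_young(3)[OF assms(1), of \<alpha> k] diagram_tuple_young(3)[OF assms(2), of \<alpha> k] assms(3) True that
      by simp
    then show ?thesis using row_count_eq_count[of m \<alpha> j] row_count_eq_count[of m' \<alpha> j] True x by simp
  next
    case False
    then have "x \<notin># m" "x \<notin># m'" using assms(1,2) x by (auto simp: col_types_def)
    then show ?thesis by (simp add: not_in_iff)
  qed
qed

text \<open>No column is longer than the total number of boxes, so heights up to H suffice.\<close>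

lemma diagram_tuple_surj:
  assumes Y: "Y \<in> young_tuples r n" and "n \<le> H"
  obtains m where "set_mset m \<subseteq> col_types r H" "diagram_tuple r m = Y"
proof
  define m where "m = (\<Sum>\<alpha>=1..r. image_mset (\<lambda>i. (\<alpha>, col_len (Y \<alpha>) i)) (mset_set {1..row_len (Y \<alpha>) 1}))"
  have yd: "Y \<alpha> \<in> young_diagrams" and card: "card (Y \<alpha>) \<le> n" if "\<alpha> \<in> {1..r}" for \<alpha>
  proof -
    show "Y \<alpha> \<in> young_diagrams" using Y that by (auto simp: young_tuples_def)
    have "card (Y \<alpha>) \<le> (\<Sum>\<alpha>=1..r. card (Y \<alpha>))" using that by (intro member_le_sum) auto
    then show "card (Y \<alpha>) \<le> n" using Y by (simp add: young_tuples_def)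
  qed
  show "set_mset m \<subseteq> col_types r H"
  proof
    fix x assume "x \<in># m"
    then obtain \<alpha> i where x: "\<alpha> \<in> {1..r}" "i \<in> {1..row_len (Y \<alpha>) 1}" "x = (\<alpha>, col_len (Y \<alpha>) i)"
      by (auto simp: m_def set_mset_sum)
    have "(i, 1) \<in> Y \<alpha>" using x young_mem_row[OF yd[OF x(1)], of i 1] by auto
    then have c1: "1 \<le> col_len (Y \<alpha>) i" using young_mem_col[OF yd[OF x(1)], of i 1] by auto
    then have "(i, col_len (Y \<alpha>) i) \<in> Y \<alpha>" using x young_mem_col[OF yd[OF x(1)], of i] by auto
    then have "col_len (Y \<alpha>) i \<le> card (Y \<alpha>)" using young_diagram_subset[OF yd[OF x(1)]] by auto
    then show "x \<in> col_types r H" using x c1 card[OF x(1)] assms(2) by (auto simp: col_types_def)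
  qed
  have "row_count m \<alpha> j = row_len (Y \<alpha>) j" if \<alpha>: "\<alpha> \<in> {1..r}" and j: "j \<ge> 1" for \<alpha> j
  proof -
    have rc: "row_count (\<Sum>\<beta>\<in>A. f \<beta>) \<alpha> j = (\<Sum>\<beta>\<in>A. row_count (f \<beta>) \<alpha> j)" for A :: "nat set" and f
      by (induction A rule: infinite_finite_induct) (simp_all add: row_count_union)
    have "row_count (image_mset (\<lambda>i. (\<beta>, col_len (Y \<beta>) i)) (mset_set {1..row_len (Y \<beta>) 1})) \<alpha> j =
        (if \<beta> = \<alpha> then row_len (Y \<alpha>) j else 0)" if "\<beta> \<in> {1..r}" for \<beta>
    proof (cases "\<beta> = \<alpha>")
      case True
      have "{i\<in>{1..row_len (Y \<alpha>) 1}. j \<le> col_len (Y \<alpha>) i} = {1..row_len (Y \<alpha>) j}"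
      proof (rule set_eqI)
        fix i
        have "i \<in> {i\<in>{1..row_len (Y \<alpha>) 1}. j \<le> col_len (Y \<alpha>) i} \<longleftrightarrow> (i, 1) \<in> Y \<alpha> \<and> (i, j) \<in> Y \<alpha>"
          unfolding young_mem_row[OF yd[OF \<alpha>], of i 1] young_mem_col[OF yd[OF \<alpha>], of i j] using j by auto
        also have "\<dots> \<longleftrightarrow> (i, j) \<in> Y \<alpha>"
          using young_down[OF yd[OF \<alpha>], of i j i 1] young_pos[OF yd[OF \<alpha>], of i j] j by auto
        also have "\<dots> \<longleftrightarrow> i \<in> {1..row_len (Y \<alpha>) j}"
          unfolding young_mem_row[OF yd[OF \<alpha>], of i j] using j by auto
        finally show "i \<in> {i\<in>{1..row_len (Y \<alpha>) 1}. j \<le> col_len (Y \<alpha>) i} \<longleftrightarrow> i \<in> {1..row_len (Y \<alpha>) j}" .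
      qed
      then show ?thesis using True
        by (simp add: row_count_def filter_mset_image_mset filter_mset_mset_set)
    next
      case False
      then show ?thesis by (simp add: row_count_def filter_mset_image_mset)
    qed
    then show ?thesis using \<alpha> by (simp add: m_def rc)
  qed
  then show "diagram_tuple r m = Y"
  proof -
    assume rc: "\<And>\<alpha> j. \<alpha> \<in> {1..r} \<Longrightarrow> 1 \<le> j \<Longrightarrow> row_count m \<alpha> j = row_len (Y \<alpha>) j"
    show ?thesis
    proof
      fix \<alpha>
      show "diagram_tuple r m \<alpha> = Y \<alpha>"
      proof (cases "\<alpha> \<in> {1..r}")
        case True
        then show ?thesis using rc[OF True] young_mem_row[OF yd[OF True]] by (auto simp: diagram_tuple_def)
      next
        case False
        then show ?thesis using Y by (auto simp: diagram_tuple_def young_tuples_def PiE_iff extensional_def)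
      qed
    qed
  qed
qed

lemma diagram_tuple_bij:
  assumes "n \<le> H"
  shows "bij_betw (diagram_tuple r) {m. set_mset m \<subseteq> col_types r H \<and> box_number m = n} (young_tuples r n)"
  unfolding bij_betw_def
proof (intro conjI equalityI subsetI)
  show "inj_on (diagram_tuple r) {m. set_mset m \<subseteq> col_types r H \<and> box_number m = n}"
    by (rule inj_onI) (auto intro: diagram_tuple_inj)
  fix Y
  show "Y \<in> young_tuples r n" if "Y \<in> diagram_tuple r ` {m. set_mset m \<subseteq> col_types r H \<and> box_number m = n}"
    using that diagram_tuple_in_young_tuples by blast
  show "Y \<in> diagram_tuple r ` {m. set_mset m \<subseteq> col_types r H \<and> box_number m = n}" if Y: "Y \<in> young_tuples r n"
  proof -
    obtain m where m: "set_mset m \<subseteq> col_types r H" "diagram_tuple r m = Y" using diagram_tuple_surj[OF Y assms] .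
    then have "box_number m = n" using diagram_tuple_in_young_tuples[OF m(1)] Y by (auto simp: young_tuples_def)
    then show ?thesis using m by blast
  qed
qed

section \<open>Adding a column\<close>

context rat_subring
begin

lemma unit_ratio_times: "unit_ratio t h \<Longrightarrow> unit_ratio t f \<Longrightarrow> unit_ratio t (\<lambda>m. h m * f m)"
proof (induction rule: unit_ratio.induct)
  case (unit_ratio_mult h c l)
  then show ?case using unit_ratio.unit_ratio_mult[of t "\<lambda>m. h m * f m" c l] by (simp add: mult.assoc)
next
  case (unit_ratio_div h c l)
  then show ?case using unit_ratio.unit_ratio_div[of t "\<lambda>m. h m * f m" c l] by simp
qed simp

lemma unit_ratio_prod: "(\<And>i. i \<in> A \<Longrightarrow> unit_ratio t (f i)) \<Longrightarrow> unit_ratio t (\<lambda>m. \<Prod>i\<in>A. f i m)"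
  by (induction A rule: infinite_finite_induct) (auto intro: unit_ratio_1 unit_ratio_times)

end

locale nekrasov_axis = nekrasov_subring r e1 e2 a R
  for r :: nat and e1 e2 :: "'a::field_char_0" and a :: "nat \<Rightarrow> 'a" and R :: "'a set" +
  assumes unit: "\<lbrakk>\<alpha> \<in> {1..r}; \<beta> \<in> {1..r}; \<alpha> \<noteq> \<beta> \<or> l \<noteq> 0\<rbrakk> \<Longrightarrow>
      inverse (of_int k * e1 + of_int l * e2 + a \<beta> - a \<alpha>) \<in> R"
begin

abbreviation increment :: "nat \<Rightarrow> nat \<Rightarrow> int \<Rightarrow> int \<Rightarrow> int \<Rightarrow> 'a nz" where
  "increment \<alpha> \<beta> y n \<delta> \<equiv> int_sum (slin \<alpha> \<beta>) y (n + \<delta>) - int_sum (slin \<alpha> \<beta>) y n"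

text \<open>A step of length one in \<open>int_sum\<close> is a single linear form, and a unit of R
  unless \<alpha> = \<beta> and y = 0, where it is a multiple of e1.\<close>

lemma unit_ratio_increment:
  assumes \<alpha>\<beta>: "\<alpha> \<in> {1..r}" "\<beta> \<in> {1..r}" and l: "\<And>m m'. l (m + m') = l m + l m'"
    and \<delta>: "\<delta> \<in> {-1, 0, 1}" "\<alpha> \<noteq> \<beta> \<or> y \<noteq> 0 \<or> \<delta> = 0"
  shows "unit_ratio e1 (\<lambda>m. of_nz (increment \<alpha> \<beta> y (l m) \<delta>))" (is ?P)
    "unit_ratio e1 (\<lambda>m. of_nz (- increment \<alpha> \<beta> y (l m) \<delta>))" (is ?N)
proof -
  define c where "c = of_int y * e2 + a \<beta> - a \<alpha>"
  have R: "c \<in> R" "c + e1 \<in> R" unfolding c_def using params_in_R \<alpha>\<beta> by (intro add diff mult; simp)+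
  have nz: "of_nz (slin \<alpha> \<beta> k y) = c + of_int k * e1" "c + of_int k * e1 \<noteq> 0 \<and> inverse (c + of_int k * e1) \<in> R"
    if "\<alpha> \<noteq> \<beta> \<or> y \<noteq> 0" for k
    using of_nz_slin[OF \<alpha>\<beta>, of k y] generic[OF \<alpha>\<beta>, of k y] unit[OF \<alpha>\<beta>, of y k] that
    by (auto simp: c_def algebra_simps)
  have nz': "c + e1 + of_int k * e1 \<noteq> 0 \<and> inverse (c + e1 + of_int k * e1) \<in> R" if "\<alpha> \<noteq> \<beta> \<or> y \<noteq> 0" for k
    using nz(2)[OF that, of "k + 1"] by (simp add: algebra_simps)
  consider "\<delta> = 0" | "\<delta> = 1" "\<alpha> \<noteq> \<beta> \<or> y \<noteq> 0" | "\<delta> = -1" "\<alpha> \<noteq> \<beta> \<or> y \<noteq> 0" using \<delta> by auto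
  then have "?P \<and> ?N"
  proof cases
    case 1
    then show ?thesis by (simp add: unit_ratio_1)
  next
    case 2
    \<comment> \<open>A step up uses the form at n + 1, a step down the form at n; hence the
      constants c + e1 and c.\<close>
    have eq: "of_nz (slin \<alpha> \<beta> (l m + 1) y) = (c + e1) + of_int (l m) * e1" for m
      using nz(1)[OF 2(2), of "l m + 1"] by (simp add: algebra_simps)
    show ?thesis
      using unit_ratio_mult[OF unit_ratio_1 R(2) l] unit_ratio_div[OF unit_ratio_1 R(2) l nz'[OF 2(2)]] 2(1)
      by (simp add: int_sum_add_1 eq inverse_eq_divide del: of_nz_diff)
  next
    case 3
    have eq: "increment \<alpha> \<beta> y (l m) \<delta> = - slin \<alpha> \<beta> (l m) y" for m
      using int_sum_diff_1[of "slin \<alpha> \<beta>" y "l m"] 3(1) by simp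
    show ?thesis
      using unit_ratio_mult[OF unit_ratio_1 R(1) l] unit_ratio_div[OF unit_ratio_1 R(1) l nz(2)[OF 3(2)]]
      unfolding eq by (simp add: nz(1)[OF 3(2)] inverse_eq_divide)
  qed
  then show ?P ?N by blast+
qed

text \<open>A column of height l in component \<gamma> changes each difference of row lengths by at
  most one, so each slot of \<open>box_pair_sum_rows\<close> yields one linear form or none. Only
  the slot \<open>sp\<close>, comparing rows l and l + 1 of \<gamma>, yields a multiple of e1,
  namely e1 times the new multiplicity; it is moved to the left side.\<close>

lemma weight_add_column:
  assumes \<tau>: "\<tau> \<in> col_types r H"
  obtains g where "unit_ratio e1 g"
    "\<And>m. set_mset m \<subseteq> col_types r H \<Longrightarrow>
      e1 * of_nat (count m \<tau> + 1) * weight (diagram_tuple r (add_mset \<tau> m)) = g m * weight (diagram_tuple r m)"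
proof -
  obtain \<gamma> l where \<tau>_eq: "\<tau> = (\<gamma>, l)" and \<gamma>: "\<gamma> \<in> {1..r}" and l: "1 \<le> l" "l \<le> H"
    using \<tau> by (auto simp: col_types_def)
  \<comment> \<open>One row beyond the maximal height: row l + 1 is then always present, and the
    boundary term of the last row, the one with y = 0, does not change.\<close>
  let ?H = "Suc H"
  let ?c = "\<lambda>m \<alpha> j. int (row_count m \<alpha> j)"
  define d where "d \<alpha> j = (of_bool (\<gamma> = \<alpha> \<and> j \<le> l) :: int)" for \<alpha> j
  define A where "A \<alpha> \<beta> j k m = increment \<alpha> \<beta> (int j - int k + 1) (?c m \<alpha> j - ?c m \<beta> k) (d \<alpha> j - d \<beta> k)" for \<alpha> \<beta> j k m
  define B where "B \<alpha> \<beta> j k m = increment \<alpha> \<beta> (int j - int k) (?c m \<alpha> j - ?c m \<beta> k) (d \<alpha> j - d \<beta> k)" for \<alpha> \<beta> j k m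
  define C where "C \<alpha> \<beta> j m = increment \<alpha> \<beta> (int j - int ?H) (?c m \<alpha> j) (d \<alpha> j)" for \<alpha> \<beta> j m
  define E where "E \<alpha> \<beta> k m = increment \<alpha> \<beta> (int ?H + 1 - int k) (- ?c m \<beta> k) (- d \<beta> k)" for \<alpha> \<beta> k m
  define sp where "sp \<alpha> \<beta> j k \<longleftrightarrow> \<alpha> = \<gamma> \<and> \<beta> = \<gamma> \<and> j = l \<and> k = Suc l" for \<alpha> \<beta> j k
  define A' where "A' \<alpha> \<beta> j k m = (if sp \<alpha> \<beta> j k then 0 else A \<alpha> \<beta> j k m)" for \<alpha> \<beta> j k m
  define s where "s m = slin \<gamma> \<gamma> (int (count m \<tau>) + 1) 0" for m
  define g where "g m = of_nz (\<Sum>\<alpha>=1..r. \<Sum>\<beta>=1..r.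
      (\<Sum>j=1..?H. \<Sum>k=1..?H. - A' \<alpha> \<beta> j k m) + (\<Sum>j=1..?H. \<Sum>k=1..?H. B \<alpha> \<beta> j k m) +
      (\<Sum>j=1..?H. - C \<alpha> \<beta> j m) + (\<Sum>k=1..?H. E \<alpha> \<beta> k m))" for m
  have d_cases: "d \<alpha> j \<in> {-1, 0, 1}" "- d \<alpha> j \<in> {-1, 0, 1}" "d \<alpha> j - d \<beta> k \<in> {-1, 0, 1}" for \<alpha> \<beta> j k
    by (auto simp: d_def)
  have d_sp: "d \<alpha> j - d \<alpha> (Suc j) = of_bool (\<gamma> = \<alpha> \<and> j = l)" for \<alpha> j by (auto simp: d_def)
  have add: "?c (m + m') \<alpha> j - ?c (m + m') \<beta> k = (?c m \<alpha> j - ?c m \<beta> k) + (?c m' \<alpha> j - ?c m' \<beta> k)"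
    "?c (m + m') \<alpha> j = ?c m \<alpha> j + ?c m' \<alpha> j" "- ?c (m + m') \<beta> k = - ?c m \<beta> k + - ?c m' \<beta> k" for m m' \<alpha> \<beta> j k
    by (simp_all add: row_count_union)
  have "unit_ratio e1 g"
    unfolding g_def of_nz_sum of_nz_add
  proof (intro unit_ratio_prod unit_ratio_times)
    fix \<alpha> \<beta> j k assume \<alpha>\<beta>: "\<alpha> \<in> {1..r}" "\<beta> \<in> {1..r}" and j: "j \<in> {1..?H}"
    show "unit_ratio e1 (\<lambda>m. of_nz (- A' \<alpha> \<beta> j k m))"
    proof (cases "sp \<alpha> \<beta> j k")
      case True
      then show ?thesis by (simp add: A'_def unit_ratio_1)
    next
      case False
      have "\<alpha> \<noteq> \<beta> \<or> int j - int k + 1 \<noteq> 0 \<or> d \<alpha> j - d \<beta> k = 0"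
      proof (rule ccontr)
        assume "\<not> ?thesis"
        then have "\<alpha> = \<beta>" "k = Suc j" "d \<alpha> j - d \<beta> k \<noteq> 0" by auto
        then show False using False d_sp[of \<alpha> j] by (auto simp: sp_def split: if_splits)
      qed
      then show ?thesis unfolding A'_def A_def if_not_P[OF False]
        by (rule unit_ratio_increment(2)[OF \<alpha>\<beta> add(1) d_cases(3)])
    qed
    show "unit_ratio e1 (\<lambda>m. of_nz (B \<alpha> \<beta> j k m))"
      unfolding B_def by (rule unit_ratio_increment(1)[OF \<alpha>\<beta> add(1) d_cases(3)]) auto
    have "\<alpha> \<noteq> \<beta> \<or> int j - int ?H \<noteq> 0 \<or> d \<alpha> j = 0" using j l by (auto simp: d_def)
    then show "unit_ratio e1 (\<lambda>m. of_nz (- C \<alpha> \<beta> j m))"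
      unfolding C_def by (rule unit_ratio_increment(2)[OF \<alpha>\<beta> add(2) d_cases(1)])
  next
    fix \<alpha> \<beta> k assume \<alpha>\<beta>: "\<alpha> \<in> {1..r}" "\<beta> \<in> {1..r}" and k: "k \<in> {1..?H}"
    have "\<alpha> \<noteq> \<beta> \<or> int ?H + 1 - int k \<noteq> 0 \<or> - d \<beta> k = 0" using k by auto
    then show "unit_ratio e1 (\<lambda>m. of_nz (E \<alpha> \<beta> k m))"
      unfolding E_def by (rule unit_ratio_increment(1)[OF \<alpha>\<beta> add(3) d_cases(2)])
  qed
  moreover have "e1 * of_nat (count m \<tau> + 1) * weight (diagram_tuple r (add_mset \<tau> m)) = g m * weight (diagram_tuple r m)"
    if m: "set_mset m \<subseteq> col_types r H" for m
  proof -
    have m': "set_mset (add_mset \<tau> m) \<subseteq> col_types r H" using m \<tau> by simp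
    have t: "tuple (diagram_tuple r m)" "tuple (diagram_tuple r (add_mset \<tau> m))"
      using diagram_tuple_young(1)[OF m] diagram_tuple_young(1)[OF m'] by (auto simp: tuple_def)
    define fA where "fA n \<alpha> \<beta> j k = int_sum (slin \<alpha> \<beta>) (int j - int k + 1) (?c n \<alpha> j - ?c n \<beta> k)" for n \<alpha> \<beta> j k
    define fB where "fB n \<alpha> \<beta> j k = int_sum (slin \<alpha> \<beta>) (int j - int k) (?c n \<alpha> j - ?c n \<beta> k)" for n \<alpha> \<beta> j k
    define fC where "fC n \<alpha> \<beta> j = int_sum (slin \<alpha> \<beta>) (int j - int ?H) (?c n \<alpha> j)" for n \<alpha> \<beta> j
    define fE where "fE n \<alpha> \<beta> k = int_sum (slin \<alpha> \<beta>) (int ?H + 1 - int k) (- ?c n \<beta> k)" for n \<alpha> \<beta> k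
    have L: "log_euler (diagram_tuple r n) = (\<Sum>\<alpha>=1..r. \<Sum>\<beta>=1..r.
        (\<Sum>j=1..?H. \<Sum>k=1..?H. fA n \<alpha> \<beta> j k) - (\<Sum>j=1..?H. \<Sum>k=1..?H. fB n \<alpha> \<beta> j k) +
        (\<Sum>j=1..?H. fC n \<alpha> \<beta> j) - (\<Sum>k=1..?H. fE n \<alpha> \<beta> k))"
      if n: "set_mset n \<subseteq> col_types r H" for n
      unfolding log_euler_def
    proof (intro sum.cong refl)
      fix \<alpha> \<beta> assume \<alpha>\<beta>: "\<alpha> \<in> {1..r}" "\<beta> \<in> {1..r}"
      note y = diagram_tuple_young[OF n \<alpha>\<beta>(1)] and z = diagram_tuple_young[OF n \<alpha>\<beta>(2)]
      have "box_pair_sum (slin \<alpha> \<beta>) (diagram_tuple r n \<alpha>) (diagram_tuple r n \<beta>) =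
        (\<Sum>j=1..?H. \<Sum>k=1..?H. int_sum (slin \<alpha> \<beta>) (int j - int k + 1)
          (int (row_len (diagram_tuple r n \<alpha>) j) - int (row_len (diagram_tuple r n \<beta>) k))) -
        (\<Sum>j=1..?H. \<Sum>k=1..?H. int_sum (slin \<alpha> \<beta>) (int j - int k)
          (int (row_len (diagram_tuple r n \<alpha>) j) - int (row_len (diagram_tuple r n \<beta>) k))) +
        (\<Sum>j=1..?H. int_sum (slin \<alpha> \<beta>) (int j - int ?H) (int (row_len (diagram_tuple r n \<alpha>) j))) -
        (\<Sum>k=1..?H. int_sum (slin \<alpha> \<beta>) (int ?H + 1 - int k) (- int (row_len (diagram_tuple r n \<beta>) k)))"
        by (rule box_pair_sum_rows[OF y(1) le_SucI[OF y(2)] z(1) le_SucI[OF z(2)]])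
      also have "\<dots> = (\<Sum>j=1..?H. \<Sum>k=1..?H. fA n \<alpha> \<beta> j k) - (\<Sum>j=1..?H. \<Sum>k=1..?H. fB n \<alpha> \<beta> j k) +
        (\<Sum>j=1..?H. fC n \<alpha> \<beta> j) - (\<Sum>k=1..?H. fE n \<alpha> \<beta> k)"
        unfolding fA_def fB_def fC_def fE_def
        by (intro arg_cong2[of _ _ _ _ "(+)"] arg_cong2[of _ _ _ _ "(-)"] sum.cong refl) (simp_all add: y(3) z(3))
      finally show "box_pair_sum (slin \<alpha> \<beta>) (diagram_tuple r n \<alpha>) (diagram_tuple r n \<beta>) =
        (\<Sum>j=1..?H. \<Sum>k=1..?H. fA n \<alpha> \<beta> j k) - (\<Sum>j=1..?H. \<Sum>k=1..?H. fB n \<alpha> \<beta> j k) +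
        (\<Sum>j=1..?H. fC n \<alpha> \<beta> j) - (\<Sum>k=1..?H. fE n \<alpha> \<beta> k)" .
    qed
    have cadd: "?c (add_mset \<tau> m) \<alpha> j = ?c m \<alpha> j + d \<alpha> j" for \<alpha> j
      by (simp add: row_count_add_mset d_def \<tau>_eq)
    have diffs: "?c (add_mset \<tau> m) \<alpha> j - ?c (add_mset \<tau> m) \<beta> k = (?c m \<alpha> j - ?c m \<beta> k) + (d \<alpha> j - d \<beta> k)"
      "- ?c (add_mset \<tau> m) \<beta> k = - ?c m \<beta> k + - d \<beta> k" for \<alpha> \<beta> j k
      by (simp_all add: cadd)
    have f: "fA (add_mset \<tau> m) \<alpha> \<beta> j k = fA m \<alpha> \<beta> j k + A \<alpha> \<beta> j k m"
      "fB (add_mset \<tau> m) \<alpha> \<beta> j k = fB m \<alpha> \<beta> j k + B \<alpha> \<beta> j k m"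
      "fC (add_mset \<tau> m) \<alpha> \<beta> j = fC m \<alpha> \<beta> j + C \<alpha> \<beta> j m"
      "fE (add_mset \<tau> m) \<alpha> \<beta> k = fE m \<alpha> \<beta> k + E \<alpha> \<beta> k m" for \<alpha> \<beta> j k
      unfolding fA_def fB_def fC_def fE_def A_def B_def C_def E_def diffs unfolding cadd by simp_all
    have cnt: "?c m \<gamma> l - ?c m \<gamma> (Suc l) = int (count m \<tau>)" using row_count_eq_count[of m \<gamma> l] by (simp add: \<tau>_eq)
    have A: "A \<alpha> \<beta> j k m = A' \<alpha> \<beta> j k m + (if sp \<alpha> \<beta> j k then s m else 0)" for \<alpha> \<beta> j k
    proof (cases "sp \<alpha> \<beta> j k")
      case True
      then have eq: "\<alpha> = \<gamma>" "\<beta> = \<gamma>" "j = l" "k = Suc l" by (auto simp: sp_def)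
      have "A \<gamma> \<gamma> l (Suc l) m = increment \<gamma> \<gamma> 0 (int (count m \<tau>)) 1"
        unfolding A_def cnt using d_sp[of \<gamma> l] by simp
      then show ?thesis unfolding A'_def if_P[OF True] using int_sum_add_1[of "slin \<gamma> \<gamma>" 0 "int (count m \<tau>)"]
        by (simp add: eq s_def)
    qed (simp add: A'_def)
    have sps: "(\<Sum>\<alpha>=1..r. \<Sum>\<beta>=1..r. \<Sum>j=1..?H. \<Sum>k=1..?H. if sp \<alpha> \<beta> j k then s m else 0) = s m"
    proof -
      have 1: "(\<Sum>k=1..?H. if sp \<alpha> \<beta> j k then s m else 0) = (if j = l then if \<beta> = \<gamma> then if \<alpha> = \<gamma> then s m else 0 else 0 else 0)" for \<alpha> \<beta> j
        using l by (simp add: sp_def)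
      show ?thesis unfolding 1 using l \<gamma> by simp
    qed
    have group: "x - y + z - w - (x + x' - (y + y') + (z + z') - (w + w')) = - x' + y' + - z' + w'"
      and group': "- (x + x') + y + - z + w = - x + y + - z + w - x'" for x x' y y' z z' w w' :: "'a nz"
      by (simp_all add: algebra_simps)
    have sA: "(\<Sum>\<alpha>=1..r. \<Sum>\<beta>=1..r. \<Sum>j=1..?H. \<Sum>k=1..?H. A \<alpha> \<beta> j k m) =
        (\<Sum>\<alpha>=1..r. \<Sum>\<beta>=1..r. \<Sum>j=1..?H. \<Sum>k=1..?H. A' \<alpha> \<beta> j k m) + s m"
      unfolding A sum.distrib sps ..
    have "log_euler (diagram_tuple r m) - log_euler (diagram_tuple r (add_mset \<tau> m)) =
      (\<Sum>\<alpha>=1..r. \<Sum>\<beta>=1..r.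
        (\<Sum>j=1..?H. \<Sum>k=1..?H. - A \<alpha> \<beta> j k m) + (\<Sum>j=1..?H. \<Sum>k=1..?H. B \<alpha> \<beta> j k m) +
        (\<Sum>j=1..?H. - C \<alpha> \<beta> j m) + (\<Sum>k=1..?H. E \<alpha> \<beta> k m))"
      unfolding L[OF m] L[OF m'] f sum_negf sum.distrib sum_subtractf by (rule group)
    also have "\<dots> = (\<Sum>\<alpha>=1..r. \<Sum>\<beta>=1..r.
        (\<Sum>j=1..?H. \<Sum>k=1..?H. - A' \<alpha> \<beta> j k m) + (\<Sum>j=1..?H. \<Sum>k=1..?H. B \<alpha> \<beta> j k m) +
        (\<Sum>j=1..?H. - C \<alpha> \<beta> j m) + (\<Sum>k=1..?H. E \<alpha> \<beta> k m)) - s m"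
      unfolding sum_negf sum.distrib sum_subtractf sA by (rule group')
    finally have "of_nz (log_euler (diagram_tuple r m) - log_euler (diagram_tuple r (add_mset \<tau> m))) = g m / of_nz (s m)"
      unfolding g_def by (simp only: of_nz_diff)
    moreover have "of_nz (s m) = e1 * of_nat (count m \<tau> + 1)"
      unfolding s_def using of_nz_slin[OF \<gamma> \<gamma>, of "int (count m \<tau>) + 1" 0] by (simp add: mult.commute)
    ultimately have "of_nz (log_euler (diagram_tuple r m)) * (e1 * of_nat (count m \<tau> + 1)) = g m * of_nz (log_euler (diagram_tuple r (add_mset \<tau> m)))"
      using of_nz_neq_0[of "s m"] by (simp add: field_simps)
    then show ?thesis unfolding weight_eq[OF t(1)] weight_eq[OF t(2)]
      by (simp add: field_simps)
  qed
  ultimately show ?thesis using that by blast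
qed

text \<open>Hence \<open>log Z\<close> has at most a simple pole along \<open>e1 = 0\<close>; the coefficients of \<open>q (log Z)'\<close> are
  characterised by the recursion in the assumption.\<close>

theorem log_coeff_in_R:
  assumes L: "\<And>n. of_nat n * Zcoeff n = (\<Sum>i\<le>n. of_nat i * L i * Zcoeff (n - i))" and "n \<ge> 1"
  shows "e1 * L n \<in> R"
proof -
  \<comment> \<open>Columns of height at most n account for all coefficients up to q^n and keep the
    set of variables finite.\<close>
  define T where "T = col_types r n"
  define W where "W m = (if set_mset m \<subseteq> T then weight (diagram_tuple r m) else 0)" for m
  have "\<forall>\<tau>\<in>T. \<exists>g. unit_ratio e1 g \<and> (\<forall>m. set_mset m \<subseteq> T \<longrightarrow>
      e1 * of_nat (count m \<tau> + 1) * weight (diagram_tuple r (add_mset \<tau> m)) = g m * weight (diagram_tuple r m))"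
    unfolding T_def using weight_add_column by metis
  then obtain g where g: "\<And>\<tau>. \<tau> \<in> T \<Longrightarrow> unit_ratio e1 (g \<tau>)"
    "\<And>\<tau> m. \<tau> \<in> T \<Longrightarrow> set_mset m \<subseteq> T \<Longrightarrow>
      e1 * of_nat (count m \<tau> + 1) * weight (diagram_tuple r (add_mset \<tau> m)) = g \<tau> m * weight (diagram_tuple r m)"
    by metis
  have "factor (diagram_tuple r {#}) \<alpha> \<beta> = 1" if "\<alpha> \<in> {1..r}" "\<beta> \<in> {1..r}" for \<alpha> \<beta>
  proof -
    have "diagram_tuple r {#} \<alpha> = {}" "diagram_tuple r {#} \<beta> = {}" using that by (auto simp: diagram_tuple_def)
    then show ?thesis by (simp add: factor_def)
  qed
  then have "weight (diagram_tuple r {#}) = 1" by (simp add: weight_def)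
  then interpret multiset_recursion R e1 T W g
    using params_in_R(1) g by unfold_locales (auto simp: W_def T_def col_types_def)
  define S where "S i = {m. set_mset m \<subseteq> T \<and> box_number m = i}" for i
  note bij = diagram_tuple_bij[of _ n r, folded T_def, folded S_def]
  have finS: "finite (S i)" if "i \<le> n" for i
    using bij_betw_finite[OF bij[OF that]] finite_young_tuples by blast
  have ZS: "Zcoeff i = (\<Sum>m\<in>S i. W m)" if "i \<le> n" for i
    unfolding Zcoeff_def sum.reindex_bij_betw[OF bij[OF that], symmetric]
    by (rule sum.cong) (auto simp: S_def W_def)
  \<comment> \<open>Setting each variable to q^height turns this weighted sum of logarithmic
    derivatives into e1 q d/dq log Z.\<close>
  define V where "V m = (\<Sum>\<tau>\<in>T. of_nat (snd \<tau>) * U \<tau> m)" for m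
  define u where "u i = (\<Sum>m\<in>S i. V m)" for i
  have bn: "box_number (k + k') = box_number k + box_number k'" for k k' by (simp add: box_number_def)
  have WV: "conv W V m = e1 * of_nat (box_number m) * W m" if m: "set_mset m \<subseteq> T" for m
  proof -
    have "conv W V m = (\<Sum>\<tau>\<in>T. of_nat (snd \<tau>) * conv W (U \<tau>) m)"
      unfolding conv_def V_def sum_distrib_left by (subst sum.swap) (simp add: mult_ac)
    also have "\<dots> = e1 * of_int (\<Sum>\<tau>\<in>T. int (box_number {#\<tau>#}) * int (count m \<tau>)) * W m"
      unfolding U_def conv_quot_eq by (simp add: sum_distrib_left sum_distrib_right mult_ac box_number_def)
    also have "(\<Sum>\<tau>\<in>T. int (box_number {#\<tau>#}) * int (count m \<tau>)) = int (box_number m)"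
      using additive_sum[of "\<lambda>m. int (box_number m)", OF _ m] bn by simp
    finally show ?thesis by simp
  qed
  \<comment> \<open>Pairs of multisets are sorted by box number, which turns \<open>conv\<close>
    into the product of series in q.\<close>
  have rec: "e1 * of_nat j * Zcoeff j = (\<Sum>i\<le>j. u i * Zcoeff (j - i))" if j: "j \<le> n" for j
  proof -
    have "e1 * of_nat j * Zcoeff j = (\<Sum>m\<in>S j. conv W V m)"
      unfolding ZS[OF j] sum_distrib_left by (rule sum.cong) (auto simp: S_def WV)
    also have "\<dots> = (\<Sum>z\<in>(SIGMA m:S j. {k. k \<subseteq># m}). W (snd z) * V (fst z - snd z))"
      unfolding conv_def using finS[OF j] by (subst sum.Sigma) (auto simp: finite_submultisets case_prod_unfold)
    also have "\<dots> = (\<Sum>z\<in>(SIGMA i:{..j}. S i \<times> S (j - i)). V (fst (snd z)) * W (snd (snd z)))"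
    proof (rule sum.reindex_bij_witness[of _ "\<lambda>z. (snd (snd z) + fst (snd z), snd (snd z))"
          "\<lambda>z. (box_number (fst z - snd z), fst z - snd z, snd z)"])
      fix z assume z: "z \<in> (SIGMA m:S j. {k. k \<subseteq># m})"
      obtain m k where mk: "z = (m, k)" by force
      have m: "m \<in> S j" "k \<subseteq># m" using z mk by auto
      have e: "k + (m - k) = m" using m by (simp add: subset_mset.add_diff_inverse)
      then have b: "box_number k + box_number (m - k) = box_number m" using bn by metis
      show "(snd (snd (box_number (fst z - snd z), fst z - snd z, snd z)) + fst (snd (box_number (fst z - snd z), fst z - snd z, snd z)),
          snd (snd (box_number (fst z - snd z), fst z - snd z, snd z))) = z" using e mk by simp
      have "set_mset k \<subseteq> set_mset m" "set_mset (m - k) \<subseteq> set_mset m"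
        using set_mset_mono[OF m(2)] by (auto dest: in_diffD)
      then show "(box_number (fst z - snd z), fst z - snd z, snd z) \<in> (SIGMA i:{..j}. S i \<times> S (j - i))"
        using m b mk by (auto simp: S_def)
      show "V (fst (snd (box_number (fst z - snd z), fst z - snd z, snd z))) * W (snd (snd (box_number (fst z - snd z), fst z - snd z, snd z))) =
          W (snd z) * V (fst z - snd z)" by (simp add: mult.commute)
    next
      fix z assume "z \<in> (SIGMA i:{..j}. S i \<times> S (j - i))"
      then obtain i k k' where z: "z = (i, k, k')" "i \<le> j" "k \<in> S i" "k' \<in> S (j - i)" by auto
      then show "(box_number (fst (snd (snd z) + fst (snd z), snd (snd z)) - snd (snd (snd z) + fst (snd z), snd (snd z))),
          fst (snd (snd z) + fst (snd z), snd (snd z)) - snd (snd (snd z) + fst (snd z), snd (snd z)),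
          snd (snd (snd z) + fst (snd z), snd (snd z))) = z"
        by (simp add: S_def)
      show "(snd (snd z) + fst (snd z), snd (snd z)) \<in> (SIGMA m:S j. {k. k \<subseteq># m})"
        using z by (auto simp: S_def bn)
    qed
    also have "\<dots> = (\<Sum>i\<le>j. u i * Zcoeff (j - i))"
    proof -
      have "(\<Sum>z\<in>(SIGMA i:{..j}. S i \<times> S (j - i)). V (fst (snd z)) * W (snd (snd z))) =
          (\<Sum>i\<le>j. \<Sum>z\<in>S i \<times> S (j - i). V (fst z) * W (snd z))"
        using finS j by (subst sum.Sigma) (auto simp: case_prod_unfold)
      also have "\<dots> = (\<Sum>i\<le>j. u i * Zcoeff (j - i))"
        using j by (intro sum.cong refl)
          (simp add: u_def ZS sum_product sum.cartesian_product case_prod_unfold)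
      finally show ?thesis .
    qed
    finally show ?thesis .
  qed
  have Z0: "Zcoeff 0 = 1"
  proof -
    have "S 0 = {{#}}"
    proof (intro equalityI subsetI)
      fix m assume m: "m \<in> S 0"
      show "m \<in> {{#}}"
      proof (cases m)
        case (add x m')
        then have "x \<in> T" "snd x = 0" using m by (auto simp: S_def box_number_def)
        then show ?thesis by (auto simp: T_def col_types_def)
      qed simp
    qed (simp add: S_def box_number_def)
    then show ?thesis using ZS[of 0] W_empty by simp
  qed
  \<comment> \<open>Both sequences satisfy the same recursion, whose top term has coefficient
    \<open>Zcoeff 0\<close> = 1.\<close>
  have uL: "u j = e1 * of_nat j * L j" if "j \<le> n" for j
    using that
  proof (induction j rule: less_induct)
    case (less j)
    have "(\<Sum>i\<le>j. u i * Zcoeff (j - i)) = (\<Sum>i\<le>j. e1 * of_nat i * L i * Zcoeff (j - i))"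
      using rec[OF less.prems] L[of j] by (simp add: sum_distrib_left mult.assoc)
    moreover have "(\<Sum>i<j. u i * Zcoeff (j - i)) = (\<Sum>i<j. e1 * of_nat i * L i * Zcoeff (j - i))"
      using less by (intro sum.cong) auto
    moreover have "{..j} = insert j {..<j}" by auto
    ultimately show ?case by (simp add: Z0)
  qed
  have "u n \<in> R" unfolding u_def V_def by (intro sum mult of_nat U_in_R)
  then have "of_nat n * (e1 * L n) \<in> R" unfolding uL[OF order_refl] by (simp add: mult_ac)
  then show ?thesis using cancel_nat[of n] assms(2) by simp
qed

end

section \<open>Exchanging the two equivariant parameters\<close>

lemma young_transpose:
  assumes "Y \<in> young_diagrams"
  shows "prod.swap ` Y \<in> young_diagrams"
  unfolding young_diagrams_def
proof (intro CollectI conjI allI impI)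
  show "finite (prod.swap ` Y)" using assms by (simp add: young_diagrams_def)
  show "prod.swap ` Y \<subseteq> {1..} \<times> {1..}" using assms by (auto simp: young_diagrams_def)
  fix i j i' j'
  assume "(i, j) \<in> prod.swap ` Y \<and> 1 \<le> i' \<and> i' \<le> i \<and> 1 \<le> j' \<and> j' \<le> j"
  then have "(j', i') \<in> Y" using young_down[OF assms, of j i j' i'] by auto
  then show "(i', j') \<in> prod.swap ` Y" by force
qed

lemma box_pair_sum_transpose:
  "box_pair_sum (\<lambda>x y. F y x) (prod.swap ` \<mu>) (prod.swap ` \<nu>) = box_pair_sum F \<mu> \<nu>"
proof -
  have s: "sum h (prod.swap ` A) = (\<Sum>(i, j)\<in>A. h (j, i))" for h :: "nat \<times> nat \<Rightarrow> 'a" and A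
    by (subst sum.reindex) (auto simp: case_prod_unfold prod.swap_def)
  have "mixed_diff (\<lambda>x y. F y x) x y = mixed_diff F y x" for x y
    by (simp add: mixed_diff_def algebra_simps)
  then show ?thesis unfolding box_pair_sum_def s by simp
qed

definition transpose_tuple :: "nat \<Rightarrow> (nat \<Rightarrow> (nat \<times> nat) set) \<Rightarrow> nat \<Rightarrow> (nat \<times> nat) set" where
  "transpose_tuple r Y = (\<lambda>\<alpha>\<in>{1..r}. prod.swap ` Y \<alpha>)"

lemma transpose_tuple_young_tuples:
  assumes "Y \<in> young_tuples r n"
  shows "transpose_tuple r Y \<in> young_tuples r n" "transpose_tuple r (transpose_tuple r Y) = Y"
proof -
  have "card (transpose_tuple r Y \<alpha>) = card (Y \<alpha>)" if "\<alpha> \<in> {1..r}" for \<alpha>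
    using that by (simp add: transpose_tuple_def card_image)
  then show "transpose_tuple r Y \<in> young_tuples r n"
    using assms young_transpose by (auto simp: young_tuples_def PiE_iff transpose_tuple_def)
  show "transpose_tuple r (transpose_tuple r Y) = Y"
    using assms by (auto simp: fun_eq_iff transpose_tuple_def young_tuples_def PiE_iff extensional_def image_image)
qed

text \<open>Transposition is visible in \<open>box_pair_sum\<close>, where rows and columns enter
  alike. The arm-leg formula is not symmetric factor by factor: its first product takes the shape of
  the second, but still runs over \<open>Y \<alpha>\<close> instead of
  \<open>Y \<beta>\<close>.\<close>

lemma nekrasov_params_swap:
  assumes "nekrasov_params r e1 e2 a"
  shows "nekrasov_params r e2 e1 a" "nekrasov_params.Zcoeff r e2 e1 a n = nekrasov_params.Zcoeff r e1 e2 a n"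
proof -
  interpret A: nekrasov_params r e1 e2 a by fact
  show B: "nekrasov_params r e2 e1 a"
  proof
    fix \<alpha> \<beta> and k l :: int assume "\<alpha> \<in> {1..r}" "\<beta> \<in> {1..r}" "\<alpha> \<noteq> \<beta> \<or> k \<noteq> 0 \<or> l \<noteq> 0"
    then show "of_int k * e2 + of_int l * e1 + a \<beta> - a \<alpha> \<noteq> 0"
      using A.generic[of \<alpha> \<beta> l k] by (auto simp: add.commute)
  qed
  interpret B: nekrasov_params r e2 e1 a by fact
  have "B.weight (transpose_tuple r Y) = A.weight Y" if Y: "Y \<in> young_tuples r n" for Y
  proof -
    have sl: "B.slin \<alpha> \<beta> = (\<lambda>x y. A.slin \<alpha> \<beta> y x)" for \<alpha> \<beta>
      by (auto simp: A.slin_def B.slin_def fun_eq_iff add.commute)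
    have "B.log_euler (transpose_tuple r Y) = A.log_euler Y"
      unfolding A.log_euler_def B.log_euler_def sl
      by (intro sum.cong refl) (simp add: transpose_tuple_def box_pair_sum_transpose)
    then show ?thesis
      using A.weight_eq[OF A.tuple_young_tuples[OF Y]]
        B.weight_eq[OF B.tuple_young_tuples[OF transpose_tuple_young_tuples(1)[OF Y]]] by simp
  qed
  then show "B.Zcoeff n = A.Zcoeff n"
    unfolding A.Zcoeff_def B.Zcoeff_def
    by (intro sym[OF sum.reindex_bij_witness[of _ "transpose_tuple r" "transpose_tuple r"]])
      (auto simp: transpose_tuple_young_tuples)
qed

section \<open>Substitution homomorphisms of the polynomial ring\<close>

lemma poly_mapping_sum_single:
  fixes p :: "'a \<Rightarrow>\<^sub>0 'b::comm_monoid_add"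
  shows "p = (\<Sum>m\<in>Poly_Mapping.keys p. Poly_Mapping.single m (Poly_Mapping.lookup p m))"
proof (rule poly_mapping_eqI)
  fix k
  have "Poly_Mapping.lookup (\<Sum>m\<in>Poly_Mapping.keys p. Poly_Mapping.single m (Poly_Mapping.lookup p m)) k =
      (\<Sum>m\<in>Poly_Mapping.keys p. if m = k then Poly_Mapping.lookup p k else 0)"
    unfolding lookup_sum by (rule sum.cong) (auto simp: lookup_single when_def)
  also have "\<dots> = Poly_Mapping.lookup p k" by (simp add: in_keys_iff)
  finally show "Poly_Mapping.lookup p k =
      Poly_Mapping.lookup (\<Sum>m\<in>Poly_Mapping.keys p. Poly_Mapping.single m (Poly_Mapping.lookup p m)) k" ..
qed

definition mono_subst :: "(nat \<Rightarrow> cpoly) \<Rightarrow> (nat \<Rightarrow>\<^sub>0 nat) \<Rightarrow> cpoly" where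
  "mono_subst f m = (\<Prod>i\<in>Poly_Mapping.keys m. f i ^ Poly_Mapping.lookup m i)"

lemma mono_subst_superset:
  assumes "finite A" "Poly_Mapping.keys m \<subseteq> A"
  shows "mono_subst f m = (\<Prod>i\<in>A. f i ^ Poly_Mapping.lookup m i)"
  unfolding mono_subst_def using assms by (intro prod.mono_neutral_left) (auto simp: in_keys_iff)

lemma mono_subst_add: "mono_subst f (m + m') = mono_subst f m * mono_subst f m'"
proof -
  let ?A = "Poly_Mapping.keys m \<union> Poly_Mapping.keys m'"
  have "mono_subst f (m + m') = (\<Prod>i\<in>?A. f i ^ Poly_Mapping.lookup (m + m') i)"
    by (rule mono_subst_superset) (use keys_add[of m m'] in auto)
  also have "\<dots> = (\<Prod>i\<in>?A. f i ^ Poly_Mapping.lookup m i) * (\<Prod>i\<in>?A. f i ^ Poly_Mapping.lookup m' i)"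
    by (simp add: lookup_add power_add prod.distrib)
  finally show ?thesis by (simp add: mono_subst_superset[of ?A])
qed

lemma pconst_0 [simp]: "pconst 0 = 0" and pconst_1 [simp]: "pconst 1 = 1"
  and pconst_add: "pconst (x + y) = pconst x + pconst y" and pconst_mult: "pconst (x * y) = pconst x * pconst y"
  by (simp_all add: pconst_def single_add mult_single)

lemma psubst_superset:
  assumes "finite A" "Poly_Mapping.keys p \<subseteq> A"
  shows "psubst f p = (\<Sum>m\<in>A. pconst (Poly_Mapping.lookup p m) * mono_subst f m)"
  unfolding psubst_def mono_subst_def[symmetric] using assms
  by (intro sum.mono_neutral_left) (auto simp: in_keys_iff)

lemma psubst_add: "psubst f (p + q) = psubst f p + psubst f q"
proof -
  let ?A = "Poly_Mapping.keys p \<union> Poly_Mapping.keys q"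
  have "psubst f (p + q) = (\<Sum>m\<in>?A. pconst (Poly_Mapping.lookup (p + q) m) * mono_subst f m)"
    by (rule psubst_superset) (use keys_add[of p q] in auto)
  also have "\<dots> = (\<Sum>m\<in>?A. pconst (Poly_Mapping.lookup p m) * mono_subst f m) +
      (\<Sum>m\<in>?A. pconst (Poly_Mapping.lookup q m) * mono_subst f m)"
    by (simp add: lookup_add pconst_add distrib_right sum.distrib)
  finally show ?thesis by (simp add: psubst_superset[of ?A])
qed

lemma psubst_0 [simp]: "psubst f 0 = 0" by (simp add: psubst_def)

lemma psubst_sum: "psubst f (sum g A) = (\<Sum>i\<in>A. psubst f (g i))"
  by (induction A rule: infinite_finite_induct) (simp_all add: psubst_add)

lemma psubst_single: "psubst f (Poly_Mapping.single m c) = pconst c * mono_subst f m"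
  by (subst psubst_superset[of "{m}"]) auto

lemma psubst_mult: "psubst f (p * q) = psubst f p * psubst f q"
proof -
  have "p * q = (\<Sum>m\<in>Poly_Mapping.keys p. Poly_Mapping.single m (Poly_Mapping.lookup p m)) *
      (\<Sum>n\<in>Poly_Mapping.keys q. Poly_Mapping.single n (Poly_Mapping.lookup q n))"
    by (rule arg_cong2[of _ _ _ _ "(*)", OF poly_mapping_sum_single poly_mapping_sum_single])
  also have "\<dots> = (\<Sum>m\<in>Poly_Mapping.keys p. \<Sum>n\<in>Poly_Mapping.keys q.
      Poly_Mapping.single (m + n) (Poly_Mapping.lookup p m * Poly_Mapping.lookup q n))"
    by (simp add: sum_product mult_single)
  finally have "psubst f (p * q) = (\<Sum>m\<in>Poly_Mapping.keys p. \<Sum>n\<in>Poly_Mapping.keys q.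
      (pconst (Poly_Mapping.lookup p m) * mono_subst f m) * (pconst (Poly_Mapping.lookup q n) * mono_subst f n))"
    by (simp add: psubst_sum psubst_single pconst_mult mono_subst_add mult_ac)
  then show ?thesis by (simp add: psubst_def mono_subst_def sum_product)
qed

lemma psubst_pconst [simp]: "psubst f (pconst c) = pconst c"
  unfolding pconst_def by (simp add: psubst_single mono_subst_def pconst_def)

lemma psubst_1 [simp]: "psubst f 1 = 1"
  using psubst_pconst[of f 1] by simp

lemma psubst_uminus: "psubst f (- p) = - psubst f p"
  using psubst_add[of f p "- p"] by (simp add: eq_neg_iff_add_eq_0 add.commute)

lemma psubst_diff: "psubst f (p - q) = psubst f p - psubst f q"
  using psubst_add[of f p "- q"] by (simp add: psubst_uminus)

lemma psubst_of_nat [simp]: "psubst f (of_nat n) = of_nat n"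
  by (induction n) (simp_all add: psubst_add)

lemma psubst_of_int [simp]: "psubst f (of_int k) = of_int k"
  by (cases k) (simp_all add: psubst_uminus psubst_diff)

lemma psubst_pvar [simp]: "psubst f (pvar i) = f i"
  by (simp add: pvar_def psubst_single mono_subst_def)

lemmas psubst_hom = psubst_add psubst_mult psubst_diff psubst_uminus

lemma mono_subst_pvar: "mono_subst pvar m = Poly_Mapping.single m 1"
proof -
  have "pvar i ^ n = Poly_Mapping.single (Poly_Mapping.single i n) 1" for i n
    by (induction n) (simp_all add: pvar_def mult_single flip: single_add)
  then have "mono_subst pvar m = (\<Prod>i\<in>Poly_Mapping.keys m. Poly_Mapping.single (Poly_Mapping.single i (Poly_Mapping.lookup m i)) 1)"
    by (simp add: mono_subst_def)
  also have "\<dots> = Poly_Mapping.single (\<Sum>i\<in>Poly_Mapping.keys m. Poly_Mapping.single i (Poly_Mapping.lookup m i)) 1"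
  proof -
    have "(\<Prod>i\<in>A. Poly_Mapping.single (k i) (1::complex)) = Poly_Mapping.single (\<Sum>i\<in>A. k i) 1"
      for A :: "nat set" and k :: "nat \<Rightarrow> nat \<Rightarrow>\<^sub>0 nat"
      by (induction A rule: infinite_finite_induct) (simp_all add: mult_single)
    then show ?thesis .
  qed
  also have "(\<Sum>i\<in>Poly_Mapping.keys m. Poly_Mapping.single i (Poly_Mapping.lookup m i)) = m"
    by (rule poly_mapping_sum_single[symmetric])
  finally show ?thesis .
qed

lemma psubst_id: "psubst pvar p = p"
proof -
  have "psubst pvar p = (\<Sum>m\<in>Poly_Mapping.keys p. Poly_Mapping.single m (Poly_Mapping.lookup p m))"
    unfolding psubst_def mono_subst_def[symmetric] mono_subst_pvar
    by (simp add: pconst_def mult_single)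
  then show ?thesis using poly_mapping_sum_single[of p] by simp
qed

lemma dvd_prod_diff:
  fixes x y :: "'i \<Rightarrow> 'a::comm_ring_1"
  assumes "\<And>i. i \<in> A \<Longrightarrow> d dvd x i - y i"
  shows "d dvd (\<Prod>i\<in>A. x i) - (\<Prod>i\<in>A. y i)"
  using assms
proof (induction A rule: infinite_finite_induct)
  case (insert i A)
  have "(\<Prod>i\<in>insert i A. x i) - (\<Prod>i\<in>insert i A. y i) =
      (x i - y i) * (\<Prod>i\<in>A. x i) + y i * ((\<Prod>i\<in>A. x i) - (\<Prod>i\<in>A. y i))"
    using insert.hyps by (simp add: algebra_simps)
  moreover have "d dvd x i - y i" "d dvd (\<Prod>i\<in>A. x i) - (\<Prod>i\<in>A. y i)" using insert by auto
  ultimately show ?case by (metis dvd_add dvd_mult dvd_mult2)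
qed simp_all

text \<open>Modulo d every variable equals its substitute, hence so does every polynomial. A
  polynomial killed by the substitution is therefore divisible by d, which replaces a primality
  argument for linear forms.\<close>

lemma psubst_congruent:
  assumes "\<And>i. d dvd pvar i - f i"
  shows "d dvd p - psubst f p"
proof -
  have "d dvd mono_subst pvar m - mono_subst f m" for m
    unfolding mono_subst_def
  proof (rule dvd_prod_diff)
    fix i
    show "d dvd pvar i ^ Poly_Mapping.lookup m i - f i ^ Poly_Mapping.lookup m i"
      using dvd_prod_diff[of "{..<Poly_Mapping.lookup m i}" d "\<lambda>_. pvar i" "\<lambda>_. f i"] assms by simp
  qed
  then have "d dvd psubst pvar p - psubst f p"
    unfolding psubst_def mono_subst_def[symmetric] sum_subtractf[symmetric] right_diff_distrib[symmetric]
    by (intro dvd_sum dvd_mult)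
  then show ?thesis by (simp add: psubst_id)
qed

lemma psubst_eq_0_dvd: "(\<And>i. d dvd pvar i - f i) \<Longrightarrow> psubst f p = 0 \<Longrightarrow> d dvd p"
  using psubst_congruent[of d f p] by simp

lemma lookup_pconst_pvar:
  "Poly_Mapping.lookup (pconst c * pvar i) (Poly_Mapping.single l 1) = (if i = l then c else 0)"
proof -
  have "pconst c * pvar i = Poly_Mapping.single (Poly_Mapping.single i 1) c"
    by (simp add: pvar_def pconst_def mult_single)
  moreover have "Poly_Mapping.single i (1::nat) = Poly_Mapping.single l 1 \<longleftrightarrow> i = l"
    by (metis lookup_single_eq lookup_single_not_eq zero_neq_one)
  ultimately show ?thesis by (simp add: lookup_single when_def)
qed

text \<open>Complex coefficients are allowed because substitution introduces the slope q /
  p.\<close>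

lemma linear_form_nonzero':
  assumes "\<alpha> \<ge> 1" "\<beta> \<ge> 1" "\<alpha> \<noteq> \<beta> \<or> x \<noteq> 0 \<or> y \<noteq> 0"
  shows "pconst x * pvar 0 + pconst y * pvar 1 + avar \<beta> - avar \<alpha> \<noteq> 0"
proof
  assume 0: "pconst x * pvar 0 + pconst y * pvar 1 + avar \<beta> - avar \<alpha> = 0"
  have "pconst x * pvar 0 + pconst y * pvar 1 + avar \<beta> - avar \<alpha> =
      pconst x * pvar 0 + pconst y * pvar 1 + pconst 1 * pvar (\<beta> + 1) - pconst 1 * pvar (\<alpha> + 1)"
    by (simp add: avar_def)
  then have z: "Poly_Mapping.lookup (pconst x * pvar 0 + pconst y * pvar 1 + pconst 1 * pvar (\<beta> + 1) - pconst 1 * pvar (\<alpha> + 1))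
      (Poly_Mapping.single i 1) = 0" for i using 0 by (metis lookup_zero)
  show False
    using z[of 0] z[of 1] z[of "\<beta> + 1"] assms
    unfolding lookup_add lookup_minus lookup_pconst_pvar by (auto split: if_splits)
qed

lemma pconst_of_int: "pconst (of_int k) = of_int k"
  by (simp add: pconst_def)

section \<open>Polynomials in the first variables\<close>

definition poly_ring :: "nat \<Rightarrow> cpoly set" where
  "poly_ring N = {p. pvars p \<subseteq> {..<N}}"

lemma poly_ring_iff: "p \<in> poly_ring N \<longleftrightarrow> (\<forall>m\<in>Poly_Mapping.keys p. Poly_Mapping.keys m \<subseteq> {..<N})"
  by (auto simp: poly_ring_def pvars_def)

lemma poly_ring_pconst: "pconst c \<in> poly_ring N"
  by (auto simp: poly_ring_iff pconst_def)

lemma poly_ring_pvar: "i < N \<Longrightarrow> pvar i \<in> poly_ring N"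
  by (auto simp: poly_ring_iff pvar_def)

lemma poly_ring_add: "p \<in> poly_ring N \<Longrightarrow> q \<in> poly_ring N \<Longrightarrow> p + q \<in> poly_ring N"
  unfolding poly_ring_iff using keys_add[of p q] by blast

lemma poly_ring_mult: "p \<in> poly_ring N \<Longrightarrow> q \<in> poly_ring N \<Longrightarrow> p * q \<in> poly_ring N"
  unfolding poly_ring_iff
proof
  fix m assume pq: "\<forall>m\<in>Poly_Mapping.keys p. Poly_Mapping.keys m \<subseteq> {..<N}" "\<forall>m\<in>Poly_Mapping.keys q. Poly_Mapping.keys m \<subseteq> {..<N}"
    and "m \<in> Poly_Mapping.keys (p * q)"
  then obtain a b where "m = a + b" "a \<in> Poly_Mapping.keys p" "b \<in> Poly_Mapping.keys q" using keys_mult[of p q] by blast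
  then show "Poly_Mapping.keys m \<subseteq> {..<N}" using pq keys_add[of a b] by blast
qed

lemma poly_ring_1: "1 \<in> poly_ring N" using poly_ring_pconst[of 1] by simp
lemma poly_ring_0: "0 \<in> poly_ring N" using poly_ring_pconst[of 0] by simp
lemma poly_ring_of_int: "of_int k \<in> poly_ring N" using poly_ring_pconst[of "of_int k"] by (simp add: pconst_of_int)
lemma poly_ring_uminus: "p \<in> poly_ring N \<Longrightarrow> - p \<in> poly_ring N"
  using poly_ring_mult[OF poly_ring_of_int[of "-1"], of p] by simp
lemma poly_ring_diff: "p \<in> poly_ring N \<Longrightarrow> q \<in> poly_ring N \<Longrightarrow> p - q \<in> poly_ring N"
  using poly_ring_add[of p N "- q"] poly_ring_uminus[of q N] by simp
lemma poly_ring_power: "p \<in> poly_ring N \<Longrightarrow> p ^ n \<in> poly_ring N"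
  by (induction n) (auto intro: poly_ring_1 poly_ring_mult)
lemma poly_ring_sum: "(\<And>i. i \<in> A \<Longrightarrow> f i \<in> poly_ring N) \<Longrightarrow> sum f A \<in> poly_ring N"
  by (induction A rule: infinite_finite_induct) (auto intro: poly_ring_0 poly_ring_add)
lemma poly_ring_prod: "(\<And>i. i \<in> A \<Longrightarrow> f i \<in> poly_ring N) \<Longrightarrow> prod f A \<in> poly_ring N"
  by (induction A rule: infinite_finite_induct) (auto intro: poly_ring_1 poly_ring_mult)

abbreviation restrict_vars :: "nat \<Rightarrow> nat \<Rightarrow> cpoly" where
  "restrict_vars N \<equiv> \<lambda>i. if i < N then pvar i else 0"

lemma psubst_restrict_vars_in: "psubst (restrict_vars N) p \<in> poly_ring N"
  unfolding psubst_def
  by (intro poly_ring_sum poly_ring_mult poly_ring_pconst poly_ring_prod poly_ring_power)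
    (auto intro: poly_ring_pvar poly_ring_0)

lemma psubst_restrict_vars_id:
  assumes "p \<in> poly_ring N"
  shows "psubst (restrict_vars N) p = p"
proof -
  have "psubst (restrict_vars N) p = psubst pvar p"
    unfolding psubst_def
    by (intro sum.cong refl arg_cong2[of _ _ _ _ "(*)"] prod.cong) (use assms in \<open>auto simp: poly_ring_iff\<close>)
  then show ?thesis by (simp add: psubst_id)
qed

text \<open>Setting the variables from N on to 0 fixes v and v p, hence p after cancelling
  v.\<close>

lemma poly_ring_cancel:
  assumes "v \<in> poly_ring N" "v \<noteq> 0" "v * p \<in> poly_ring N"
  shows "p \<in> poly_ring N"
proof -
  have "v * psubst (restrict_vars N) p = v * p"
    using psubst_restrict_vars_id[OF assms(3)] psubst_restrict_vars_id[OF assms(1)] by (simp add: psubst_mult)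
  then show ?thesis using assms(2) psubst_restrict_vars_in[of N p] by simp
qed

section \<open>Local rings of rational functions\<close>

text \<open>The localisation of the polynomial ring at the kernel of the substitution: if f
  parametrises a hyperplane, the functions without a pole along it.\<close>

definition local_ring :: "(nat \<Rightarrow> cpoly) \<Rightarrow> cratfun set" where
  "local_ring f = {Fract p q | p q. psubst f q \<noteq> 0}"

lemma local_ring_to_fract: "to_fract p \<in> local_ring f"
  unfolding local_ring_def to_fract_def by (intro CollectI exI[of _ p] exI[of _ 1]) simp

lemma local_ring_inverse: "psubst f p \<noteq> 0 \<Longrightarrow> inverse (to_fract p) \<in> local_ring f"
  unfolding local_ring_def to_fract_def by (intro CollectI exI[of _ 1] exI[of _ p]) simp

lemma to_fract_of_nat: "to_fract (of_nat n) = of_nat n" by (induction n) simp_all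
lemma to_fract_of_int: "to_fract (of_int k) = of_int k"
  by (cases k) (simp_all add: to_fract_of_nat flip: of_nat_Suc)
lemma to_fract_prod: "to_fract (prod f A) = (\<Prod>i\<in>A. to_fract (f i))"
  by (induction A rule: infinite_finite_induct) simp_all

interpretation local_ring: rat_subring "local_ring f" for f
proof
  have nz: "q \<noteq> 0" if "psubst f q \<noteq> 0" for q using that by auto
  show "1 \<in> local_ring f" using local_ring_to_fract[of 1 f] by simp
  fix x y assume "x \<in> local_ring f" "y \<in> local_ring f"
  then obtain p q p' q' where e: "x = Fract p q" "psubst f q \<noteq> 0" "y = Fract p' q'" "psubst f q' \<noteq> 0"
    by (auto simp: local_ring_def)
  have qq: "psubst f (q * q') \<noteq> 0" using e by (simp add: psubst_mult)
  have "x + y = Fract (p * q' + p' * q) (q * q')" "x * y = Fract (p * p') (q * q')"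
    using e nz by simp_all
  then show "x + y \<in> local_ring f" "x * y \<in> local_ring f" using qq by (auto simp: local_ring_def)
next
  fix x assume "x \<in> local_ring f"
  then obtain p q where "x = Fract p q" "psubst f q \<noteq> 0" by (auto simp: local_ring_def)
  then have "- x = Fract (- p) q" "psubst f q \<noteq> 0" by simp_all
  then show "- x \<in> local_ring f" unfolding local_ring_def by blast
next
  fix n :: nat assume "n > 0"
  then show "inverse (of_nat n) \<in> local_ring f"
    using local_ring_inverse[of f "of_nat n"] by (simp add: to_fract_of_nat)
qed

section \<open>The partition function over the field of rational functions\<close>

abbreviation E1 :: cratfun where "E1 \<equiv> to_fract eps1"
abbreviation E2 :: cratfun where "E2 \<equiv> to_fract eps2"
abbreviation Av :: "nat \<Rightarrow> cratfun" where "Av \<alpha> \<equiv> to_fract (avar \<alpha>)"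

lemma to_fract_linear:
  "of_int k * E1 + of_int l * E2 + Av \<beta> - Av \<alpha> = to_fract (of_int k * eps1 + of_int l * eps2 + avar \<beta> - avar \<alpha>)"
  by (simp add: to_fract_of_int)

interpretation nek: nekrasov_params r E1 E2 Av for r
proof
  fix \<alpha> \<beta> and k l :: int assume "\<alpha> \<in> {1..r}" "\<beta> \<in> {1..r}" "\<alpha> \<noteq> \<beta> \<or> k \<noteq> 0 \<or> l \<noteq> 0"
  then show "of_int k * E1 + of_int l * E2 + Av \<beta> - Av \<alpha> \<noteq> 0"
    unfolding to_fract_linear to_fract_eq_0_iff by (intro linear_form_nonzero) auto
qed

lemma to_fract_nekrasov_factor: "to_fract (nekrasov_factor Y \<alpha> \<beta>) = nek.factor Y \<alpha> \<beta>"
  by (simp add: nekrasov_factor_def nek.factor_def to_fract_prod to_fract_of_int)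

lemma nekrasov_Z_nth: "nekrasov_Z r $ n = nek.Zcoeff r n"
  by (simp add: nekrasov_Z_def nek.Zcoeff_def nek.weight_def to_fract_prod to_fract_nekrasov_factor)

text \<open>Coefficients are compared in q G' = q (log G)' G, so the logarithm never has to be
  expanded.\<close>

lemma fps_log_recursion:
  fixes G :: "'a::field_char_0 fps"
  assumes "G $ 0 = 1"
  shows "of_nat n * G $ n = (\<Sum>i\<le>n. of_nat i * fps_log G $ i * G $ (n - i))"
proof -
  have G1: "(G - 1) $ 0 = 0" using assms by simp
  have "inverse (1 + fps_X) oo (G - 1) = inverse ((1 + fps_X) oo (G - 1))"
    by (rule fps_inverse_compose[OF G1]) simp
  also have "(1 + fps_X) oo (G - 1) = G" using G1 by (simp add: fps_compose_add_distrib)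
  finally have "fps_deriv (fps_log G) = inverse G * fps_deriv G"
    unfolding fps_log_def fps_compose_deriv[OF G1] fps_ln_deriv by simp
  then have "fps_deriv (fps_log G) * G = fps_deriv G * (inverse G * G)" by (simp add: mult_ac)
  then have "fps_X * fps_deriv (fps_log G) * G = fps_X * fps_deriv G"
    using inverse_mult_eq_1[of G] assms by (simp add: mult.assoc)
  then have "(fps_X * fps_deriv G) $ n = (\<Sum>i=0..n. (fps_X * fps_deriv (fps_log G)) $ i * G $ (n - i))"
    by (metis fps_mult_nth)
  moreover have "(fps_X * fps_deriv H) $ i = of_nat i * H $ i" for H :: "'a fps" and i by (cases i) simp_all
  ultimately show ?thesis by (simp add: atMost_atLeast0)
qed

lemma fps_log_nth_0: "fps_log G $ 0 = 0"
  by (simp add: fps_log_def fps_compose_nth)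

text \<open>The recursion expresses n times the n-th coefficient by earlier ones; the only division
  is by n.\<close>

lemma (in rat_subring) fps_log_in_R:
  assumes G: "G $ 0 = 1" "\<And>n. G $ n \<in> R"
  shows "fps_log G $ n \<in> R"
proof (induction n rule: less_induct)
  case (less n)
  show ?case
  proof (cases "n = 0")
    case False
    have "{..n} = insert n {..<n}" by auto
    then have "of_nat n * fps_log G $ n = of_nat n * G $ n - (\<Sum>i<n. of_nat i * fps_log G $ i * G $ (n - i))"
      using fps_log_recursion[OF G(1), of n] G(1) by simp
    also have "\<dots> \<in> R" using less by (intro diff sum mult of_nat G) auto
    finally show ?thesis using cancel_nat False by simp
  qed (simp add: fps_log_nth_0)
qed

lemma F_inst_nth: "F_inst r $ n = E1 * E2 * fps_log (nekrasov_Z r) $ n"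
  by (simp add: F_inst_def)

section \<open>Regularity along each hyperplane\<close>

lemma psubst_avar: "\<alpha> \<ge> 1 \<Longrightarrow> psubst (pvar(0 := s)) (avar \<alpha>) = avar \<alpha>"
  and psubst_avar': "\<alpha> \<ge> 1 \<Longrightarrow> psubst (pvar(1 := s)) (avar \<alpha>) = avar \<alpha>"
  by (simp_all add: avar_def)

lemma F_inst_regular_cluster:
  assumes "p > 0" "q > 0" "r \<ge> 1"
  shows "F_inst r $ n \<in> local_ring (pvar(0 := pconst (of_nat q / of_nat p) * pvar 1))"
proof -
  let ?f = "pvar(0 := pconst (of_nat q / of_nat p) * pvar 1)"
  \<comment> \<open>The substitution imposes e1 = (q / p) e2. In the common unit w = e2 / p the
    parameters become q and p, up to v, which is the part that vanishes.\<close>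
  let ?w = "to_fract (pconst (1 / of_nat p) * pvar 1)"
  let ?v = "to_fract (eps1 - pconst (of_nat q / of_nat p) * eps2)"
  have pc: "of_nat k = pconst (of_nat k)" for k using pconst_of_int[of "int k"] by simp
  interpret nekrasov_cluster r E1 E2 Av "local_ring ?f" ?v ?w p q
  proof
    show "E1 = of_nat q * ?w + ?v"
      by (simp add: pc pconst_mult[symmetric] mult.assoc[symmetric] eps2_def flip: to_fract_of_nat to_fract_mult to_fract_add)
    show "E2 = of_nat p * ?w"
      using assms(1) by (simp add: pc pconst_mult[symmetric] mult.assoc[symmetric] eps2_def flip: to_fract_of_nat to_fract_mult)
    fix \<alpha> \<beta> and k l :: int assume \<alpha>\<beta>: "\<alpha> \<in> {1..r}" "\<beta> \<in> {1..r}" and kl: "\<alpha> \<noteq> \<beta> \<or> int q * k + int p * l \<noteq> 0"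
    have "psubst ?f (of_int k * eps1 + of_int l * eps2 + avar \<beta> - avar \<alpha>) =
        pconst 0 * pvar 0 + pconst (of_int k * (of_nat q / of_nat p) + of_int l) * pvar 1 + avar \<beta> - avar \<alpha>"
    proof -
      have "pconst (of_int k * (of_nat q / of_nat p) + of_int l) * pvar 1 =
          of_int k * (pconst (of_nat q / of_nat p) * pvar 1) + of_int l * pvar 1"
        by (simp only: pconst_add pconst_mult pconst_of_int distrib_right mult.assoc)
      then show ?thesis using \<alpha>\<beta> by (simp add: psubst_hom psubst_avar eps1_def eps2_def)
    qed
    also have "\<dots> \<noteq> 0"
    proof (rule linear_form_nonzero')
      \<comment> \<open>After substitution the coefficient of e2 is the height q k + p l divided by
        p.\<close>
      have "of_int k * (of_nat q / of_nat p) + of_int l = (of_int (int q * k + int p * l) / of_nat p :: complex)"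
        using assms(1) by (simp add: field_simps)
      then show "\<alpha> \<noteq> \<beta> \<or> (0::complex) \<noteq> 0 \<or> of_int k * (of_nat q / of_nat p) + of_int l \<noteq> (0::complex)"
        using kl assms(1) by (simp del: of_int_add of_int_mult)
    qed (use \<alpha>\<beta> in auto)
    finally show "inverse (of_int k * E1 + of_int l * E2 + Av \<beta> - Av \<alpha>) \<in> local_ring ?f"
      unfolding to_fract_linear by (rule local_ring_inverse)
  qed (use assms local_ring_to_fract in auto)
  have "fps_log (nekrasov_Z r) $ n \<in> local_ring ?f"
    using Zcoeff_in_R unfolding nekrasov_Z_nth[symmetric] by (rule local_ring.fps_log_in_R[OF nekrasov_Z_nth_0])
  then show ?thesis unfolding F_inst_nth by (intro local_ring.mult local_ring_to_fract)
qed

text \<open>The factor \<open>E1\<close> cancels the simple pole of log Z along e1 = 0.\<close>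

lemma F_inst_regular_eps1:
  assumes "n \<ge> 1"
  shows "F_inst r $ n \<in> local_ring (pvar(0 := 0))"
proof -
  interpret nekrasov_axis r E1 E2 Av "local_ring (pvar(0 := 0))"
  proof
    fix \<alpha> \<beta> and k l :: int assume \<alpha>\<beta>: "\<alpha> \<in> {1..r}" "\<beta> \<in> {1..r}" and l: "\<alpha> \<noteq> \<beta> \<or> l \<noteq> 0"
    have "psubst (pvar(0 := 0)) (of_int k * eps1 + of_int l * eps2 + avar \<beta> - avar \<alpha>) =
        pconst 0 * pvar 0 + pconst (of_int l) * pvar 1 + avar \<beta> - avar \<alpha>"
      using \<alpha>\<beta> by (simp add: psubst_hom psubst_avar eps1_def eps2_def pconst_of_int)
    also have "\<dots> \<noteq> 0" by (rule linear_form_nonzero') (use \<alpha>\<beta> l in auto)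
    finally show "inverse (of_int k * E1 + of_int l * E2 + Av \<beta> - Av \<alpha>) \<in> local_ring (pvar(0 := 0))"
      unfolding to_fract_linear by (rule local_ring_inverse)
  qed (use local_ring_to_fract in auto)
  have "E1 * fps_log (nekrasov_Z r) $ n \<in> local_ring (pvar(0 := 0))"
    using fps_log_recursion[OF nekrasov_Z_nth_0[of r]] assms unfolding nekrasov_Z_nth by (rule log_coeff_in_R)
  from local_ring.mult[OF local_ring_to_fract[of eps2] this] show ?thesis by (simp add: F_inst_nth mult_ac)
qed

lemma F_inst_regular_eps2:
  assumes "n \<ge> 1"
  shows "F_inst r $ n \<in> local_ring (pvar(1 := 0))"
proof -
  have "nekrasov_params r E1 E2 Av" by unfold_locales
  note swap = nekrasov_params_swap[OF this]
  interpret sw: nekrasov_params r E2 E1 Av by (rule swap(1))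
  interpret nekrasov_axis r E2 E1 Av "local_ring (pvar(1 := 0))"
  proof
    fix \<alpha> \<beta> and k l :: int assume \<alpha>\<beta>: "\<alpha> \<in> {1..r}" "\<beta> \<in> {1..r}" and l: "\<alpha> \<noteq> \<beta> \<or> l \<noteq> 0"
    have "psubst (pvar(1 := 0)) (of_int l * eps1 + of_int k * eps2 + avar \<beta> - avar \<alpha>) =
        pconst (of_int l) * pvar 0 + pconst 0 * pvar 1 + avar \<beta> - avar \<alpha>"
      using \<alpha>\<beta> by (simp add: psubst_hom psubst_avar'[simplified] eps1_def eps2_def pconst_of_int)
    also have "\<dots> \<noteq> 0" by (rule linear_form_nonzero') (use \<alpha>\<beta> l in auto)
    finally have "inverse (of_int l * E1 + of_int k * E2 + Av \<beta> - Av \<alpha>) \<in> local_ring (pvar(1 := 0))"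
      unfolding to_fract_linear by (rule local_ring_inverse)
    then show "inverse (of_int k * E2 + of_int l * E1 + Av \<beta> - Av \<alpha>) \<in> local_ring (pvar(1 := 0))"
      by (simp add: add.commute)
  qed (use local_ring_to_fract in auto)
  have "nekrasov_Z r $ n = sw.Zcoeff n" for n unfolding nekrasov_Z_nth swap(2) ..
  then have "E2 * fps_log (nekrasov_Z r) $ n \<in> local_ring (pvar(1 := 0))"
    using fps_log_recursion[OF nekrasov_Z_nth_0[of r]] assms by (intro log_coeff_in_R) auto
  from local_ring.mult[OF local_ring_to_fract[of eps1] this] show ?thesis by (simp add: F_inst_nth mult_ac)
qed

text \<open>The sign condition comes from the factors with \<alpha> = \<beta>, whose coefficients
  are -leg and arm + 1, or leg + 1 and -arm. It ensures that off the axes the slope q / p is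
  positive.\<close>

definition hyperplane_forms :: "cpoly set" where
  "hyperplane_forms = {of_int k * eps1 + of_int l * eps2 | k l. k * l \<le> 0 \<and> (k \<noteq> 0 \<or> l \<noteq> 0)}"

lemma dvd_pconst_mult: "c \<noteq> 0 \<Longrightarrow> d dvd P \<Longrightarrow> pconst c * d dvd P"
proof -
  assume c: "c \<noteq> 0" "d dvd P"
  have "pconst c * pconst (1 / c) = 1" using c(1) by (simp flip: pconst_mult)
  moreover obtain e where "P = d * e" using c(2) by (rule dvdE)
  ultimately have "P = (pconst c * d) * (pconst (1 / c) * e)" by (metis mult.assoc mult.commute mult_1)
  then show ?thesis by (rule dvdI)
qed

lemma hyperplane_regular:
  assumes "v \<in> hyperplane_forms" "r \<ge> 1" "n \<ge> 1"
  obtains f where "psubst f v = 0" "\<And>P. psubst f P = 0 \<Longrightarrow> v dvd P" "F_inst r $ n \<in> local_ring f"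
proof -
  obtain k l where v: "v = of_int k * eps1 + of_int l * eps2" and kl: "k * l \<le> 0" "k \<noteq> 0 \<or> l \<noteq> 0"
    using assms(1) by (auto simp: hyperplane_forms_def)
  have dvd: "pvar i - s dvd P" if "psubst (pvar(i := s)) P = 0" for i s P
    by (rule psubst_eq_0_dvd[OF _ that]) simp
  have pcd: "of_int k * d dvd P" if "k \<noteq> 0" "d dvd P" for k and d P :: cpoly
    using dvd_pconst_mult[of "of_int k" d P] that by (simp add: pconst_of_int)
  consider "l = 0" | "k = 0" | "k \<noteq> 0" "l \<noteq> 0" by blast
  then show ?thesis
  proof cases
    case 1
    show ?thesis
    proof
      show "psubst (pvar(0 := 0)) v = 0" by (simp add: v 1 eps1_def psubst_hom)
      show "v dvd P" if "psubst (pvar(0 := 0)) P = 0" for P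
        using pcd[of k eps1 P] dvd[OF that] kl 1 by (simp add: v eps1_def)
    qed (rule F_inst_regular_eps1[OF assms(3)])
  next
    case 2
    show ?thesis
    proof
      show "psubst (pvar(1 := 0)) v = 0" by (simp add: v 2 eps2_def psubst_hom)
      show "v dvd P" if "psubst (pvar(1 := 0)) P = 0" for P
        using pcd[of l eps2 P] dvd[OF that] kl 2 by (simp add: v eps2_def)
    qed (rule F_inst_regular_eps2[OF assms(3)])
  next
    case 3
    \<comment> \<open>As k and l have opposite signs, v is k times e1 - (q / p) e2.\<close>
    define p q where "p = nat \<bar>k\<bar>" and "q = nat \<bar>l\<bar>"
    have pq: "p > 0" "q > 0" using 3 by (auto simp: p_def q_def)
    let ?s = "pconst (of_nat q / of_nat p) * pvar 1"
    have "int q * k = - (int p * l)"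
      using kl 3 by (cases "k > 0") (auto simp: p_def q_def mult_le_0_iff algebra_simps)
    then have "of_int (int q * k) = (of_int (- (int p * l)) :: complex)" by simp
    then have "of_int k * (of_nat q / of_nat p) = - (of_int l :: complex)"
      using pq by (simp add: field_simps)
    then have "pconst (of_int k) * pconst (of_nat q / of_nat p) = - of_int l"
      by (simp flip: pconst_mult add: pconst_of_int[of "- l", simplified])
    then have v': "v = of_int k * (pvar 0 - ?s)"
      by (simp add: v eps1_def eps2_def right_diff_distrib mult.assoc[symmetric] pconst_of_int)
    show ?thesis
    proof
      show "psubst (pvar(0 := ?s)) v = 0" by (simp add: v' psubst_hom)
      show "v dvd P" if "psubst (pvar(0 := ?s)) P = 0" for P
        using pcd[of k "pvar 0 - ?s" P] dvd[OF that] 3 by (simp add: v')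
    qed (rule F_inst_regular_cluster[OF pq assms(2)])
  qed
qed

section \<open>Clearing the denominators\<close>

text \<open>The hyperplane forms are kept as a list so that they can be cancelled one at a time; B
  is the part that survives at e1 = e2 = 0. Being a subring, this set contains the coefficients of
  log Z along with those of Z.\<close>

definition split_denominator_ring :: "nat \<Rightarrow> cratfun set" where
  "split_denominator_ring r = {Fract P (prod_list vs * B) | P vs B. P \<in> poly_ring (r + 2) \<and> B \<in> poly_ring (r + 2) \<and>
     set vs \<subseteq> hyperplane_forms \<and> set_eps_zero B \<noteq> 0}"

lemma split_denominator_ringI:
  "P \<in> poly_ring (r + 2) \<Longrightarrow> B \<in> poly_ring (r + 2) \<Longrightarrow> set vs \<subseteq> hyperplane_forms \<Longrightarrow> set_eps_zero B \<noteq> 0 \<Longrightarrow>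
    Fract P (prod_list vs * B) \<in> split_denominator_ring r"
  unfolding split_denominator_ring_def by blast

lemma hyperplane_forms_neq_0: "v \<in> hyperplane_forms \<Longrightarrow> v \<noteq> 0"
  using linear_form_nonzero[of 1 1] by (auto simp: hyperplane_forms_def)

lemma hyperplane_forms_poly_ring: "v \<in> hyperplane_forms \<Longrightarrow> v \<in> poly_ring (r + 2)"
  unfolding hyperplane_forms_def eps1_def eps2_def
  by (auto intro!: poly_ring_add poly_ring_mult poly_ring_of_int poly_ring_pvar)

lemma set_eps_zero_mult: "set_eps_zero (p * q) = set_eps_zero p * set_eps_zero q"
  by (simp add: set_eps_zero_def psubst_mult)

lemma set_eps_zero_1: "set_eps_zero 1 = 1"
  by (simp add: set_eps_zero_def)

lemma denominator_neq_0:
  assumes "set vs \<subseteq> hyperplane_forms" "set_eps_zero B \<noteq> 0"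
  shows "prod_list vs * B \<noteq> 0"
proof -
  have "B \<noteq> 0" using assms(2) by (auto simp: set_eps_zero_def)
  moreover have "prod_list vs \<noteq> 0" using assms(1) hyperplane_forms_neq_0 by (auto simp: prod_list_zero_iff)
  ultimately show ?thesis by simp
qed

lemma prod_list_poly_ring: "set vs \<subseteq> hyperplane_forms \<Longrightarrow> prod_list vs \<in> poly_ring (r + 2)"
proof (induction vs)
  case (Cons v vs)
  then have "v \<in> poly_ring (r + 2)" "prod_list vs \<in> poly_ring (r + 2)" using hyperplane_forms_poly_ring by auto
  then show ?case unfolding prod_list.Cons by (rule poly_ring_mult)
qed (simp add: poly_ring_1)

interpretation split_denominator_ring: rat_subring "split_denominator_ring r" for r
proof
  have const: "to_fract (pconst c) \<in> split_denominator_ring r" for c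
    using split_denominator_ringI[OF poly_ring_pconst poly_ring_1, of "[]" c r]
    by (simp add: set_eps_zero_1 to_fract_def)
  show "1 \<in> split_denominator_ring r" using const[of 1] by simp
  show "inverse (of_nat n) \<in> split_denominator_ring r" if "n > 0" for n
  proof -
    have "to_fract (pconst (1 / of_nat n)) * of_nat n = to_fract (pconst (1 / of_nat n) * pconst (of_nat n))"
      using pconst_of_int[of "int n"] by (simp add: to_fract_of_nat)
    also have "\<dots> = 1" using that by (simp flip: pconst_mult)
    finally show ?thesis using const[of "1 / of_nat n"] that by (metis inverse_unique mult.commute)
  qed
  fix x y assume "x \<in> split_denominator_ring r" "y \<in> split_denominator_ring r"
  then obtain P vs B P' vs' B' where e: "x = Fract P (prod_list vs * B)" "y = Fract P' (prod_list vs' * B')"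
    and R: "P \<in> poly_ring (r + 2)" "B \<in> poly_ring (r + 2)" "P' \<in> poly_ring (r + 2)" "B' \<in> poly_ring (r + 2)"
    and vs: "set vs \<subseteq> hyperplane_forms" "set vs' \<subseteq> hyperplane_forms" and B: "set_eps_zero B \<noteq> 0" "set_eps_zero B' \<noteq> 0"
    by (auto simp: split_denominator_ring_def)
  note nz = denominator_neq_0[OF vs(1) B(1)] denominator_neq_0[OF vs(2) B(2)]
  have d: "(prod_list vs * B) * (prod_list vs' * B') = prod_list (vs @ vs') * (B * B')" by (simp add: mult_ac)
  have "x + y = Fract (P * (prod_list vs' * B') + P' * (prod_list vs * B)) (prod_list (vs @ vs') * (B * B'))"
    "x * y = Fract (P * P') (prod_list (vs @ vs') * (B * B'))"
    unfolding e d[symmetric] using nz by simp_all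
  moreover have "set (vs @ vs') \<subseteq> hyperplane_forms" "set_eps_zero (B * B') \<noteq> 0" "B * B' \<in> poly_ring (r + 2)"
    "P * (prod_list vs' * B') + P' * (prod_list vs * B) \<in> poly_ring (r + 2)" "P * P' \<in> poly_ring (r + 2)"
    using R vs B by (auto intro!: poly_ring_add poly_ring_mult prod_list_poly_ring simp del: add_2_eq_Suc' simp: set_eps_zero_mult)
  ultimately show "x + y \<in> split_denominator_ring r" "x * y \<in> split_denominator_ring r"
    by (metis split_denominator_ringI)+
  have "- x = Fract (- P) (prod_list vs * B)" by (simp add: e)
  then show "- x \<in> split_denominator_ring r"
    using split_denominator_ringI[OF poly_ring_uminus[OF R(1)] R(2) vs(1) B(1)] by simp
qed

lemma split_denominator_ring_poly: "P \<in> poly_ring (r + 2) \<Longrightarrow> to_fract P \<in> split_denominator_ring r"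
  using split_denominator_ringI[OF _ poly_ring_1, of P r "[]"] by (simp add: set_eps_zero_1 to_fract_def)

lemma split_denominator_ring_inverse:
  assumes "\<alpha> \<in> {1..r}" "\<beta> \<in> {1..r}" "\<alpha> \<noteq> \<beta> \<or> (k * l \<le> 0 \<and> (k \<noteq> 0 \<or> l \<noteq> 0))"
  shows "inverse (of_int k * E1 + of_int l * E2 + Av \<beta> - Av \<alpha>) \<in> split_denominator_ring r"
proof (cases "\<alpha> = \<beta>")
  case True
  let ?v = "of_int k * eps1 + of_int l * eps2"
  have "?v \<in> hyperplane_forms" using assms True by (auto simp: hyperplane_forms_def)
  then have "Fract 1 (prod_list [?v] * 1) \<in> split_denominator_ring r"
    by (intro split_denominator_ringI poly_ring_1) (auto simp: set_eps_zero_1)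
  then show ?thesis unfolding to_fract_linear using True by (simp add: to_fract_def)
next
  case False
  let ?B = "of_int k * eps1 + of_int l * eps2 + avar \<beta> - avar \<alpha>"
  have "set_eps_zero ?B = pconst 0 * pvar 0 + pconst 0 * pvar 1 + avar \<beta> - avar \<alpha>"
    using assms(1,2) by (simp add: set_eps_zero_def psubst_hom eps1_def eps2_def avar_def)
  also have "\<dots> \<noteq> 0" by (rule linear_form_nonzero') (use assms False in auto)
  finally have "set_eps_zero ?B \<noteq> 0" .
  moreover have "?B \<in> poly_ring (r + 2)"
    unfolding eps1_def eps2_def avar_def using assms(1,2)
    by (intro poly_ring_add poly_ring_diff poly_ring_mult poly_ring_of_int poly_ring_pvar) auto
  ultimately have "Fract 1 (prod_list [] * ?B) \<in> split_denominator_ring r"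
    by (intro split_denominator_ringI poly_ring_1) auto
  then show ?thesis unfolding to_fract_linear by (simp add: to_fract_def)
qed

lemma weight_split_denominator:
  assumes "Y \<in> young_tuples r n"
  shows "nek.weight r Y \<in> split_denominator_ring r"
proof -
  have yd: "Y \<alpha> \<in> young_diagrams" if "\<alpha> \<in> {1..r}" for \<alpha> using assms that by (auto simp: young_tuples_def)
  have "inverse (nek.factor Y \<alpha> \<beta>) \<in> split_denominator_ring r" if \<alpha>\<beta>: "\<alpha> \<in> {1..r}" "\<beta> \<in> {1..r}" for \<alpha> \<beta>
    unfolding nek.factor_def inverse_mult_distrib prod_inversef[symmetric] comp_def
  proof (intro split_denominator_ring.mult split_denominator_ring.prod)
    fix s assume s: "s \<in> Y \<alpha>"
    have "\<alpha> \<noteq> \<beta> \<or> (- leg (Y \<beta>) s * (arm (Y \<alpha>) s + 1) \<le> 0 \<and> (- leg (Y \<beta>) s \<noteq> 0 \<or> arm (Y \<alpha>) s + 1 \<noteq> 0))"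
      using leg_arm_nonneg[OF yd[OF \<alpha>\<beta>(1)] s] by auto
    from split_denominator_ring_inverse[OF \<alpha>\<beta> this]
    show "inverse (- of_int (leg (Y \<beta>) s) * E1 + of_int (arm (Y \<alpha>) s + 1) * E2 + Av \<beta> - Av \<alpha>) \<in> split_denominator_ring r"
      by simp
  next
    fix t assume t: "t \<in> Y \<beta>"
    have "\<alpha> \<noteq> \<beta> \<or> ((leg (Y \<alpha>) t + 1) * (- arm (Y \<beta>) t) \<le> 0 \<and> (leg (Y \<alpha>) t + 1 \<noteq> 0 \<or> - arm (Y \<beta>) t \<noteq> 0))"
      using leg_arm_nonneg[OF yd[OF \<alpha>\<beta>(2)] t] by auto
    from split_denominator_ring_inverse[OF \<alpha>\<beta> this]
    show "inverse (of_int (leg (Y \<alpha>) t + 1) * E1 - of_int (arm (Y \<beta>) t) * E2 + Av \<beta> - Av \<alpha>) \<in> split_denominator_ring r"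
      by simp
  qed
  then show ?thesis
    unfolding nek.weight_def divide_inverse prod_inversef[symmetric] comp_def mult_1_left
    by (intro split_denominator_ring.prod) auto
qed

lemma F_inst_split_denominator: "F_inst r $ n \<in> split_denominator_ring r"
proof -
  have "fps_log (nekrasov_Z r) $ n \<in> split_denominator_ring r"
  proof (rule split_denominator_ring.fps_log_in_R)
    show "nekrasov_Z r $ n \<in> split_denominator_ring r" for n
      unfolding nekrasov_Z_nth nek.Zcoeff_def by (intro split_denominator_ring.sum weight_split_denominator)
  qed (rule nekrasov_Z_nth_0)
  moreover have "E1 \<in> split_denominator_ring r" "E2 \<in> split_denominator_ring r"
    by (intro split_denominator_ring_poly; simp add: eps1_def eps2_def poly_ring_pvar)+
  ultimately show ?thesis unfolding F_inst_nth by (intro split_denominator_ring.mult)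
qed

text \<open>If P / (v X) equals p / q with q nonzero on the hyperplane, then P q = p v X vanishes
  there, hence so does P, and v divides P. Cancelling v shortens the list.\<close>

lemma cancel_hyperplanes:
  assumes "F = Fract P (prod_list vs * B)" "P \<in> poly_ring (r + 2)" "set vs \<subseteq> hyperplane_forms" "set_eps_zero B \<noteq> 0"
    and "\<And>v. v \<in> hyperplane_forms \<Longrightarrow> \<exists>f. psubst f v = 0 \<and> (\<forall>P. psubst f P = 0 \<longrightarrow> v dvd P) \<and> F \<in> local_ring f"
  shows "\<exists>P'\<in>poly_ring (r + 2). F = Fract P' B"
  using assms(1-3)
proof (induction vs arbitrary: P)
  case (Cons v vs)
  let ?X = "prod_list vs * B"
  have v: "v \<in> hyperplane_forms" "set vs \<subseteq> hyperplane_forms" using Cons.prems by auto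
  have nz: "v \<noteq> 0" "?X \<noteq> 0" using hyperplane_forms_neq_0[OF v(1)] denominator_neq_0[OF v(2) assms(4)] by auto
  obtain f where f: "psubst f v = 0" "\<And>P. psubst f P = 0 \<Longrightarrow> v dvd P" "F \<in> local_ring f" using assms(5)[OF v(1)] by blast
  obtain p q where pq: "F = Fract p q" "psubst f q \<noteq> 0" using f(3) by (auto simp: local_ring_def)
  have q: "q \<noteq> 0" using pq(2) by auto
  have F: "F = Fract P (v * ?X)" using Cons.prems(1) by (simp add: mult.assoc)
  then have "P * q = p * (v * ?X)" using pq(1) q nz by (simp add: eq_fract)
  then have "psubst f P * psubst f q = 0" using f(1) by (metis mult_zero_left mult_zero_right psubst_mult)
  then have "v dvd P" using f(2) pq(2) by simp
  then obtain P'' where P: "P = v * P''" by (auto elim: dvdE)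
  have "P'' \<in> poly_ring (r + 2)"
    using poly_ring_cancel[OF hyperplane_forms_poly_ring[OF v(1)] nz(1)] Cons.prems(2) P by simp
  moreover have "F = Fract P'' ?X" unfolding F P using nz by (simp add: eq_fract)
  ultimately show ?case using Cons.IH v(2) by blast
qed auto

theorem proposition7p3:
  fixes r :: nat
  assumes "r \<ge> 1"
  shows "fps_nth (F_inst r) 0 = 0 \<and> (\<forall>n\<ge>1. regular_at_eps_zero r (fps_nth (F_inst r) n))"
proof (intro conjI allI impI)
  show "fps_nth (F_inst r) 0 = 0" by (simp add: F_inst_nth fps_log_nth_0)
next
  fix n :: nat assume n: "n \<ge> 1"
  obtain P vs B where F: "F_inst r $ n = Fract P (prod_list vs * B)" "P \<in> poly_ring (r + 2)" "B \<in> poly_ring (r + 2)"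
    "set vs \<subseteq> hyperplane_forms" "set_eps_zero B \<noteq> 0"
    using F_inst_split_denominator[of r n] by (auto simp: split_denominator_ring_def)
  have "\<exists>f. psubst f v = 0 \<and> (\<forall>P. psubst f P = 0 \<longrightarrow> v dvd P) \<and> F_inst r $ n \<in> local_ring f"
    if "v \<in> hyperplane_forms" for v
    using hyperplane_regular[OF that assms n] by metis
  then obtain P' where "P' \<in> poly_ring (r + 2)" "F_inst r $ n = Fract P' B"
    using cancel_hyperplanes[OF F(1,2,4,5)] by blast
  then show "regular_at_eps_zero r (fps_nth (F_inst r) n)"
    unfolding regular_at_eps_zero_def using F(3,5) by (auto simp: poly_ring_def)
qed

end
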